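(* There exists a countable relational language $\mathcal{L}$, having no nullary relational symbols, such that the presheaf topos $\mathcal{E}_{\mathcal{L}}$ (the encoding topos of $\mathcal{L}$) has proper class many mutually non-isomorphic inhabited-topos-rigid objects. As a consequence, $\mathcal{E}_{\mathcal{L}}$ has proper class many mutually non-equivalent quotient topoi.
   Context: "Proper class many mutually non-isomorphic (resp. non-equivalent)" means that the isomorphism (resp. equivalence) classes do not form a small set: no set of such items contains a representative of every class. A relational language $\mathcal{L}=\{Q_\lambda\}_{\lambda\in\Lambda}$ is a set of relational symbols, each with an arity $n_\lambda\in\mathbb{Z}_{\ge 0}$; a symbol is nullary if $n_\lambda=0$. Encoding topos. The encoding graph of $\mathcal{L}$ is the directed graph with vertex set $\{v\}\sqcup\{v_\lambda\}_{\lambda\in\Lambda}$ and with edges: $p^n_i\colon v\to v$ for $0\le i<n\le\omega$ (with $i\in\mathbb{N}$ and $n$ a natural number or $\omega$); $p'^n_i\colon v\to v$ for $0\le i<n<\omega$; $s'_\lambda\colon v_\lambda\to v$ and $r_\lambda\colon v\to v_\lambda$ for $\lambda\in\Lambda$. The encoding topos $\mathcal{E}_{\mathcal{L}}$ is the full subcategory of the category of covariant functors $\mathbb{X}$ from the free category on this graph to $\mathbf{Set}$ consisting of those with $\mathbb{X}(r_\lambda)\circ\mathbb{X}(s'_\lambda)=\mathrm{id}$ for all $\lambda$. Equivalently $\mathcal{E}_{\mathcal{L}}\simeq[\mathcal{C}_{\mathcal{L}},\mathbf{Set}]$, where $\mathcal{C}_{\mathcal{L}}$ is the category generated by the graph subject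 to the relations $r_\lambda\circ s'_\lambda=\mathrm{id}$. Inhabited-topos-rigidity. Let $\mathbf{FinSet}^{\circ}$ be the category of non-empty finite sets, $\mathbb{A}^{\circ}=[\mathbf{FinSet}^{\circ},\mathbf{Set}]$ the covariant functor category, and $\mathscr{X}^{\circ}\in\mathbb{A}^{\circ}$ the inclusion functor $\mathbf{FinSet}^{\circ}\to\mathbf{Set}$. An object $X$ of a topos is inhabited if $X\to 1$ is an epimorphism. For every Grothendieck topos $\mathcal{E}$, $f\mapsto f^*(\mathscr{X}^{\circ})$ is an equivalence between the category of geometric morphisms $\mathcal{E}\to\mathbb{A}^{\circ}$ (with natural transformations between inverse images) and the full subcategory of inhabited objects of $\mathcal{E}$. A geometric morphism $f$ is connected if $f^*$ is fully faithful. An object $X$ of $\mathcal{E}$ is inhabited-topos-rigid if it is inhabited and the corresponding geometric morphism $\mathcal{E}\to\mathbb{A}^{\circ}$ is connected. Quotient topoi. A quotient topos of $\mathcal{E}$ is a connected geometric morphism with domain $\mathcal{E}$; two quotient topoi $f\colon\mathcal{E}\to\mathcal{F}$ and $f'\colon\mathcal{E}\to\mathcal{F}'$ are equivalent if there is an equivalence of categories $e\colon\mathcal{F}\to\mathcal{F}'$ with $e\circ f\cong f'$. *)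

theory Defs
  imports
    "HOL-Library.FuncSet"
    "HOL-Library.Equipollence"
    "HOL-Library.Countable_Set"
    "HOL-Library.Extended_Nat"
    "Graph_Theory.Arc_Walk"
begin

section \<open>Smallness\<close>

text \<open>
  HOL has no proper classes. A type \<open>'u\<close> whose cardinality is a strongly inaccessible cardinal plays
  the role of the set-theoretic universe: sets are the collections of cardinality less than that
  of \<open>'u\<close>, classes are arbitrary collections. Equivalently, up to a bijection \<open>'u\<close> is a
  Grothendieck universe containing an infinite set, i.e. a model of second-order ZFC.
  HOL does not prove that such a type exists, so inaccessibility is an explicit hypothesis
  wherever it is used. Constants whose type does not determine \<open>'u\<close> take it as
  an \<open>itself\<close> argument.
\<close>

definition small :: "'u itself \<Rightarrow> 'a set \<Rightarrow> bool" where
  "small _ A \<longleftrightarrow> A \<prec> (UNIV :: 'u set)"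

definition inaccessible :: "'u itself \<Rightarrow> bool" where
  "inaccessible U \<longleftrightarrow>
     uncountable (UNIV :: 'u set) \<and>
     (\<forall>A :: 'u set. small U A \<longrightarrow> small U (Pow A)) \<and>
     (\<forall>(A :: 'u set) (B :: 'u \<Rightarrow> 'u set). small U A \<and> (\<forall>x\<in>A. small U (B x)) \<longrightarrow> small U (\<Union>x\<in>A. B x))"

definition proper_class_many :: "'u itself \<Rightarrow> 'a set \<Rightarrow> ('a \<Rightarrow> 'a \<Rightarrow> bool) \<Rightarrow> bool" where
  "proper_class_many U K R \<longleftrightarrow> \<not> (\<exists>S. S \<subseteq> K \<and> small U S \<and> (\<forall>x\<in>K. \<exists>y\<in>S. R x y))"


section \<open>Categories\<close>

record ('o, 'm) cat =
  Obj :: "'o set"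
  Arr :: "'m set"
  Dom :: "'m \<Rightarrow> 'o"
  Cod :: "'m \<Rightarrow> 'o"
  Ide :: "'o \<Rightarrow> 'm"
  Comp :: "'m \<Rightarrow> 'm \<Rightarrow> 'm"  \<comment> \<open>\<open>Comp C g f\<close> is \<open>g\<close> after \<open>f\<close>\<close>

definition Hom :: "('o, 'm) cat \<Rightarrow> 'o \<Rightarrow> 'o \<Rightarrow> 'm set" where
  "Hom C a b = {f \<in> Arr C. Dom C f = a \<and> Cod C f = b}"

definition category :: "('o, 'm) cat \<Rightarrow> bool" where
  "category C \<longleftrightarrow>
     (\<forall>f\<in>Arr C. Dom C f \<in> Obj C \<and> Cod C f \<in> Obj C) \<and>
     (\<forall>a\<in>Obj C. Ide C a \<in> Hom C a a) \<and>
     (\<forall>f\<in>Arr C. \<forall>g\<in>Arr C. Cod C f = Dom C g \<longrightarrow> Comp C g f \<in> Hom C (Dom C f) (Cod C g)) \<and>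
     (\<forall>f\<in>Arr C. Comp C f (Ide C (Dom C f)) = f \<and> Comp C (Ide C (Cod C f)) f = f) \<and>
     (\<forall>f\<in>Arr C. \<forall>g\<in>Arr C. \<forall>h\<in>Arr C. Cod C f = Dom C g \<and> Cod C g = Dom C h \<longrightarrow>
        Comp C h (Comp C g f) = Comp C (Comp C h g) f)"

definition opposite :: "('o, 'm) cat \<Rightarrow> ('o, 'm) cat" where
  "opposite C = \<lparr>Obj = Obj C, Arr = Arr C, Dom = Cod C, Cod = Dom C, Ide = Ide C,
     Comp = (\<lambda>g f. Comp C f g)\<rparr>"

definition full_subcategory :: "('o, 'm) cat \<Rightarrow> 'o set \<Rightarrow> ('o, 'm) cat" where
  "full_subcategory C K = C\<lparr>Obj := Obj C \<inter> K, Arr := {f \<in> Arr C. Dom C f \<in> K \<and> Cod C f \<in> K}\<rparr>"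

definition isomorphic :: "('o, 'm) cat \<Rightarrow> 'o \<Rightarrow> 'o \<Rightarrow> bool" where
  "isomorphic C a b \<longleftrightarrow> a \<in> Obj C \<and> b \<in> Obj C \<and>
     (\<exists>f\<in>Hom C a b. \<exists>g\<in>Hom C b a. Comp C g f = Ide C a \<and> Comp C f g = Ide C b)"

definition epi :: "('o, 'm) cat \<Rightarrow> 'm \<Rightarrow> bool" where
  "epi C f \<longleftrightarrow> f \<in> Arr C \<and>
     (\<forall>b. \<forall>g\<in>Hom C (Cod C f) b. \<forall>h\<in>Hom C (Cod C f) b. Comp C g f = Comp C h f \<longrightarrow> g = h)"

definition terminal :: "('o, 'm) cat \<Rightarrow> 'o \<Rightarrow> bool" where
  "terminal C t \<longleftrightarrow> t \<in> Obj C \<and> (\<forall>a\<in>Obj C. \<exists>!f. f \<in> Hom C a t)"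

definition inhabited :: "('o, 'm) cat \<Rightarrow> 'o \<Rightarrow> bool" where
  "inhabited C a \<longleftrightarrow> (\<exists>t. terminal C t \<and> (\<exists>f\<in>Hom C a t. epi C f))"


section \<open>Functors and natural transformations\<close>

text \<open>
  Functors and natural transformations are extensional (equal to \<open>undefined\<close> off their
  domains), so that HOL equality is the mathematical equality.
\<close>

record ('o, 'm, 'p, 'n) func =
  omap :: "'o \<Rightarrow> 'p"
  amap :: "'m \<Rightarrow> 'n"

definition is_functor :: "('o, 'm) cat \<Rightarrow> ('p, 'n) cat \<Rightarrow> ('o, 'm, 'p, 'n) func \<Rightarrow> bool" where
  "is_functor C D F \<longleftrightarrow>
     omap F \<in> Obj C \<rightarrow>\<^sub>E Obj D \<and>
     amap F \<in> (\<Pi>\<^sub>E f\<in>Arr C. Hom D (omap F (Dom C f)) (omap F (Cod C f))) \<and>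
     (\<forall>a\<in>Obj C. amap F (Ide C a) = Ide D (omap F a)) \<and>
     (\<forall>f\<in>Arr C. \<forall>g\<in>Arr C. Cod C f = Dom C g \<longrightarrow>
        amap F (Comp C g f) = Comp D (amap F g) (amap F f))"

definition id_functor :: "('o, 'm) cat \<Rightarrow> ('o, 'm, 'o, 'm) func" where
  "id_functor C = \<lparr>omap = restrict (\<lambda>a. a) (Obj C), amap = restrict (\<lambda>f. f) (Arr C)\<rparr>"

text \<open>\<open>comp_functor C G F\<close> is \<open>G\<close> after \<open>F\<close>, where \<open>C\<close> is the domain of \<open>F\<close>.\<close>

definition comp_functor ::
  "('o, 'm) cat \<Rightarrow> ('p, 'n, 'q, 'k) func \<Rightarrow> ('o, 'm, 'p, 'n) func \<Rightarrow> ('o, 'm, 'q, 'k) func" where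
  "comp_functor C G F =
     \<lparr>omap = compose (Obj C) (omap G) (omap F), amap = compose (Arr C) (amap G) (amap F)\<rparr>"

definition fully_faithful ::
  "('o, 'm) cat \<Rightarrow> ('p, 'n) cat \<Rightarrow> ('o, 'm, 'p, 'n) func \<Rightarrow> bool" where
  "fully_faithful C D F \<longleftrightarrow>
     (\<forall>a\<in>Obj C. \<forall>b\<in>Obj C. bij_betw (amap F) (Hom C a b) (Hom D (omap F a) (omap F b)))"

definition is_nat_trans ::
  "('o, 'm) cat \<Rightarrow> ('p, 'n) cat \<Rightarrow> ('o, 'm, 'p, 'n) func \<Rightarrow> ('o, 'm, 'p, 'n) func \<Rightarrow> ('o \<Rightarrow> 'n) \<Rightarrow> bool"
where
  "is_nat_trans C D F G \<alpha> \<longleftrightarrow>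
     \<alpha> \<in> (\<Pi>\<^sub>E a\<in>Obj C. Hom D (omap F a) (omap G a)) \<and>
     (\<forall>f\<in>Arr C. Comp D (\<alpha> (Cod C f)) (amap F f) = Comp D (amap G f) (\<alpha> (Dom C f)))"

text \<open>Arrows carrying their source and target, used for functions, natural transformations and paths.\<close>

datatype ('o, 'b) arrow = Arrow (source: 'o) (body: 'b) (target: 'o)

definition functor_category ::
  "('o, 'm) cat \<Rightarrow> ('p, 'n) cat \<Rightarrow>
     (('o, 'm, 'p, 'n) func, (('o, 'm, 'p, 'n) func, 'o \<Rightarrow> 'n) arrow) cat" where
  "functor_category C D =
     \<lparr>Obj = {F. is_functor C D F},
      Arr = {Arrow F \<alpha> G | F \<alpha> G. is_functor C D F \<and> is_functor C D G \<and> is_nat_trans C D F G \<alpha>},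
      Dom = source,
      Cod = target,
      Ide = (\<lambda>F. Arrow F (\<lambda>a\<in>Obj C. Ide D (omap F a)) F),
      Comp = (\<lambda>\<beta> \<alpha>. Arrow (source \<alpha>) (\<lambda>a\<in>Obj C. Comp D (body \<beta> a) (body \<alpha> a)) (target \<beta>))\<rparr>"

definition is_equivalence ::
  "('o, 'm) cat \<Rightarrow> ('p, 'n) cat \<Rightarrow> ('o, 'm, 'p, 'n) func \<Rightarrow> ('p, 'n, 'o, 'm) func \<Rightarrow> bool" where
  "is_equivalence C D F G \<longleftrightarrow>
     is_functor C D F \<and> is_functor D C G \<and>
     isomorphic (functor_category C C) (comp_functor C G F) (id_functor C) \<and>
     isomorphic (functor_category D D) (comp_functor D F G) (id_functor D)"

text \<open>\<open>L : C \<rightarrow> D\<close> is left adjoint to \<open>R : D \<rightarrow> C\<close>, by unit, counit and the triangle identities.\<close>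

definition is_left_adjoint ::
  "('o, 'm) cat \<Rightarrow> ('p, 'n) cat \<Rightarrow> ('o, 'm, 'p, 'n) func \<Rightarrow> ('p, 'n, 'o, 'm) func \<Rightarrow> bool" where
  "is_left_adjoint C D L R \<longleftrightarrow>
     is_functor C D L \<and> is_functor D C R \<and>
     (\<exists>\<eta> \<epsilon>. is_nat_trans C C (id_functor C) (comp_functor C R L) \<eta> \<and>
            is_nat_trans D D (comp_functor D L R) (id_functor D) \<epsilon> \<and>
            (\<forall>a\<in>Obj C. Comp D (\<epsilon> (omap L a)) (amap L (\<eta> a)) = Ide D (omap L a)) \<and>
            (\<forall>b\<in>Obj D. Comp C (amap R (\<epsilon> b)) (\<eta> (omap R b)) = Ide C (omap R b)))"

definition is_cone ::
  "('j, 'i) cat \<Rightarrow> ('o, 'm) cat \<Rightarrow> ('j, 'i, 'o, 'm) func \<Rightarrow> 'o \<Rightarrow> ('j \<Rightarrow> 'm) \<Rightarrow> bool" where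
  "is_cone J C K a \<tau> \<longleftrightarrow>
     a \<in> Obj C \<and> (\<forall>j\<in>Obj J. \<tau> j \<in> Hom C a (omap K j)) \<and>
     (\<forall>u\<in>Arr J. Comp C (amap K u) (\<tau> (Dom J u)) = \<tau> (Cod J u))"

definition is_limit ::
  "('j, 'i) cat \<Rightarrow> ('o, 'm) cat \<Rightarrow> ('j, 'i, 'o, 'm) func \<Rightarrow> 'o \<Rightarrow> ('j \<Rightarrow> 'm) \<Rightarrow> bool" where
  "is_limit J C K a \<tau> \<longleftrightarrow>
     is_cone J C K a \<tau> \<and>
     (\<forall>b \<sigma>. is_cone J C K b \<sigma> \<longrightarrow> (\<exists>!h. h \<in> Hom C b a \<and> (\<forall>j\<in>Obj J. Comp C (\<tau> j) h = \<sigma> j)))"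

text \<open>Every finite category is isomorphic to one whose objects and arrows are natural numbers.\<close>

definition preserves_finite_limits ::
  "('o, 'm) cat \<Rightarrow> ('p, 'n) cat \<Rightarrow> ('o, 'm, 'p, 'n) func \<Rightarrow> bool" where
  "preserves_finite_limits C D F \<longleftrightarrow>
     (\<forall>(J :: (nat, nat) cat) K a \<tau>.
        category J \<and> finite (Obj J) \<and> finite (Arr J) \<and> is_functor J C K \<and> is_limit J C K a \<tau> \<longrightarrow>
        is_limit J D (comp_functor J F K) (omap F a) (\<lambda>j. amap F (\<tau> j)))"


section \<open>The category of sets, presheaves and Grothendieck topoi\<close>

type_synonym 'u fn = "('u set, 'u \<Rightarrow> 'u) arrow"

definition set_cat :: "('u set, 'u fn) cat" where
  "set_cat =
     \<lparr>Obj = {A. small TYPE('u) A},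
      Arr = {Arrow A f B | A f B. small TYPE('u) A \<and> small TYPE('u) B \<and> f \<in> A \<rightarrow>\<^sub>E B},
      Dom = source,
      Cod = target,
      Ide = (\<lambda>A. Arrow A (\<lambda>x\<in>A. x) A),
      Comp = (\<lambda>g f. Arrow (source f) (compose (source f) (body g) (body f)) (target g))\<rparr>"

text \<open>Objects and arrows of the category of covariant functors from a category to \<^const>\<open>set_cat\<close>.\<close>

type_synonym ('o, 'm, 'u) sfun = "('o, 'm, 'u set, 'u fn) func"
type_synonym ('o, 'm, 'u) strans = "(('o, 'm, 'u) sfun, 'o \<Rightarrow> 'u fn) arrow"

definition sieve :: "('o, 'm) cat \<Rightarrow> 'o \<Rightarrow> 'm set \<Rightarrow> bool" where
  "sieve C c S \<longleftrightarrow> S \<subseteq> {f \<in> Arr C. Cod C f = c} \<and>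
     (\<forall>f\<in>S. \<forall>g\<in>Arr C. Cod C g = Dom C f \<longrightarrow> Comp C f g \<in> S)"

definition pullback_sieve :: "('o, 'm) cat \<Rightarrow> 'm \<Rightarrow> 'm set \<Rightarrow> 'm set" where
  "pullback_sieve C h S = {g \<in> Arr C. Cod C g = Dom C h \<and> Comp C h g \<in> S}"

definition grothendieck_topology :: "('o, 'm) cat \<Rightarrow> ('o \<Rightarrow> 'm set set) \<Rightarrow> bool" where
  "grothendieck_topology C J \<longleftrightarrow>
     (\<forall>c\<in>Obj C. \<forall>S\<in>J c. sieve C c S) \<and>
     (\<forall>c\<in>Obj C. {f \<in> Arr C. Cod C f = c} \<in> J c) \<and>
     (\<forall>c\<in>Obj C. \<forall>S\<in>J c. \<forall>h\<in>Arr C. Cod C h = c \<longrightarrow> pullback_sieve C h S \<in> J (Dom C h)) \<and>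
     (\<forall>c\<in>Obj C. \<forall>S\<in>J c. \<forall>T. sieve C c T \<and> (\<forall>h\<in>S. pullback_sieve C h T \<in> J (Dom C h)) \<longrightarrow> T \<in> J c)"

definition is_sheaf :: "('o, 'm) cat \<Rightarrow> ('o \<Rightarrow> 'm set set) \<Rightarrow> ('o, 'm, 'u) sfun \<Rightarrow> bool" where
  "is_sheaf C J P \<longleftrightarrow>
     (\<forall>c\<in>Obj C. \<forall>S\<in>J c. \<forall>x.
        (\<forall>f\<in>S. x f \<in> omap P (Dom C f)) \<and>
        (\<forall>f\<in>S. \<forall>g\<in>Arr C. Cod C g = Dom C f \<longrightarrow> body (amap P g) (x f) = x (Comp C f g)) \<longrightarrow>
        (\<exists>!y. y \<in> omap P c \<and> (\<forall>f\<in>S. body (amap P f) y = x f)))"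

definition sheaf_category ::
  "('o, 'm) cat \<Rightarrow> ('o \<Rightarrow> 'm set set) \<Rightarrow> (('o, 'm, 'u) sfun, ('o, 'm, 'u) strans) cat" where
  "sheaf_category C J =
     full_subcategory (functor_category (opposite C) set_cat) {P. is_sheaf C J P}"

text \<open>Every small category is isomorphic to one whose objects and arrows are elements of \<open>'u\<close>.\<close>

definition grothendieck_topos :: "'u itself \<Rightarrow> ('o, 'm) cat \<Rightarrow> bool" where
  "grothendieck_topos U \<T> \<longleftrightarrow>
     category \<T> \<and>
     (\<exists>(C :: ('u, 'u) cat) J.
        category C \<and> small U (Obj C) \<and> small U (Arr C) \<and> grothendieck_topology C J \<and>
        (\<exists>F G. is_equivalence \<T>
                 (sheaf_category C J :: (('u, 'u, 'u) sfun, ('u, 'u, 'u) strans) cat) F G))"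


section \<open>Geometric morphisms\<close>

text \<open>
  In a geometric morphism \<open>f : \<E> \<rightarrow> \<F>\<close>, of which \<open>\<E>\<close> has objects \<open>'o\<close> and arrows \<open>'m\<close>, the
  adjunction is determined by the two functors up to isomorphism and is only required to exist.
\<close>

record ('o, 'm, 'p, 'n) geom =
  inverse_image :: "('p, 'n, 'o, 'm) func"
  direct_image :: "('o, 'm, 'p, 'n) func"

definition geometric_morphism ::
  "('o, 'm) cat \<Rightarrow> ('p, 'n) cat \<Rightarrow> ('o, 'm, 'p, 'n) geom \<Rightarrow> bool" where
  "geometric_morphism \<E> \<F> f \<longleftrightarrow>
     is_left_adjoint \<F> \<E> (inverse_image f) (direct_image f) \<and>
     preserves_finite_limits \<F> \<E> (inverse_image f)"

definition connected_geometric_morphism ::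
  "('o, 'm) cat \<Rightarrow> ('p, 'n) cat \<Rightarrow> ('o, 'm, 'p, 'n) geom \<Rightarrow> bool" where
  "connected_geometric_morphism \<E> \<F> f \<longleftrightarrow>
     geometric_morphism \<E> \<F> f \<and> fully_faithful \<F> \<E> (inverse_image f)"


section \<open>Quotient topoi\<close>

text \<open>
  A quotient topos is a pair \<open>(\<F>, f)\<close>. The codomains \<open>\<F>\<close> range over all Grothendieck topoi with
  objects and arrows in given types \<open>'p\<close> and \<open>'n\<close>; these have to be large enough to contain a
  copy of every Grothendieck topos.
\<close>

definition quotient_topoi ::
  "'u itself \<Rightarrow> ('o, 'm) cat \<Rightarrow> (('p, 'n) cat \<times> ('o, 'm, 'p, 'n) geom) set" where
  "quotient_topoi U \<E> =
     {(\<F>, f). grothendieck_topos U \<F> \<and> connected_geometric_morphism \<E> \<F> f}"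

text \<open>
  The geometric morphism underlying an equivalence \<open>e : \<F> \<rightarrow> \<F>'\<close> has a quasi-inverse \<open>e'\<close> of \<open>e\<close> as
  its inverse image, and geometric morphisms are isomorphic if their inverse images are. So
  \<open>e \<circ> f \<cong> f'\<close> means \<open>f\<^sup>* \<circ> e' \<cong> f'\<^sup>*\<close>.
\<close>

definition equivalent_quotients ::
  "('o, 'm) cat \<Rightarrow> ('p, 'n) cat \<times> ('o, 'm, 'p, 'n) geom \<Rightarrow> ('p, 'n) cat \<times> ('o, 'm, 'p, 'n) geom \<Rightarrow> bool"
where
  "equivalent_quotients \<E> = (\<lambda>(\<F>, f) (\<F>', f'). \<exists>e e'. is_equivalence \<F> \<F>' e e' \<and>
     isomorphic (functor_category \<F>' \<E>) (comp_functor \<F>' (inverse_image f) e') (inverse_image f'))"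


section \<open>Inhabited-topos-rigidity\<close>

text \<open>The category of non-empty finite sets, the topos \<open>\<bbbA>\<^sup>\<circ>\<close> and its universal inhabited object.\<close>

definition finset_inh :: "('u set, 'u fn) cat" where
  "finset_inh = full_subcategory set_cat {A. finite A \<and> A \<noteq> {}}"

type_synonym 'u inh_obj = "('u set, 'u fn, 'u) sfun"
type_synonym 'u inh_arr = "('u set, 'u fn, 'u) strans"

definition inh_classifier :: "('u inh_obj, 'u inh_arr) cat" where
  "inh_classifier = functor_category finset_inh set_cat"

definition universal_inh :: "'u inh_obj" where
  "universal_inh = \<lparr>omap = (\<lambda>A\<in>Obj finset_inh. A), amap = (\<lambda>f\<in>Arr finset_inh. f)\<rparr>"

text \<open>
  The geometric morphism \<open>f\<close> corresponding to \<open>X\<close> is the one with \<open>f\<^sup>*\<close> of the universal object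
  isomorphic to \<open>X\<close>; it exists for inhabited \<open>X\<close> and is unique up to isomorphism, which does not
  affect connectedness.
\<close>

definition inhabited_topos_rigid :: "'u itself \<Rightarrow> ('o, 'm) cat \<Rightarrow> 'o \<Rightarrow> bool" where
  "inhabited_topos_rigid _ \<E> X \<longleftrightarrow>
     X \<in> Obj \<E> \<and> inhabited \<E> X \<and>
     (\<exists>f :: ('o, 'm, 'u inh_obj, 'u inh_arr) geom.
        isomorphic \<E> (omap (inverse_image f) universal_inh) X \<and>
        connected_geometric_morphism \<E> inh_classifier f)"


section \<open>The encoding topos of a relational language\<close>

record 'l language =
  symbols :: "'l set"
  arity :: "'l \<Rightarrow> nat"

datatype 'l enc_vertex = V | VSym 'l

datatype 'l enc_edge =
    Proj enat nat    \<comment> \<open>\<open>p\<^sup>n\<^sub>i\<close> with \<open>i < n \<le> \<omega>\<close>\<close>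
  | Proj' nat nat    \<comment> \<open>\<open>p'\<^sup>n\<^sub>i\<close> with \<open>i < n < \<omega>\<close>\<close>
  | Sect' 'l         \<comment> \<open>\<open>s'\<^sub>\<lambda>\<close>\<close>
  | Retr 'l          \<comment> \<open>\<open>r\<^sub>\<lambda>\<close>\<close>

fun edge_tail :: "'l enc_edge \<Rightarrow> 'l enc_vertex" where
  "edge_tail (Sect' l) = VSym l"
| "edge_tail _ = V"

fun edge_head :: "'l enc_edge \<Rightarrow> 'l enc_vertex" where
  "edge_head (Retr l) = VSym l"
| "edge_head _ = V"

text \<open>The arities do not enter the encoding graph.\<close>

definition encoding_graph :: "'l language \<Rightarrow> ('l enc_vertex, 'l enc_edge) pre_digraph" where
  "encoding_graph \<L> =
     \<lparr>verts = insert V (VSym ` symbols \<L>),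
      arcs = {Proj n i | n i. enat i < n} \<union> {Proj' n i | n i. i < n} \<union>
             Sect' ` symbols \<L> \<union> Retr ` symbols \<L>,
      tail = edge_tail,
      head = edge_head\<rparr>"

definition free_category :: "('v, 'e) pre_digraph \<Rightarrow> ('v, ('v, 'e list) arrow) cat" where
  "free_category G =
     \<lparr>Obj = verts G,
      Arr = {Arrow a p b | a p b. pre_digraph.awalk G a p b},
      Dom = source,
      Cod = target,
      Ide = (\<lambda>a. Arrow a [] a),
      Comp = (\<lambda>q p. Arrow (source p) (body p @ body q) (target q))\<rparr>"

type_synonym ('l, 'u) enc_obj = "('l enc_vertex, ('l enc_vertex, 'l enc_edge list) arrow, 'u) sfun"
type_synonym ('l, 'u) enc_arr = "('l enc_vertex, ('l enc_vertex, 'l enc_edge list) arrow, 'u) strans"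

definition encoding_topos :: "'l language \<Rightarrow> (('l, 'u) enc_obj, ('l, 'u) enc_arr) cat" where
  "encoding_topos \<L> =
     full_subcategory (functor_category (free_category (encoding_graph \<L>)) set_cat)
       {X. \<forall>l\<in>symbols \<L>.
             Comp set_cat (amap X (Arrow V [Retr l] (VSym l))) (amap X (Arrow (VSym l) [Sect' l] V))
               = Ide set_cat (omap X (VSym l))}"

end

theory Submission
  imports Defs
begin

text \<open>
  The empty language suffices: its encoding topos consists of sets with countably many unary
  operations. Let \<open>S\<close> be an infinite set in bijection with the set of sequences in \<open>S\<close>. The inverse
  image functor attached to an algebra \<open>S\<close> sends \<open>F\<close> to the value at \<open>S\<close> of the finitary extension
  of \<open>F\<close>, and it is fully faithful if every equivariant map \<open>\<phi>\<close> from \<open>S\<^sup>A\<close> to such a value is of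
  the form \<open>x \<mapsto> F(x)(g)\<close>.

  Through the bijection a unary operation can encode an operation of countable arity. Coding sequences
  bounds the size of the supports of the \<open>\<phi>(x)\<close>; at an \<open>x\<^sup>*\<close> where it is maximal, the values
  \<open>\<phi>(x\<^sup>*, x)\<close> write \<open>\<phi>\<close> in terms of finitely many equivariant maps \<open>S\<^sup>A \<rightarrow> S\<close>. Such a map depends
  injectively on one coordinate, because it respects two constants and the operation ``if \<open>a = b\<close> then
  \<open>u\<close> else \<open>v\<close>'', so it comes from an endomorphism \<open>\<alpha>\<close>. Finally \<open>\<alpha>\<close> is the identity, because an
  operation choosing a representative of the tail class of a sequence takes the same value on an
  \<open>\<alpha>\<close>-orbit and on its shift.

  As \<open>S\<close> can be arbitrarily large, the rigid objects form a proper class. If two of them have equivalent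
  quotient topoi, then there are maps between them in both directions, and these are inverse to each
  other because a rigid object has no endomorphism but the identity.
\<close>

section \<open>Smallness\<close>

text \<open>Rigidity of \<open>S\<close> asks that the equivariant maps between values of finitary
  functors at \<open>S\<close> all come from natural maps. By the Yoneda lemma it suffices to test
  maps out of the finite powers of \<open>S\<close>, since these are the values of the representable
  functors. Each operation \<open>w\<close> also occurs as \<open>par w\<close>, which acts on one
  half of a coded pair and keeps the other half as a parameter: only so can the dependence of \<phi>
  on \<open>x\<close> be followed while the reference point stays fixed. The empty set is missing
  from the index category, so an element may be supported by every singleton without having an empty
  support. Such elements behave as constants and form the degenerate case of the support argument.
  For quotients the obstacle is that an equivalence need not carry the universal object to itself.
  Its transport is still a functor with some non-empty value, and the universal object, being
  represented by a point, maps to every such functor. This is the origin of the maps in both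
  directions.\<close>

lemma small_lepoll: "small U A \<Longrightarrow> B \<lesssim> A \<Longrightarrow> small U B"
  unfolding small_def by (rule lesspoll_trans1)

lemma small_subset: "small U A \<Longrightarrow> B \<subseteq> A \<Longrightarrow> small U B"
  by (blast intro: small_lepoll subset_imp_lepoll)

lemma small_image: "small U A \<Longrightarrow> small U (f ` A)"
  by (blast intro: small_lepoll image_lepoll)

text \<open>Values of set-valued functors must be subsets of \<open>'u\<close>. Sets of functions or
  of equivalence classes live in other types, so they are transported along some chosen
  injection.\<close>

definition code :: "'a set \<Rightarrow> 'a \<Rightarrow> 'u" where
  "code Q = (SOME e. inj_on e Q)"

definition decode :: "'a set \<Rightarrow> 'u \<Rightarrow> 'a" where
  "decode Q = inv_into Q (code Q)"

lemma inj_code: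
  assumes "small TYPE('u) Q" shows "inj_on (code Q :: 'a \<Rightarrow> 'u) Q"
proof -
  have "\<exists>e::'a \<Rightarrow> 'u. inj_on e Q"
    using assms unfolding small_def lesspoll_def lepoll_def by blast
  then show ?thesis unfolding code_def by (rule someI_ex)
qed

lemma decode_code: "small TYPE('u) Q \<Longrightarrow> q \<in> Q \<Longrightarrow> decode Q (code Q q :: 'u) = q"
  unfolding decode_def by (rule inv_into_f_f[OF inj_code])

lemma code_inject: "small TYPE('u) Q \<Longrightarrow> q \<in> Q \<Longrightarrow> r \<in> Q \<Longrightarrow> (code Q q :: 'u) = code Q r \<longleftrightarrow> q = r"
  by (metis decode_code)

lemma decode_in: "v \<in> code Q ` Q \<Longrightarrow> decode Q v \<in> Q"
  unfolding decode_def by (rule inv_into_into)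

lemma code_decode: "v \<in> code Q ` Q \<Longrightarrow> code Q (decode Q v) = v"
  unfolding decode_def by (rule f_inv_into_f)

section \<open>Closure properties of small sets\<close>

locale inaccessible_universe =
  fixes U :: "'u itself"
  assumes inaccessible: "inaccessible TYPE('u)"
begin

lemma infinite_universe: "infinite (UNIV :: 'u set)"
  using inaccessible unfolding inaccessible_def by (auto dest: countable_finite)

text \<open>The uncountability clause of \<open>inaccessible\<close> enters here: \<open>nat\<close>
  embeds in \<open>'u\<close> and is not equipollent to it.\<close>

lemma small_countable:
  assumes "countable A" shows "small TYPE('u) A"
proof -
  have "A \<lesssim> (UNIV :: nat set)"
    using assms by (auto simp: countable_def lepoll_def)
  also have "(UNIV :: nat set) \<prec> (UNIV :: 'u set)"
    unfolding lesspoll_def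
  proof
    show "(UNIV :: nat set) \<lesssim> (UNIV :: 'u set)"
      using infinite_universe infinite_le_lepoll by blast
    show "\<not> (UNIV :: nat set) \<approx> (UNIV :: 'u set)"
    proof
      assume "(UNIV :: nat set) \<approx> (UNIV :: 'u set)"
      then have "countable (UNIV :: 'u set)"
        by (rule countable_eqpoll[OF countableI_type eqpoll_sym])
      then show False using inaccessible by (simp add: inaccessible_def)
    qed
  qed
  finally show ?thesis unfolding small_def .
qed

lemma small_finite: "finite A \<Longrightarrow> small TYPE('u) A"
  by (simp add: small_countable countable_finite)

lemma small_code_image: "small TYPE('u) Q \<Longrightarrow> small TYPE('u) (code Q ` Q :: 'u set)"
  by (rule small_image)

lemma code_eqpoll: "small TYPE('u) Q \<Longrightarrow> (code Q ` Q :: 'u set) \<approx> Q"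
  by (rule inj_on_image_eqpoll_self[OF inj_code])

lemma small_Pow:
  assumes "small TYPE('u) A" shows "small TYPE('u) (Pow A)"
proof -
  let ?B = "code A ` A :: 'u set"
  have "small TYPE('u) (Pow ?B)"
    using inaccessible small_code_image[OF assms] unfolding inaccessible_def by blast
  moreover have "Pow A \<lesssim> Pow ?B"
    unfolding lepoll_def
    by (rule exI[of _ "image (code A)"])
       (auto intro!: inj_on_image_Pow inj_code assms)
  ultimately show ?thesis by (rule small_lepoll)
qed

text \<open>Regularity is assumed only for unions of subsets of \<open>'u\<close>. A dependent sum
  takes that form once base and fibres are coded in \<open>'u\<close> and the fibres are kept apart
  by an injection of \<open>'u \<times> 'u\<close> into \<open>'u\<close>.\<close>

lemma small_Sigma:
  assumes A: "small TYPE('u) A" and B: "\<And>x. x \<in> A \<Longrightarrow> small TYPE('u) (B x)" shows "small TYPE('u) (Sigma A B)"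
proof -
  have "(UNIV :: 'u set) \<times> (UNIV :: 'u set) \<approx> (UNIV :: 'u set)"
    unfolding eqpoll_iff_card_of_ordIso by (rule card_of_Times_same_infinite[OF infinite_universe])
  then obtain j :: "'u \<times> 'u \<Rightarrow> 'u" where j: "inj j"
    by (auto simp: eqpoll_def bij_betw_def)
  let ?A = "code A ` A :: 'u set"
  define C where "C x = (\<lambda>y. j (x, y)) ` (code (B (decode A x)) ` B (decode A x) :: 'u set)" for x :: 'u
  have "small TYPE('u) (\<Union>x\<in>?A. C x)"
  proof -
    have "\<forall>x\<in>?A. small TYPE('u) (C x)"
      unfolding C_def by (blast intro: small_image B decode_in)
    then show ?thesis
      using inaccessible small_code_image[OF A] unfolding inaccessible_def by blast
  qed
  moreover have "Sigma A B \<lesssim> (\<Union>x\<in>?A. C x)"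
    unfolding lepoll_def
  proof (intro exI conjI)
    let ?f = "\<lambda>(x, y). j (code A x, code (B x) y)"
    show "inj_on ?f (Sigma A B)"
    proof (rule inj_onI)
      fix p q assume p: "p \<in> Sigma A B" and q: "q \<in> Sigma A B" and eq: "?f p = ?f q"
      obtain x y x' y' where [simp]: "p = (x, y)" "q = (x', y')" by (cases p; cases q)
      from eq j have "(code A x :: 'u) = code A x'" and y: "(code (B x) y :: 'u) = code (B x') y'"
        by (auto dest: injD)
      with p q have "x = x'" using code_inject[OF A] by simp
      with y p q show "p = q" using code_inject[OF B] by simp
    qed
    show "?f ` Sigma A B \<subseteq> (\<Union>x\<in>?A. C x)"
      by (auto simp: C_def decode_code[OF A])
  qed
  ultimately show ?thesis by (rule small_lepoll)
qed

lemma small_UN: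
  assumes "small TYPE('u) A" "\<And>x. x \<in> A \<Longrightarrow> small TYPE('u) (B x)" shows "small TYPE('u) (\<Union>x\<in>A. B x)"
proof -
  have "(\<Union>x\<in>A. B x) = snd ` Sigma A B" by force
  then show ?thesis using small_Sigma[OF assms] by (simp add: small_image)
qed

text \<open>A function is replaced by its graph, a subset of a small product; extensionality makes
  this passage injective.\<close>

lemma small_PiE:
  assumes "small TYPE('u) A" "small TYPE('u) B" shows "small TYPE('u) (A \<rightarrow>\<^sub>E B)"
proof -
  have "small TYPE('u) (Pow (A \<times> B))" using assms by (intro small_Pow small_Sigma)
  moreover have "(A \<rightarrow>\<^sub>E B) \<lesssim> Pow (A \<times> B)"
    unfolding lepoll_def
  proof (intro exI conjI)
    let ?f = "\<lambda>f. (\<lambda>x. (x, f x)) ` A"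
    show "inj_on ?f (A \<rightarrow>\<^sub>E B)"
    proof (rule inj_onI)
      fix f g assume f: "f \<in> A \<rightarrow>\<^sub>E B" and g: "g \<in> A \<rightarrow>\<^sub>E B" and eq: "?f f = ?f g"
      show "f = g"
      proof (rule PiE_ext[OF f g])
        fix x assume "x \<in> A"
        then have "(x, f x) \<in> ?f g" unfolding eq[symmetric] by blast
        then show "f x = g x" by auto
      qed
    qed
    show "?f ` (A \<rightarrow>\<^sub>E B) \<subseteq> Pow (A \<times> B)" by auto
  qed
  ultimately show ?thesis by (rule small_lepoll)
qed

end


section \<open>Categories of set-valued functors\<close>

lemma HomD: "f \<in> Hom C a b \<Longrightarrow> f \<in> Arr C" "f \<in> Hom C a b \<Longrightarrow> Dom C f = a"
  "f \<in> Hom C a b \<Longrightarrow> Cod C f = b"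
  by (simp_all add: Hom_def)

lemma categoryD:
  assumes "category C"
  shows "f \<in> Arr C \<Longrightarrow> Dom C f \<in> Obj C" "f \<in> Arr C \<Longrightarrow> Cod C f \<in> Obj C"
    "a \<in> Obj C \<Longrightarrow> Ide C a \<in> Hom C a a"
    "f \<in> Hom C a b \<Longrightarrow> g \<in> Hom C b c \<Longrightarrow> Comp C g f \<in> Hom C a c"
    "f \<in> Hom C a b \<Longrightarrow> Comp C f (Ide C a) = f"
    "f \<in> Hom C a b \<Longrightarrow> Comp C (Ide C b) f = f"
    "f \<in> Hom C a b \<Longrightarrow> g \<in> Hom C b c \<Longrightarrow> h \<in> Hom C c d \<Longrightarrow>
       Comp C h (Comp C g f) = Comp C (Comp C h g) f"
    "f \<in> Hom C a b \<Longrightarrow> a \<in> Obj C" "f \<in> Hom C a b \<Longrightarrow> b \<in> Obj C"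
  using assms unfolding category_def Hom_def by auto

lemma functorD:
  assumes "is_functor C D F"
  shows "a \<in> Obj C \<Longrightarrow> omap F a \<in> Obj D"
    "f \<in> Hom C a b \<Longrightarrow> amap F f \<in> Hom D (omap F a) (omap F b)"
    "a \<in> Obj C \<Longrightarrow> amap F (Ide C a) = Ide D (omap F a)"
    "f \<in> Hom C a b \<Longrightarrow> g \<in> Hom C b c \<Longrightarrow> amap F (Comp C g f) = Comp D (amap F g) (amap F f)"
  using assms unfolding is_functor_def Hom_def by (auto simp: PiE_iff)

lemma category_functor_category:
  assumes C: "category C" and D: "category D" shows "category (functor_category C D)"
proof -
  let ?FC = "functor_category C D"
  have nt: "\<alpha> \<in> Hom D (omap F a) (omap G a)"
    if "is_nat_trans C D F G h" "a \<in> Obj C" "\<alpha> = h a" for F G h a \<alpha>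
    using that unfolding is_nat_trans_def by (auto simp: PiE_iff)
  have ext: "(\<lambda>a\<in>Obj C. k a) = h" if "is_nat_trans C D F G h" "\<And>a. a \<in> Obj C \<Longrightarrow> k a = h a" for F G h k
  proof
    fix a show "(\<lambda>a\<in>Obj C. k a) a = h a"
      using that unfolding is_nat_trans_def by (cases "a \<in> Obj C") (auto simp: PiE_iff extensional_def)
  qed
  have ide: "is_nat_trans C D F F (\<lambda>a\<in>Obj C. Ide D (omap F a))" if F: "is_functor C D F" for F
    unfolding is_nat_trans_def
  proof (intro conjI ballI)
    show "(\<lambda>a\<in>Obj C. Ide D (omap F a)) \<in> (\<Pi>\<^sub>E a\<in>Obj C. Hom D (omap F a) (omap F a))"
      using categoryD(3)[OF D functorD(1)[OF F]] by auto
    fix f assume f: "f \<in> Arr C"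
    have "amap F f \<in> Hom D (omap F (Dom C f)) (omap F (Cod C f))"
      by (rule functorD(2)[OF F]) (simp add: Hom_def f)
    then show "Comp D ((\<lambda>a\<in>Obj C. Ide D (omap F a)) (Cod C f)) (amap F f) =
        Comp D (amap F f) ((\<lambda>a\<in>Obj C. Ide D (omap F a)) (Dom C f))"
      using categoryD(1,2)[OF C f] categoryD(5,6)[OF D] by simp
  qed
  have comp: "is_nat_trans C D F H (\<lambda>a\<in>Obj C. Comp D (k a) (h a))"
    if F: "is_functor C D F" and G: "is_functor C D G" and H: "is_functor C D H"
    and h: "is_nat_trans C D F G h" and k: "is_nat_trans C D G H k" for F G H h k
    unfolding is_nat_trans_def
  proof (intro conjI ballI)
    show "(\<lambda>a\<in>Obj C. Comp D (k a) (h a)) \<in> (\<Pi>\<^sub>E a\<in>Obj C. Hom D (omap F a) (omap H a))"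
      using categoryD(4)[OF D nt[OF h] nt[OF k]] by auto
    fix f assume f: "f \<in> Arr C"
    note d = categoryD(1)[OF C f] and c = categoryD(2)[OF C f]
    have m: "amap E f \<in> Hom D (omap E (Dom C f)) (omap E (Cod C f))" if "is_functor C D E" for E
      by (rule functorD(2)[OF that]) (simp add: Hom_def f)
    have "Comp D (Comp D (k (Cod C f)) (h (Cod C f))) (amap F f)
       = Comp D (k (Cod C f)) (Comp D (h (Cod C f)) (amap F f))"
      using categoryD(7)[OF D m[OF F] nt[OF h c refl] nt[OF k c refl]] by simp
    also have "\<dots> = Comp D (k (Cod C f)) (Comp D (amap G f) (h (Dom C f)))"
      using h f by (simp add: is_nat_trans_def)
    also have "\<dots> = Comp D (Comp D (k (Cod C f)) (amap G f)) (h (Dom C f))"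
      using categoryD(7)[OF D nt[OF h d refl] m[OF G] nt[OF k c refl]] .
    also have "\<dots> = Comp D (Comp D (amap H f) (k (Dom C f))) (h (Dom C f))"
      using k f by (simp add: is_nat_trans_def)
    also have "\<dots> = Comp D (amap H f) (Comp D (k (Dom C f)) (h (Dom C f)))"
      using categoryD(7)[OF D nt[OF h d refl] nt[OF k d refl] m[OF H]] by simp
    finally show "Comp D ((\<lambda>a\<in>Obj C. Comp D (k a) (h a)) (Cod C f)) (amap F f) =
        Comp D (amap H f) ((\<lambda>a\<in>Obj C. Comp D (k a) (h a)) (Dom C f))"
      using c d by simp
  qed
  show ?thesis
    unfolding category_def
  proof (intro conjI ballI impI; (elim conjE)?)
    fix f assume "f \<in> Arr ?FC"
    then obtain F h G where f: "f = Arrow F h G" and F: "is_functor C D F" and G: "is_functor C D G"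
      and h: "is_nat_trans C D F G h" by (auto simp: functor_category_def)
    show "Dom ?FC f \<in> Obj ?FC" "Cod ?FC f \<in> Obj ?FC"
      using F G by (simp_all add: f functor_category_def)
    show "Comp ?FC f (Ide ?FC (Dom ?FC f)) = f"
      by (simp add: f functor_category_def)
         (rule ext[OF h], use categoryD(5)[OF D nt[OF h]] in simp)
    show "Comp ?FC (Ide ?FC (Cod ?FC f)) f = f"
      by (simp add: f functor_category_def)
         (rule ext[OF h], use categoryD(6)[OF D nt[OF h]] in simp)
    fix g assume "g \<in> Arr ?FC" "Cod ?FC f = Dom ?FC g"
    then obtain k H where g: "g = Arrow G k H" and H: "is_functor C D H"
      and k: "is_nat_trans C D G H k" by (auto simp: functor_category_def f)
    show "Comp ?FC g f \<in> Hom ?FC (Dom ?FC f) (Cod ?FC g)"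
      using comp[OF F G H h k] F H by (simp add: f g functor_category_def Hom_def)
    fix l assume "l \<in> Arr ?FC" "Cod ?FC g = Dom ?FC l"
    then obtain m K where l: "l = Arrow H m K" and m: "is_nat_trans C D H K m"
      by (auto simp: functor_category_def g)
    show "Comp ?FC l (Comp ?FC g f) = Comp ?FC (Comp ?FC l g) f"
      using categoryD(7)[OF D nt[OF h _ refl] nt[OF k _ refl] nt[OF m _ refl]]
      by (auto simp: f g l functor_category_def)
  next
    fix F assume "F \<in> Obj ?FC"
    then show "Ide ?FC F \<in> Hom ?FC F F"
      using ide by (auto simp: functor_category_def Hom_def)
  qed
qed

lemma set_cat_sel [simp]:
  "Obj (set_cat :: ('u set, 'u fn) cat) = {A. small TYPE('u) A}" "Dom set_cat = source" "Cod set_cat = target"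
  "Ide set_cat A = Arrow A (\<lambda>x\<in>A. x) (A :: 'u set)"
  "Comp set_cat (Arrow B g C) (Arrow A f B') = Arrow A (compose A g f) (C :: 'u set)"
  by (simp_all add: set_cat_def)

lemma set_cat_Arr:
  "m \<in> Arr (set_cat :: ('u set, 'u fn) cat) \<longleftrightarrow> small TYPE('u) (source m) \<and> small TYPE('u) (target m) \<and>
     body m \<in> source m \<rightarrow>\<^sub>E target m"
  by (cases m) (auto simp: set_cat_def)

lemma set_cat_Hom:
  "m \<in> Hom (set_cat :: ('u set, 'u fn) cat) A B \<longleftrightarrow> small TYPE('u) A \<and> small TYPE('u) B \<and>
     m = Arrow A (body m) B \<and> body m \<in> A \<rightarrow>\<^sub>E B"
  by (cases m) (auto simp: Hom_def set_cat_Arr)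

lemma Arrow_set_cat_Hom [simp]:
  "Arrow A' h B' \<in> Hom (set_cat :: ('u set, 'u fn) cat) A B \<longleftrightarrow> A' = A \<and> B' = B \<and>
     small TYPE('u) A \<and> small TYPE('u) B \<and> h \<in> A \<rightarrow>\<^sub>E B"
  by (auto simp: set_cat_Hom)

lemma category_set_cat: "category (set_cat :: ('u set, 'u fn) cat)"
  unfolding category_def
proof (intro conjI ballI impI; (elim conjE)?)
  fix f :: "'u fn" assume f: "f \<in> Arr set_cat"
  then show "Dom set_cat f \<in> Obj set_cat" "Cod set_cat f \<in> Obj set_cat" by (simp_all add: set_cat_Arr)
  show "Comp set_cat f (Ide set_cat (Dom set_cat f)) = f" "Comp set_cat (Ide set_cat (Cod set_cat f)) f = f"
    using f by (cases f; fastforce simp: set_cat_Arr PiE_iff extensional_def compose_def fun_eq_iff)+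
  fix g :: "'u fn" assume g: "g \<in> Arr set_cat" "Cod set_cat f = Dom set_cat g"
  show "Comp set_cat g f \<in> Hom set_cat (Dom set_cat f) (Cod set_cat g)"
    using f g by (cases f; cases g) (auto simp: set_cat_Arr compose_def)
  fix h :: "'u fn" assume h: "h \<in> Arr set_cat" "Cod set_cat g = Dom set_cat h"
  show "Comp set_cat h (Comp set_cat g f) = Comp set_cat (Comp set_cat h g) f"
    using f g h by (cases f; cases g; cases h) (auto simp: set_cat_Arr compose_def fun_eq_iff PiE_iff)
next
  fix A :: "'u set" assume "A \<in> Obj set_cat"
  then show "Ide set_cat A \<in> Hom set_cat A A" by simp
qed

section \<open>Set-valued functors and natural transformations in terms of elements\<close>

definition act :: "('o, 'm, 'u) sfun \<Rightarrow> 'm \<Rightarrow> 'u \<Rightarrow> 'u" where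
  "act F f = body (amap F f)"

definition app :: "('o, 'm, 'u) strans \<Rightarrow> 'o \<Rightarrow> 'u \<Rightarrow> 'u" where
  "app \<eta> c = body (body \<eta> c)"

text \<open>The tables \<open>Q\<close> and \<open>t\<close> may be arbitrary off the category; the
  restrictions build in the extensionality that equality of functors relies on.\<close>

definition mk_fun :: "('o, 'm) cat \<Rightarrow> ('o \<Rightarrow> 'u set) \<Rightarrow> ('m \<Rightarrow> 'u \<Rightarrow> 'u) \<Rightarrow> ('o, 'm, 'u) sfun" where
  "mk_fun C Q t = \<lparr>omap = (\<lambda>c\<in>Obj C. Q c),
     amap = (\<lambda>f\<in>Arr C. Arrow (Q (Dom C f)) (\<lambda>a\<in>Q (Dom C f). t f a) (Q (Cod C f)))\<rparr>"

definition mk_nat ::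
  "('o, 'm) cat \<Rightarrow> ('o, 'm, 'u) sfun \<Rightarrow> ('o, 'm, 'u) sfun \<Rightarrow> ('o \<Rightarrow> 'u \<Rightarrow> 'u) \<Rightarrow> ('o, 'm, 'u) strans" where
  "mk_nat C F G h = Arrow F (\<lambda>c\<in>Obj C. Arrow (omap F c) (\<lambda>a\<in>omap F c. h c a) (omap G c)) G"

locale index_category =
  fixes C :: "('o, 'm) cat"
  assumes cat: "category C"
begin

abbreviation Sets :: "(('o, 'm, 'u) sfun, ('o, 'm, 'u) strans) cat" where
  "Sets \<equiv> functor_category C set_cat"

lemma category_Sets: "category Sets"
  by (rule category_functor_category[OF cat category_set_cat])

lemma Dom_in [simp]: "f \<in> Arr C \<Longrightarrow> Dom C f \<in> Obj C"
  and Cod_in [simp]: "f \<in> Arr C \<Longrightarrow> Cod C f \<in> Obj C"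
  using categoryD(1,2)[OF cat] by auto

lemma Obj_Sets: "F \<in> Obj Sets \<longleftrightarrow> is_functor C set_cat F"
  by (simp add: functor_category_def)

lemma
  fixes F :: "('o, 'm, 'u) sfun"
  assumes F: "F \<in> Obj Sets"
  shows small_omap: "c \<in> Obj C \<Longrightarrow> small TYPE('u) (omap F c)"
    and amap_eq: "f \<in> Arr C \<Longrightarrow>
      amap F f = Arrow (omap F (Dom C f)) (\<lambda>a\<in>omap F (Dom C f). act F f a) (omap F (Cod C f))"
    and act_in: "f \<in> Arr C \<Longrightarrow> a \<in> omap F (Dom C f) \<Longrightarrow> act F f a \<in> omap F (Cod C f)"
    and act_Ide: "c \<in> Obj C \<Longrightarrow> a \<in> omap F c \<Longrightarrow> act F (Ide C c) a = a"
    and act_Comp: "f \<in> Arr C \<Longrightarrow> g \<in> Arr C \<Longrightarrow> Cod C f = Dom C g \<Longrightarrow> a \<in> omap F (Dom C f) \<Longrightarrow>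
      act F (Comp C g f) a = act F g (act F f a)"
proof -
  have F': "is_functor C set_cat F" using F by (simp add: Obj_Sets)
  show "c \<in> Obj C \<Longrightarrow> small TYPE('u) (omap F c)"
    using functorD(1)[OF F'] by simp
  have h: "amap F f \<in> Hom set_cat (omap F (Dom C f)) (omap F (Cod C f))" if "f \<in> Arr C" for f
    by (rule functorD(2)[OF F']) (simp add: Hom_def that)
  show eq: "amap F f = Arrow (omap F (Dom C f)) (\<lambda>a\<in>omap F (Dom C f). act F f a) (omap F (Cod C f))"
    if "f \<in> Arr C" for f
    using h[OF that] unfolding set_cat_Hom act_def
    by (cases "amap F f") (auto simp: PiE_iff extensional_def fun_eq_iff)
  show act: "act F f a \<in> omap F (Cod C f)" if "f \<in> Arr C" "a \<in> omap F (Dom C f)" for f a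
    using that h[of f] unfolding set_cat_Hom act_def by (auto simp: PiE_iff)
  show "c \<in> Obj C \<Longrightarrow> a \<in> omap F c \<Longrightarrow> act F (Ide C c) a = a"
    using functorD(3)[OF F', of c] by (simp add: act_def)
  assume a: "f \<in> Arr C" "g \<in> Arr C" "Cod C f = Dom C g" "a \<in> omap F (Dom C f)"
  have "amap F (Comp C g f) = Comp set_cat (amap F g) (amap F f)"
    using F' a unfolding is_functor_def by blast
  then show "act F (Comp C g f) a = act F g (act F f a)"
    using a(3,4) act[OF a(1,4)] unfolding act_def[of F "Comp C g f"]
    by (simp add: eq[OF a(1)] eq[OF a(2)] compose_def)
qed

lemma mk_fun_Obj:
  fixes Q :: "'o \<Rightarrow> 'u set"
  assumes "\<And>c. c \<in> Obj C \<Longrightarrow> small TYPE('u) (Q c)"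
    and "\<And>f a. f \<in> Arr C \<Longrightarrow> a \<in> Q (Dom C f) \<Longrightarrow> t f a \<in> Q (Cod C f)"
    and "\<And>c a. c \<in> Obj C \<Longrightarrow> a \<in> Q c \<Longrightarrow> t (Ide C c) a = a"
    and "\<And>f g a. f \<in> Arr C \<Longrightarrow> g \<in> Arr C \<Longrightarrow> Cod C f = Dom C g \<Longrightarrow> a \<in> Q (Dom C f) \<Longrightarrow>
      t (Comp C g f) a = t g (t f a)"
  shows "mk_fun C Q t \<in> Obj Sets"
  unfolding Obj_Sets is_functor_def
proof (intro conjI ballI impI)
  show "omap (mk_fun C Q t) \<in> Obj C \<rightarrow>\<^sub>E Obj set_cat"
    using assms(1) by (simp add: mk_fun_def)
  show "amap (mk_fun C Q t) \<in> (\<Pi>\<^sub>E f\<in>Arr C. Hom set_cat (omap (mk_fun C Q t) (Dom C f)) (omap (mk_fun C Q t) (Cod C f)))"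
    using assms(1,2) by (auto simp: mk_fun_def)
  fix a assume a: "a \<in> Obj C"
  have i: "Ide C a \<in> Arr C" "Dom C (Ide C a) = a" "Cod C (Ide C a) = a"
    using categoryD(3)[OF cat a] by (auto simp: Hom_def)
  show "amap (mk_fun C Q t) (Ide C a) = Ide set_cat (omap (mk_fun C Q t) a)"
    using a assms(3) i by (auto simp: mk_fun_def)
next
  fix f g assume a: "f \<in> Arr C" "g \<in> Arr C" "Cod C f = Dom C g"
  have i: "Comp C g f \<in> Arr C" "Dom C (Comp C g f) = Dom C f" "Cod C (Comp C g f) = Cod C g"
    using categoryD(4)[OF cat, of f "Dom C f" "Cod C f" g "Cod C g"] a by (auto simp: Hom_def)
  show "amap (mk_fun C Q t) (Comp C g f) = Comp set_cat (amap (mk_fun C Q t) g) (amap (mk_fun C Q t) f)"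
    using a assms(2)[of f] assms(4)[of f g] i by (auto simp: mk_fun_def compose_def fun_eq_iff)
qed

lemma omap_mk_fun [simp]: "c \<in> Obj C \<Longrightarrow> omap (mk_fun C Q t) c = Q c"
  by (simp add: mk_fun_def)

lemma act_mk_fun [simp]: "f \<in> Arr C \<Longrightarrow> a \<in> Q (Dom C f) \<Longrightarrow> act (mk_fun C Q t) f a = t f a"
  by (simp add: mk_fun_def act_def)

lemma mk_nat_Hom:
  assumes F: "F \<in> Obj Sets" and G: "G \<in> Obj Sets"
    and h: "\<And>c a. c \<in> Obj C \<Longrightarrow> a \<in> omap F c \<Longrightarrow> h c a \<in> omap G c"
    and nat: "\<And>f a. f \<in> Arr C \<Longrightarrow> a \<in> omap F (Dom C f) \<Longrightarrow>
      act G f (h (Dom C f) a) = h (Cod C f) (act F f a)"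
  shows "mk_nat C F G h \<in> Hom Sets F G"
proof -
  have "is_nat_trans C set_cat F G (\<lambda>c\<in>Obj C. Arrow (omap F c) (\<lambda>a\<in>omap F c. h c a) (omap G c))"
    unfolding is_nat_trans_def
    using h nat act_in[OF F]
    by (auto simp: small_omap[OF F] small_omap[OF G] amap_eq[OF F] amap_eq[OF G] compose_def fun_eq_iff)
  then show ?thesis
    using F G by (auto simp: Hom_def mk_nat_def functor_category_def)
qed

lemma app_mk_nat [simp]: "c \<in> Obj C \<Longrightarrow> a \<in> omap F c \<Longrightarrow> app (mk_nat C F G h) c a = h c a"
  by (simp add: mk_nat_def app_def)

text \<open>Extensionality forces an arrow to be the one that \<open>mk_nat\<close> builds from its
  own components, so equality of arrows can be tested on elements.\<close>

lemma
  assumes \<eta>: "\<eta> \<in> Hom Sets F G"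
  shows Hom_Sets_Obj1: "F \<in> Obj Sets" and Hom_Sets_Obj2: "G \<in> Obj Sets"
    and app_in: "c \<in> Obj C \<Longrightarrow> a \<in> omap F c \<Longrightarrow> app \<eta> c a \<in> omap G c"
    and app_natural: "f \<in> Arr C \<Longrightarrow> a \<in> omap F (Dom C f) \<Longrightarrow>
      act G f (app \<eta> (Dom C f) a) = app \<eta> (Cod C f) (act F f a)"
    and Hom_Sets_eq: "\<eta> = mk_nat C F G (app \<eta>)"
proof -
  show F: "F \<in> Obj Sets" and G: "G \<in> Obj Sets"
    using \<eta> by (auto simp: Hom_def functor_category_def)
  obtain h where h: "\<eta> = Arrow F h G" and n: "is_nat_trans C set_cat F G h"
    using \<eta> by (auto simp: Hom_def functor_category_def)
  have hc: "h c = Arrow (omap F c) (\<lambda>a\<in>omap F c. app \<eta> c a) (omap G c)" if "c \<in> Obj C" for c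
    using n that unfolding is_nat_trans_def h app_def
    by (cases "h c") (auto simp: PiE_iff set_cat_Hom extensional_def fun_eq_iff)
  show i: "app \<eta> c a \<in> omap G c" if "c \<in> Obj C" "a \<in> omap F c" for c a
    using n that unfolding is_nat_trans_def h app_def
    by (auto simp: PiE_iff set_cat_Hom)
  show "\<eta> = mk_nat C F G (app \<eta>)"
    unfolding mk_nat_def h using n unfolding is_nat_trans_def
    by (auto simp: fun_eq_iff hc[unfolded h] PiE_iff extensional_def)
  assume f: "f \<in> Arr C" and a: "a \<in> omap F (Dom C f)"
  have "Comp set_cat (h (Cod C f)) (amap F f) = Comp set_cat (amap G f) (h (Dom C f))"
    using n f by (auto simp: is_nat_trans_def)
  then have "compose (omap F (Dom C f)) (\<lambda>a\<in>omap F (Cod C f). app \<eta> (Cod C f) a) (\<lambda>a\<in>omap F (Dom C f). act F f a) a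
      = compose (omap F (Dom C f)) (\<lambda>a\<in>omap G (Dom C f). act G f a) (\<lambda>a\<in>omap F (Dom C f). app \<eta> (Dom C f) a) a"
    using f by (simp add: hc amap_eq[OF F f] amap_eq[OF G f])
  then show "act G f (app \<eta> (Dom C f) a) = app \<eta> (Cod C f) (act F f a)"
    using a f act_in[OF F f a] i by (simp add: compose_def)
qed

lemma Hom_Sets_ext:
  assumes "\<eta> \<in> Hom Sets F G" "\<theta> \<in> Hom Sets F G"
    and "\<And>c a. c \<in> Obj C \<Longrightarrow> a \<in> omap F c \<Longrightarrow> app \<eta> c a = app \<theta> c a"
  shows "\<eta> = \<theta>"
proof -
  have "mk_nat C F G (app \<eta>) = mk_nat C F G (app \<theta>)"
    using assms(3) by (auto simp: mk_nat_def fun_eq_iff)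
  then show ?thesis using Hom_Sets_eq[OF assms(1)] Hom_Sets_eq[OF assms(2)] by simp
qed

lemma app_Ide [simp]: "c \<in> Obj C \<Longrightarrow> a \<in> omap F c \<Longrightarrow> app (Ide Sets F) c a = a"
  by (simp add: functor_category_def app_def)

lemma app_Comp:
  assumes \<eta>: "\<eta> \<in> Hom Sets F G" and \<theta>: "\<theta> \<in> Hom Sets G H" and c: "c \<in> Obj C" and a: "a \<in> omap F c"
  shows "app (Comp Sets \<theta> \<eta>) c a = app \<theta> c (app \<eta> c a)"
proof -
  have "app (Comp Sets (mk_nat C G H (app \<theta>)) (mk_nat C F G (app \<eta>))) c a = app \<theta> c (app \<eta> c a)"
    using c a app_in[OF \<eta> c a] by (simp add: functor_category_def app_def mk_nat_def compose_def)
  then show ?thesis using Hom_Sets_eq[OF \<eta>] Hom_Sets_eq[OF \<theta>] by simp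
qed

end


section \<open>Functors on non-empty finite sets\<close>

abbreviation fs :: "'a set \<Rightarrow> bool" where "fs A \<equiv> finite A \<and> A \<noteq> {}"

text \<open>Maps are passed as total functions and cut down to \<open>A\<close> inside. Composites
  and identities thus remain plain lambda terms, and a map may be exchanged for one that agrees with
  it on \<open>A\<close>.\<close>

definition push :: "'u inh_obj \<Rightarrow> 'u set \<Rightarrow> 'u set \<Rightarrow> ('u \<Rightarrow> 'u) \<Rightarrow> 'u \<Rightarrow> 'u" where
  "push F A B f = act F (Arrow A (restrict f A) B)"

lemma push_cong: "(\<And>x. x \<in> A \<Longrightarrow> f x = g x) \<Longrightarrow> push F A B f a = push F A B g a"
  unfolding push_def by (metis restrict_ext)

context inaccessible_universe
begin

lemma Obj_finset: "A \<in> Obj (finset_inh :: ('u set, 'u fn) cat) \<longleftrightarrow> fs A"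
  by (auto simp: finset_inh_def full_subcategory_def small_finite)

lemma Arr_finset:
  "m \<in> Arr (finset_inh :: ('u set, 'u fn) cat) \<longleftrightarrow>
     fs (source m) \<and> fs (target m) \<and> body m \<in> source m \<rightarrow>\<^sub>E target m"
  by (auto simp: finset_inh_def full_subcategory_def small_finite set_cat_Arr)

lemma finset_sel [simp]:
  "Dom finset_inh = source" "Cod finset_inh = target" "Ide finset_inh = Ide set_cat"
  "Comp finset_inh = Comp set_cat"
  by (simp_all add: finset_inh_def full_subcategory_def)

sublocale finset: index_category "finset_inh :: ('u set, 'u fn) cat"
proof
  show "category (finset_inh :: ('u set, 'u fn) cat)"
    unfolding category_def
  proof (intro conjI ballI impI; (elim conjE)?)
    fix f :: "'u fn" assume f: "f \<in> Arr finset_inh"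
    then have f': "f \<in> Arr set_cat" by (simp add: Arr_finset set_cat_Arr small_finite)
    have h: "f \<in> Hom set_cat (source f) (target f)" using f' by (simp add: Hom_def)
    note c = categoryD[OF category_set_cat]
    show "Dom finset_inh f \<in> Obj finset_inh" "Cod finset_inh f \<in> Obj finset_inh"
      using f by (simp_all add: Arr_finset Obj_finset)
    show "Comp finset_inh f (Ide finset_inh (Dom finset_inh f)) = f"
      "Comp finset_inh (Ide finset_inh (Cod finset_inh f)) f = f"
      using c(5,6)[OF h] by simp_all
    fix g :: "'u fn" assume g: "g \<in> Arr finset_inh" "Cod finset_inh f = Dom finset_inh g"
    have hg: "g \<in> Hom set_cat (target f) (target g)"
      using g by (simp add: Hom_def Arr_finset set_cat_Arr small_finite)
    show "Comp finset_inh g f \<in> Hom finset_inh (Dom finset_inh f) (Cod finset_inh g)"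
      using c(4)[OF h hg] f g unfolding Hom_def by (auto simp: Arr_finset set_cat_Arr)
    fix k :: "'u fn" assume k: "k \<in> Arr finset_inh" "Cod finset_inh g = Dom finset_inh k"
    have hk: "k \<in> Hom set_cat (target g) (target k)"
      using k by (simp add: Hom_def Arr_finset set_cat_Arr small_finite)
    show "Comp finset_inh k (Comp finset_inh g f) = Comp finset_inh (Comp finset_inh k g) f"
      using c(7)[OF h hg hk] by simp
  next
    fix A :: "'u set" assume "A \<in> Obj finset_inh"
    then show "Ide finset_inh A \<in> Hom finset_inh A A"
      by (simp add: Obj_finset Hom_def Arr_finset)
  qed
qed

abbreviation IC :: "('u inh_obj, 'u inh_arr) cat" where "IC \<equiv> inh_classifier"

lemma IC_Sets: "IC = finset.Sets"
  by (simp add: inh_classifier_def)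

lemma category_IC: "category IC"
  using finset.category_Sets by (simp add: IC_Sets)

lemma Arrow_finset: "fs A \<Longrightarrow> fs B \<Longrightarrow> f \<in> A \<rightarrow> B \<Longrightarrow> Arrow A (restrict f A) B \<in> Arr finset_inh"
  for A B :: "'u set"
  by (auto simp: Arr_finset)

lemma small_obj: "F \<in> Obj IC \<Longrightarrow> fs A \<Longrightarrow> small TYPE('u) (omap F A)"
  using finset.small_omap[of F A] by (simp add: IC_Sets Obj_finset)

lemma push_in:
  assumes "F \<in> Obj IC" "fs A" "fs B" "f \<in> A \<rightarrow> B" "a \<in> omap F A"
  shows "push F A B f a \<in> omap F B"
  using finset.act_in[of F "Arrow A (restrict f A) B" a] assms Arrow_finset[OF assms(2,3,4)]
  by (simp add: push_def IC_Sets)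

lemma push_id:
  assumes "F \<in> Obj IC" "fs A" "a \<in> omap F A"
  shows "push F A A (\<lambda>x. x) a = a"
  using finset.act_Ide[of F A a] assms by (simp add: push_def IC_Sets Obj_finset)

lemma push_push:
  assumes "F \<in> Obj IC" "fs A" "fs B" "fs C" "f \<in> A \<rightarrow> B" "g \<in> B \<rightarrow> C" "a \<in> omap F A"
  shows "push F B C g (push F A B f a) = push F A C (\<lambda>x. g (f x)) a"
proof -
  have "Comp finset_inh (Arrow B (restrict g B) C) (Arrow A (restrict f A) B) =
      Arrow A (restrict (\<lambda>x. g (f x)) A) C"
    using assms(5) by (auto simp: compose_def fun_eq_iff)
  then show ?thesis
    using finset.act_Comp[of F "Arrow A (restrict f A) B" "Arrow B (restrict g B) C" a]
      assms Arrow_finset[OF assms(2,3,5)] Arrow_finset[OF assms(3,4,6)]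
    by (simp add: push_def IC_Sets del: set_cat_sel)
qed

text \<open>An injection with non-empty domain has a left inverse, and every functor preserves split
  monomorphisms.\<close>

lemma push_inject:
  assumes F: "F \<in> Obj IC" and A: "fs A" and B: "fs B" and f: "f \<in> A \<rightarrow> B" and inj: "inj_on f A"
    and a: "a \<in> omap F A" "b \<in> omap F A" and eq: "push F A B f a = push F A B f b"
  shows "a = b"
proof -
  obtain a0 where a0: "a0 \<in> A" using A by blast
  \<comment> \<open>The left inverse; points off the image go to the fixed element
    \<open>a0\<close>.\<close>
  define r where "r y = (if y \<in> f ` A then inv_into A f y else a0)" for y
  have r: "r \<in> B \<rightarrow> A" using a0 by (auto simp: r_def inv_into_into)
  have "push F B A r (push F A B f c) = c" if c: "c \<in> omap F A" for c
  proof -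
    have "push F B A r (push F A B f c) = push F A A (\<lambda>x. r (f x)) c"
      by (rule push_push[OF F A B A f r c])
    also have "\<dots> = push F A A (\<lambda>x. x) c"
      by (rule push_cong) (simp add: r_def inv_into_f_f[OF inj])
    finally show ?thesis using push_id[OF F A c] by simp
  qed
  then show ?thesis using a eq by metis
qed

text \<open>For functors whose natural values are not subsets of \<open>'u\<close>: the values
  \<open>Q A\<close> lie in any type and are coded. The representable functors, the right adjoint
  and a two-valued constant functor are obtained this way.\<close>

lemma mk_fun_IC:
  fixes Q :: "'u set \<Rightarrow> 'a set" and t :: "'u set \<Rightarrow> 'u set \<Rightarrow> ('u \<Rightarrow> 'u) \<Rightarrow> 'a \<Rightarrow> 'a"
  assumes sm: "\<And>A. fs A \<Longrightarrow> small TYPE('u) (Q A)"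
    and t: "\<And>A B f q. fs A \<Longrightarrow> fs B \<Longrightarrow> f \<in> A \<rightarrow>\<^sub>E B \<Longrightarrow> q \<in> Q A \<Longrightarrow> t A B f q \<in> Q B"
    and tid: "\<And>A q. fs A \<Longrightarrow> q \<in> Q A \<Longrightarrow> t A A (restrict (\<lambda>x. x) A) q = q"
    and tcomp: "\<And>A B C f g q. fs A \<Longrightarrow> fs B \<Longrightarrow> fs C \<Longrightarrow> f \<in> A \<rightarrow>\<^sub>E B \<Longrightarrow> g \<in> B \<rightarrow>\<^sub>E C \<Longrightarrow>
       q \<in> Q A \<Longrightarrow> t A C (compose A g f) q = t B C g (t A B f q)"
  obtains F where "F \<in> Obj IC" "\<And>A. fs A \<Longrightarrow> omap F A = code (Q A) ` Q A"
    "\<And>A B f q. fs A \<Longrightarrow> fs B \<Longrightarrow> f \<in> A \<rightarrow> B \<Longrightarrow> q \<in> Q A \<Longrightarrow>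
       push F A B f (code (Q A) q) = code (Q B) (t A B (restrict f A) q)"
proof
  let ?Q = "\<lambda>A. code (Q A) ` Q A :: 'u set"
  let ?t = "\<lambda>(m :: 'u fn) (v :: 'u). code (Q (target m)) (t (source m) (target m) (body m) (decode (Q (source m)) v)) :: 'u"
  let ?F = "mk_fun finset_inh ?Q ?t :: 'u inh_obj"
  show "?F \<in> Obj IC"
    unfolding IC_Sets
  proof (rule finset.mk_fun_Obj)
    fix A :: "'u set" assume "A \<in> Obj finset_inh"
    then show "small TYPE('u) (?Q A)" using sm by (simp add: Obj_finset small_image)
  next
    fix f :: "'u fn" and a assume "f \<in> Arr finset_inh" "a \<in> ?Q (Dom finset_inh f)"
    then show "?t f a \<in> ?Q (Cod finset_inh f)"
      using t by (auto simp: Arr_finset decode_in)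
  next
    fix A :: "'u set" and a assume "A \<in> Obj finset_inh" "a \<in> ?Q A"
    then show "?t (Ide finset_inh A) a = a"
      using tid[of A "decode (Q A) a"] by (simp add: Obj_finset decode_in code_decode)
  next
    fix f g :: "'u fn" and a
    assume fg: "f \<in> Arr finset_inh" "g \<in> Arr finset_inh" "Cod finset_inh f = Dom finset_inh g"
      and a: "a \<in> ?Q (Dom finset_inh f)"
    obtain A f' B where f: "f = Arrow A f' B" by (cases f)
    obtain g' C where g: "g = Arrow B g' C" using fg(3) f by (cases g) auto
    show "?t (Comp finset_inh g f) a = ?t g (?t f a)"
      using fg a tcomp[of A B C f' g' "decode (Q A) a"] t[of A B f' "decode (Q A) a"]
        decode_code[OF sm, of B "t A B f' (decode (Q A) a)"]
      by (simp add: f g Arr_finset decode_in)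
  qed
  show "omap ?F A = ?Q A" if "fs A" for A
    using that by (intro finset.omap_mk_fun) (simp add: Obj_finset)
  show "push ?F A B f (code (Q A) q) = code (Q B) (t A B (restrict f A) q)"
    if "fs A" "fs B" "f \<in> A \<rightarrow> B" "q \<in> Q A" for A B f q
    using that Arrow_finset[OF that(1-3)] by (simp add: push_def decode_code[OF sm])
qed

lemma mk_nat_IC_Hom:
  assumes F: "F \<in> Obj IC" and G: "G \<in> Obj IC"
    and h: "\<And>A a. fs A \<Longrightarrow> a \<in> omap F A \<Longrightarrow> h A a \<in> omap G A"
    and nat: "\<And>A B f a. fs A \<Longrightarrow> fs B \<Longrightarrow> f \<in> A \<rightarrow> B \<Longrightarrow> a \<in> omap F A \<Longrightarrow>
      push G A B f (h A a) = h B (push F A B f a)"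
  shows "mk_nat finset_inh F G h \<in> Hom IC F G"
  unfolding IC_Sets
proof (rule finset.mk_nat_Hom)
  show "F \<in> Obj finset.Sets" "G \<in> Obj finset.Sets" using F G by (simp_all add: IC_Sets)
  show "h c a \<in> omap G c" if "c \<in> Obj finset_inh" "a \<in> omap F c" for c a
    using that h by (simp add: Obj_finset)
  fix f :: "'u fn" and a assume f: "f \<in> Arr finset_inh" and a: "a \<in> omap F (Dom finset_inh f)"
  obtain A f' B where f': "f = Arrow A f' B" by (cases f)
  have fe: "restrict f' A = f'" using f by (auto simp: f' Arr_finset PiE_iff extensional_def fun_eq_iff)
  show "act G f (h (Dom finset_inh f) a) = h (Cod finset_inh f) (act F f a)"
    using nat[of A B f' a] f a fe by (auto simp: f' Arr_finset push_def)
qed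

lemma app_mk_nat_IC: "fs (A :: 'u set) \<Longrightarrow> a \<in> omap F A \<Longrightarrow> app (mk_nat finset_inh F G h) A a = h A a"
  by (simp add: Obj_finset)

lemma IC_Hom_Obj: "\<eta> \<in> Hom IC F G \<Longrightarrow> F \<in> Obj IC" "\<eta> \<in> Hom IC F G \<Longrightarrow> G \<in> Obj IC"
  unfolding IC_Sets by (rule finset.Hom_Sets_Obj1, assumption, rule finset.Hom_Sets_Obj2)

lemma IC_app_in: "\<eta> \<in> Hom IC F G \<Longrightarrow> fs A \<Longrightarrow> a \<in> omap F A \<Longrightarrow> app \<eta> A a \<in> omap G A"
  unfolding IC_Sets by (rule finset.app_in) (simp_all add: Obj_finset)

lemma IC_app_push:
  assumes "\<eta> \<in> Hom IC F G" "fs A" "fs B" "f \<in> A \<rightarrow> B" "a \<in> omap F A"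
  shows "push G A B f (app \<eta> A a) = app \<eta> B (push F A B f a)"
  using finset.app_natural[of \<eta> F G "Arrow A (restrict f A) B" a] assms Arrow_finset[OF assms(2-4)]
  by (simp add: push_def IC_Sets)

lemma IC_Hom_ext:
  assumes "\<eta> \<in> Hom IC F G" "\<theta> \<in> Hom IC F G"
    and "\<And>A a. fs A \<Longrightarrow> a \<in> omap F A \<Longrightarrow> app \<eta> A a = app \<theta> A a"
  shows "\<eta> = \<theta>"
  using assms unfolding IC_Sets by (intro finset.Hom_Sets_ext) (auto simp: Obj_finset)

lemma IC_app_Comp:
  assumes "\<eta> \<in> Hom IC F G" "\<theta> \<in> Hom IC G H" "fs A" "a \<in> omap F A"
  shows "app (Comp IC \<theta> \<eta>) A a = app \<theta> A (app \<eta> A a)"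
  using assms unfolding IC_Sets by (intro finset.app_Comp) (auto simp: Obj_finset)

lemma IC_app_Ide: "fs A \<Longrightarrow> a \<in> omap F A \<Longrightarrow> app (Ide IC F) A a = a"
  unfolding IC_Sets by (rule finset.app_Ide) (simp_all add: Obj_finset)

lemma
  shows universal_Obj: "(universal_inh :: 'u inh_obj) \<in> Obj IC"
    and universal_omap: "fs A \<Longrightarrow> omap (universal_inh :: 'u inh_obj) A = A"
    and universal_push: "fs A \<Longrightarrow> fs B \<Longrightarrow> f \<in> A \<rightarrow> B \<Longrightarrow> a \<in> A \<Longrightarrow>
      push (universal_inh :: 'u inh_obj) A B f a = f a"
proof -
  have eq: "(universal_inh :: 'u inh_obj) = mk_fun finset_inh (\<lambda>A. A) (\<lambda>m. body m)"
  proof -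
    have "amap (universal_inh :: 'u inh_obj) m = amap (mk_fun finset_inh (\<lambda>A. A) (\<lambda>m. body m)) m" for m :: "'u fn"
      by (cases m) (auto simp: universal_inh_def mk_fun_def Arr_finset PiE_iff extensional_def fun_eq_iff)
    then show ?thesis by (auto simp: universal_inh_def mk_fun_def)
  qed
  show "(universal_inh :: 'u inh_obj) \<in> Obj IC"
    unfolding IC_Sets eq
    by (rule finset.mk_fun_Obj)
       (auto simp: Obj_finset Arr_finset small_finite compose_def set_cat_def)
  show u: "omap (universal_inh :: 'u inh_obj) A = A" if "fs A" for A
    using that by (simp add: universal_inh_def Obj_finset)
  show "push (universal_inh :: 'u inh_obj) A B f a = f a" if "fs A" "fs B" "f \<in> A \<rightarrow> B" "a \<in> A"
    using that Arrow_finset[OF that(1-3)] by (simp add: universal_inh_def push_def act_def)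
qed

end


section \<open>The extension of a functor to an infinite set\<close>

locale infinite_carrier = inaccessible_universe U for U :: "'u itself" +
  fixes S :: "'u set"
  assumes small_S: "small TYPE('u) S" and infinite_S: "infinite S"
begin

text \<open>A triple \<open>(A, x, a)\<close> with \<open>x : A \<rightarrow> S\<close> and \<open>a \<in> F(A)\<close> represents an element of the directed
  colimit of \<open>F\<close> over the non-empty finite subsets of \<open>S\<close>: its class \<open>cls F A x a\<close>, which \<open>br F A x a\<close>
  encodes in \<open>'u\<close>.\<close>

definition cls :: "'u inh_obj \<Rightarrow> 'u set \<Rightarrow> ('u \<Rightarrow> 'u) \<Rightarrow> 'u \<Rightarrow> ('u set \<times> 'u) set" where
  "cls F A x a = {(B, b). fs B \<and> B \<subseteq> S \<and> b \<in> omap F B \<and>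
     (\<exists>C. fs C \<and> C \<subseteq> S \<and> B \<subseteq> C \<and> x ` A \<subseteq> C \<and> push F B C (\<lambda>i. i) b = push F A C x a)}"

definition rep :: "'u inh_obj \<Rightarrow> 'u set \<Rightarrow> ('u \<Rightarrow> 'u) \<Rightarrow> 'u \<Rightarrow> bool" where
  "rep F A x a \<longleftrightarrow> fs A \<and> x \<in> A \<rightarrow> S \<and> a \<in> omap F A"

definition ext_classes :: "'u inh_obj \<Rightarrow> ('u set \<times> 'u) set set" where
  "ext_classes F = {cls F A x a | A x a. rep F A x a}"

definition br :: "'u inh_obj \<Rightarrow> 'u set \<Rightarrow> ('u \<Rightarrow> 'u) \<Rightarrow> 'u \<Rightarrow> 'u" where
  "br F A x a = code (ext_classes F) (cls F A x a)"

definition ext :: "'u inh_obj \<Rightarrow> 'u set" where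
  "ext F = code (ext_classes F) ` ext_classes F"

lemma push_enlarge:
  assumes F: "F \<in> Obj IC" and A: "rep F A x a" and C: "fs C" "fs D" "C \<subseteq> D" "x ` A \<subseteq> C"
  shows "push F C D (\<lambda>i. i) (push F A C x a) = push F A D x a"
  using push_push[OF F, of A C D x "\<lambda>i. i" a] A C by (auto simp: rep_def)

text \<open>The relation is transitive because the finite subsets of \<open>S\<close> are directed:
  two stages of agreement \<open>C\<close> and \<open>C'\<close> lie in their union. Conversely, the
  class of a triple contains the image of \<open>a\<close> over the image of \<open>A\<close> under
  \<open>x\<close>, so equal classes agree on that member.\<close>

lemma cls_eq_iff:
  assumes F: "F \<in> Obj IC" and A: "rep F A x a" and B: "rep F B y b"
  shows "cls F A x a = cls F B y b \<longleftrightarrow>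
    (\<exists>C. fs C \<and> C \<subseteq> S \<and> x ` A \<subseteq> C \<and> y ` B \<subseteq> C \<and> push F A C x a = push F B C y b)" (is "_ \<longleftrightarrow> ?R")
proof
  assume eq: "cls F A x a = cls F B y b"
  have A': "fs (x ` A)" "x \<in> A \<rightarrow> x ` A" "a \<in> omap F A" "x ` A \<subseteq> S" "fs A" using A by (auto simp: rep_def)
  let ?c = "push F A (x ` A) x a"
  have c: "?c \<in> omap F (x ` A)" using push_in[OF F] A' by auto
  have "(x ` A, ?c) \<in> cls F A x a"
    unfolding cls_def using A' c push_id[OF F A'(1) c] by (auto intro!: exI[of _ "x ` A"])
  then obtain C where "fs C" "C \<subseteq> S" "x ` A \<subseteq> C" "y ` B \<subseteq> C"
    "push F (x ` A) C (\<lambda>i. i) ?c = push F B C y b"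
    unfolding eq by (auto simp: cls_def)
  then show ?R using push_enlarge[OF F A, of "x ` A" C] A' by auto
next
  have *: "cls F A x a \<subseteq> cls F B y b"
    if A: "rep F A x a" and B: "rep F B y b" and C: "fs C" "C \<subseteq> S" "x ` A \<subseteq> C" "y ` B \<subseteq> C"
    and eq: "push F A C x a = push F B C y b" for A x a B y b C
  proof clarify
    fix D d assume "(D, d) \<in> cls F A x a"
    then obtain C' where D: "rep F D (\<lambda>i. i) d" "D \<subseteq> S" and C': "fs C'" "C' \<subseteq> S" "D \<subseteq> C'" "x ` A \<subseteq> C'"
      and eq': "push F D C' (\<lambda>i. i) d = push F A C' x a" by (auto simp: cls_def rep_def)
    let ?E = "C \<union> C'"
    have "push F D ?E (\<lambda>i. i) d = push F A ?E x a"
      using push_enlarge[OF F D(1), of C' ?E] push_enlarge[OF F A, of C' ?E] C C' eq' by auto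
    also have "\<dots> = push F B ?E y b"
      using push_enlarge[OF F A, of C ?E] push_enlarge[OF F B, of C ?E] C C' eq by auto
    finally have "push F D ?E (\<lambda>i. i) d = push F B ?E y b" .
    moreover have "fs ?E" "?E \<subseteq> S" "D \<subseteq> ?E" "y ` B \<subseteq> ?E" using C C' by auto
    ultimately show "(D, d) \<in> cls F B y b"
      using D unfolding cls_def rep_def by blast
  qed
  assume ?R
  then obtain C where "fs C" "C \<subseteq> S" "x ` A \<subseteq> C" "y ` B \<subseteq> C" "push F A C x a = push F B C y b" by blast
  then show "cls F A x a = cls F B y b" using *[OF A B, of C] *[OF B A, of C] by simp
qed

text \<open>Moving \<open>f\<close> from the coordinates to the element is the coend relation
  between \<open>F\<close> and the powers of \<open>S\<close>. Maps out of \<open>ext F\<close> are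
  well defined once they respect it.\<close>

lemma cls_push:
  assumes F: "F \<in> Obj IC" and A: "fs A" "a \<in> omap F A" and B: "fs B" "f \<in> A \<rightarrow> B" "x \<in> B \<rightarrow> S"
  shows "cls F A (\<lambda>i. x (f i)) a = cls F B x (push F A B f a)"
proof -
  have r: "rep F A (\<lambda>i. x (f i)) a" "rep F B x (push F A B f a)"
    using A B push_in[OF F A(1) B(1,2) A(2)] by (auto simp: rep_def)
  have "push F A (x ` B) (\<lambda>i. x (f i)) a = push F B (x ` B) x (push F A B f a)"
    using push_push[OF F A(1) B(1) _ B(2) _ A(2), of "x ` B" x] B(1) by auto
  then show ?thesis
    unfolding cls_eq_iff[OF F r] using B by (intro exI[of _ "x ` B"]) auto
qed

lemma cls_cong:
  assumes "\<And>i. i \<in> A \<Longrightarrow> x i = y i" shows "cls F A x a = cls F A y a"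
proof -
  have "x ` A = y ` A" using assms by auto
  moreover have "push F A C x a = push F A C y a" for C by (rule push_cong[OF assms])
  ultimately show ?thesis unfolding cls_def by simp
qed

lemma cls_image:
  assumes F: "F \<in> Obj IC" and A: "rep F A x a"
  shows "cls F A x a = cls F (x ` A) (\<lambda>i. i) (push F A (x ` A) x a)"
    and "rep F (x ` A) (\<lambda>i. i) (push F A (x ` A) x a)"
proof -
  show "cls F A x a = cls F (x ` A) (\<lambda>i. i) (push F A (x ` A) x a)"
    using A by (intro cls_push[OF F, of A a "x ` A" x "\<lambda>i. i"]) (auto simp: rep_def)
  show "rep F (x ` A) (\<lambda>i. i) (push F A (x ` A) x a)"
    using A push_in[OF F, of A "x ` A" x a] by (auto simp: rep_def)
qed

text \<open>Every class is represented over the inclusion of a finite subset of \<open>S\<close>,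
  and such subsets and the values of \<open>F\<close> on them form small families.\<close>

lemma small_ext_classes:
  assumes F: "F \<in> Obj IC" shows "small TYPE('u) (ext_classes F)"
proof -
  let ?I = "{A. fs A \<and> A \<subseteq> S}"
  have "small TYPE('u) ?I" by (rule small_subset[OF small_Pow[OF small_S]]) auto
  then have "small TYPE('u) (\<Union>A\<in>?I. cls F A (\<lambda>i. i) ` omap F A)"
    by (intro small_UN small_image) (auto intro: small_obj[OF F])
  moreover have "ext_classes F \<subseteq> (\<Union>A\<in>?I. cls F A (\<lambda>i. i) ` omap F A)"
  proof
    fix u assume "u \<in> ext_classes F"
    then obtain A x a where u: "u = cls F A x a" and r: "rep F A x a" by (auto simp: ext_classes_def)
    show "u \<in> (\<Union>A\<in>?I. cls F A (\<lambda>i. i) ` omap F A)"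
      using cls_image[OF F r] unfolding u rep_def
      by (intro UN_I[of "x ` A"]) (auto intro!: imageI)
  qed
  ultimately show ?thesis by (rule small_subset)
qed

lemma small_ext: "F \<in> Obj IC \<Longrightarrow> small TYPE('u) (ext F)"
  unfolding ext_def by (intro small_image small_ext_classes)

lemma br_in: "rep F A x a \<Longrightarrow> br F A x a \<in> ext F"
  unfolding br_def ext_def ext_classes_def by blast

lemma br_eq_iff:
  assumes F: "F \<in> Obj IC" and A: "rep F A x a" and B: "rep F B y b"
  shows "br F A x a = br F B y b \<longleftrightarrow>
    (\<exists>C. fs C \<and> C \<subseteq> S \<and> x ` A \<subseteq> C \<and> y ` B \<subseteq> C \<and> push F A C x a = push F B C y b)"
proof -
  have "cls F A x a \<in> ext_classes F" "cls F B y b \<in> ext_classes F"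
    using A B unfolding ext_classes_def by blast+
  then show ?thesis
    unfolding br_def by (simp add: code_inject[OF small_ext_classes[OF F]] cls_eq_iff[OF F A B])
qed

lemma br_push:
  assumes "F \<in> Obj IC" "fs A" "a \<in> omap F A" "fs B" "f \<in> A \<rightarrow> B" "x \<in> B \<rightarrow> S"
  shows "br F A (\<lambda>i. x (f i)) a = br F B x (push F A B f a)"
  using cls_push[OF assms] by (simp add: br_def)

lemma br_cong: "(\<And>i. i \<in> A \<Longrightarrow> x i = y i) \<Longrightarrow> br F A x a = br F A y a"
  unfolding br_def by (metis cls_cong)

lemma ext_cases:
  assumes F: "F \<in> Obj IC" and u: "u \<in> ext F"
  obtains A a where "fs A" "A \<subseteq> S" "a \<in> omap F A" "u = br F A (\<lambda>i. i) a"
proof -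
  obtain A x a where "u = br F A x a" and r: "rep F A x a"
    using u by (auto simp: ext_def ext_classes_def br_def)
  then have "u = br F (x ` A) (\<lambda>i. i) (push F A (x ` A) x a)"
    using cls_image(1)[OF F r] by (simp add: br_def)
  then show thesis using that cls_image(2)[OF F r] r by (auto simp: rep_def)
qed

text \<open>Injective coordinates lose no information, because \<open>F\<close> takes the injection
  into a common stage to an injection.\<close>

lemma br_inject:
  assumes F: "F \<in> Obj IC" and A: "rep F A x a" "b \<in> omap F A" and inj: "inj_on x A"
    and eq: "br F A x a = br F A x b"
  shows "a = b"
proof -
  have b: "rep F A x b" using A by (simp add: rep_def)
  obtain C where "fs C" "x ` A \<subseteq> C" "push F A C x a = push F A C x b"
    using eq unfolding br_eq_iff[OF F A(1) b] by auto
  then show ?thesis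
    using A by (intro push_inject[OF F _ _ _ inj, of C a b]) (auto simp: rep_def)
qed

section \<open>Maps out of the extension and its functoriality in both variables\<close>

definition lift :: "'u inh_obj \<Rightarrow> ('u set \<Rightarrow> ('u \<Rightarrow> 'u) \<Rightarrow> 'u \<Rightarrow> 'b) \<Rightarrow> 'u \<Rightarrow> 'b" where
  "lift F k u = (case SOME (A, a). rep F A (\<lambda>i. i) a \<and> u = br F A (\<lambda>i. i) a of (A, a) \<Rightarrow> k A (\<lambda>i. i) a)"

text \<open>The representative chosen by \<open>lift\<close> and the given triple agree at some
  stage \<open>C\<close>; the hypothesis on \<open>k\<close> moves both of them there.\<close>

lemma lift_br:
  assumes F: "F \<in> Obj IC"
    and k: "\<And>A B f x a. fs A \<Longrightarrow> fs B \<Longrightarrow> f \<in> A \<rightarrow> B \<Longrightarrow> x \<in> B \<rightarrow> S \<Longrightarrow> a \<in> omap F A \<Longrightarrow>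
      k A (\<lambda>i. x (f i)) a = k B x (push F A B f a)"
    and A: "rep F A x a"
  shows "lift F k (br F A x a) = k A x a"
proof -
  let ?P = "\<lambda>(B, b). rep F B (\<lambda>i. i) b \<and> br F A x a = br F B (\<lambda>i. i) b"
  obtain B b where Bb: "(SOME p. ?P p) = (B, b)" by (cases "SOME p. ?P p")
  obtain A' a' where "fs A'" "A' \<subseteq> S" "a' \<in> omap F A'" "br F A x a = br F A' (\<lambda>i. i) a'"
    using ext_cases[OF F br_in[OF A]] .
  then have "?P (A', a')" by (auto simp: rep_def)
  then have "\<exists>p. ?P p" ..
  then have "?P (SOME p. ?P p)" by (rule someI_ex)
  then have B: "rep F B (\<lambda>i. i) b" and eq: "br F A x a = br F B (\<lambda>i. i) b" by (auto simp: Bb)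
  then obtain C where C: "fs C" "C \<subseteq> S" "x ` A \<subseteq> C" "B \<subseteq> C"
    "push F A C x a = push F B C (\<lambda>i. i) b"
    using br_eq_iff[OF F A B] by auto
  have "k B (\<lambda>i. i) b = k C (\<lambda>i. i) (push F B C (\<lambda>i. i) b)"
    using k[of B C "\<lambda>i. i" "\<lambda>i. i" b] B C by (auto simp: rep_def)
  also have "\<dots> = k C (\<lambda>i. i) (push F A C x a)" using C by simp
  also have "\<dots> = k A x a"
    using k[of A C x "\<lambda>i. i" a] A C by (simp add: rep_def image_subset_iff_funcset subset_iff)
  finally show ?thesis by (simp add: lift_def Bb)
qed

text \<open>Functoriality of the extension in its argument set, through which every self-map of
  \<open>S\<close> acts on \<open>ext F\<close>.\<close>

definition emap :: "'u inh_obj \<Rightarrow> ('u \<Rightarrow> 'u) \<Rightarrow> 'u \<Rightarrow> 'u" where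
  "emap F w = lift F (\<lambda>A x a. br F A (\<lambda>i. w (x i)) a)"

lemma emap_br:
  assumes F: "F \<in> Obj IC" and w: "w \<in> S \<rightarrow> S" and A: "rep F A x a"
  shows "emap F w (br F A x a) = br F A (\<lambda>i. w (x i)) a"
  unfolding emap_def
proof (rule lift_br[OF F _ A])
  fix A B :: "'u set" and f x a assume "fs A" "fs B" "f \<in> A \<rightarrow> B" "x \<in> B \<rightarrow> S" "a \<in> omap F A"
  then show "br F A (\<lambda>i. w (x (f i))) a = br F B (\<lambda>i. w (x i)) (push F A B f a)"
    using br_push[OF F, of A a B f "\<lambda>i. w (x i)"] w by auto
qed

lemma rep_comp: "rep F A x a \<Longrightarrow> w \<in> S \<rightarrow> S \<Longrightarrow> rep F A (\<lambda>i. w (x i)) a"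
  by (auto simp: rep_def)

lemma emap_in:
  assumes F: "F \<in> Obj IC" and w: "w \<in> S \<rightarrow> S" and u: "u \<in> ext F"
  shows "emap F w u \<in> ext F"
  using ext_cases[OF F u]
proof cases
  case (1 A a)
  then have r: "rep F A (\<lambda>i. i) a" by (auto simp: rep_def)
  show ?thesis using emap_br[OF F w r] br_in[OF rep_comp[OF r w]] 1 by simp
qed

definition ext_trans :: "'u inh_arr \<Rightarrow> 'u \<Rightarrow> 'u" where
  "ext_trans \<eta> = lift (source \<eta>) (\<lambda>A x a. br (target \<eta>) A x (app \<eta> A a))"

lemma ext_trans_br:
  assumes \<eta>: "\<eta> \<in> Hom IC F G" and A: "rep F A x a"
  shows "ext_trans \<eta> (br F A x a) = br G A x (app \<eta> A a)"
proof -
  have st: "source \<eta> = F" "target \<eta> = G"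
    using \<eta> by (auto simp: Hom_def inh_classifier_def functor_category_def)
  show ?thesis
    unfolding ext_trans_def st
  proof (rule lift_br[OF IC_Hom_Obj(1)[OF \<eta>] _ A])
    fix A B :: "'u set" and f x a assume *: "fs A" "fs B" "f \<in> A \<rightarrow> B" "x \<in> B \<rightarrow> S" "a \<in> omap F A"
    show "br G A (\<lambda>i. x (f i)) (app \<eta> A a) = br G B x (app \<eta> B (push F A B f a))"
      using br_push[OF IC_Hom_Obj(2)[OF \<eta>] _ _ *(2,3,4), of "app \<eta> A a"] *
        IC_app_in[OF \<eta> *(1,5)] IC_app_push[OF \<eta> *(1-3,5)] by simp
  qed
qed

end


section \<open>The encoding topos of the empty language\<close>

definition empty_lang :: "nat language" where
  "empty_lang = \<lparr>symbols = {}, arity = (\<lambda>_. 1)\<rparr>"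

definition loops :: "nat enc_edge set" where
  "loops = {Proj n i | n i. enat i < n} \<union> {Proj' n i | n i. i < n}"

abbreviation loop_cat :: "(nat enc_vertex, (nat enc_vertex, nat enc_edge list) arrow) cat" where
  "loop_cat \<equiv> free_category (encoding_graph empty_lang)"

text \<open>Loops at one vertex can be concatenated freely, so the path category is the free monoid
  on \<open>loops\<close>, seen as a category with one object.\<close>

lemma awalk_loops:
  "pre_digraph.awalk (encoding_graph empty_lang) a p b \<longleftrightarrow> a = V \<and> b = V \<and> set p \<subseteq> loops"
proof -
  have [simp]: "verts (encoding_graph empty_lang) = {V}" "arcs (encoding_graph empty_lang) = loops"
    "tail (encoding_graph empty_lang) = edge_tail" "head (encoding_graph empty_lang) = edge_head"
    by (auto simp: encoding_graph_def empty_lang_def loops_def)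
  have "pre_digraph.cas (encoding_graph empty_lang) V p V" if "set p \<subseteq> loops"
    using that
    by (induction p) (auto simp: pre_digraph.cas.simps loops_def)
  moreover have "b = V" if "pre_digraph.cas (encoding_graph empty_lang) V p b" "set p \<subseteq> loops"
    using that
    by (induction p) (auto simp: pre_digraph.cas.simps loops_def)
  ultimately show ?thesis unfolding pre_digraph.awalk_def by auto
qed

lemma loop_cat_sel [simp]:
  "Obj loop_cat = {V}" "Dom loop_cat = source" "Cod loop_cat = target"
  "Ide loop_cat a = Arrow a [] a"
  "Comp loop_cat q p = Arrow (source p) (body p @ body q) (target q)"
  by (simp_all add: free_category_def encoding_graph_def empty_lang_def)

lemma Arr_loop_cat: "m \<in> Arr loop_cat \<longleftrightarrow> (\<exists>p. m = Arrow V p V \<and> set p \<subseteq> loops)"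
  by (auto simp: free_category_def awalk_loops)

interpretation loop: index_category loop_cat
proof
  show "category loop_cat"
    unfolding category_def by (auto simp: Arr_loop_cat Hom_def subset_iff)
qed

type_synonym 'u eobj = "(nat, 'u) enc_obj"
type_synonym 'u earr = "(nat, 'u) enc_arr"

abbreviation ET :: "('u eobj, 'u earr) cat" where "ET \<equiv> encoding_topos empty_lang"

lemma ET_Sets: "ET = loop.Sets"
  by (simp add: encoding_topos_def full_subcategory_def empty_lang_def)

lemma category_ET: "category ET"
  using loop.category_Sets by (simp add: ET_Sets)

abbreviation car :: "'u eobj \<Rightarrow> 'u set" where "car X \<equiv> omap X V"

definition eact :: "'u eobj \<Rightarrow> nat enc_edge \<Rightarrow> 'u \<Rightarrow> 'u" where
  "eact X e = act X (Arrow V [e] V)"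

lemma eact_in: "X \<in> Obj ET \<Longrightarrow> e \<in> loops \<Longrightarrow> v \<in> car X \<Longrightarrow> eact X e v \<in> car X"
  using loop.act_in[of X "Arrow V [e] V" v] by (simp add: ET_Sets eact_def Arr_loop_cat)

text \<open>A path is traversed from the head of its list, which is the order in which
  \<open>fold\<close> applies the operations.\<close>

lemma act_fold:
  assumes X: "X \<in> Obj ET" and p: "set p \<subseteq> loops" and v: "v \<in> car X"
  shows "act X (Arrow V p V) v = fold (eact X) p v"
  using p v
proof (induction p arbitrary: v)
  case Nil
  then show ?case using loop.act_Ide[of X V v] X by (simp add: ET_Sets)
next
  case (Cons e p)
  have "act X (Comp loop_cat (Arrow V p V) (Arrow V [e] V)) v = act X (Arrow V p V) (act X (Arrow V [e] V) v)"
    using X Cons.prems by (intro loop.act_Comp) (auto simp: ET_Sets Arr_loop_cat)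
  then show ?case using Cons.IH[of "eact X e v"] Cons.prems eact_in[OF X] by (simp add: eact_def)
qed

lemma ET_HomI:
  assumes X: "X \<in> Obj ET" and Y: "Y \<in> Obj ET"
    and h: "\<And>v. v \<in> car X \<Longrightarrow> h v \<in> car Y"
    and eq: "\<And>e v. e \<in> loops \<Longrightarrow> v \<in> car X \<Longrightarrow> eact Y e (h v) = h (eact X e v)"
  shows "mk_nat loop_cat X Y (\<lambda>_. h) \<in> Hom ET X Y"
  unfolding ET_Sets
proof (rule loop.mk_nat_Hom)
  show "X \<in> Obj loop.Sets" "Y \<in> Obj loop.Sets" using X Y by (simp_all add: ET_Sets)
  show "\<And>c a. c \<in> Obj loop_cat \<Longrightarrow> a \<in> omap X c \<Longrightarrow> h a \<in> omap Y c" using h by simp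
  fix f a assume "f \<in> Arr loop_cat" "a \<in> omap X (Dom loop_cat f)"
  then obtain p where f: "f = Arrow V p V" "set p \<subseteq> loops" and a: "a \<in> car X"
    by (auto simp: Arr_loop_cat)
  have "fold (eact Y) p (h a) = h (fold (eact X) p a)"
    using f(2) a
  proof (induction p arbitrary: a)
    case (Cons e p)
    then show ?case using eq[of e a] eact_in[OF X, of e a] by simp
  qed simp
  then show "act Y f (h a) = h (act X f a)"
    using act_fold[OF X f(2) a] act_fold[OF Y f(2) h[OF a]] f by simp
qed

lemma ET_Hom_Obj: "\<eta> \<in> Hom ET X Y \<Longrightarrow> X \<in> Obj ET" "\<eta> \<in> Hom ET X Y \<Longrightarrow> Y \<in> Obj ET"
  unfolding ET_Sets by (rule loop.Hom_Sets_Obj1, assumption, rule loop.Hom_Sets_Obj2)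

lemma ET_app_in: "\<eta> \<in> Hom ET X Y \<Longrightarrow> v \<in> car X \<Longrightarrow> app \<eta> V v \<in> car Y"
  unfolding ET_Sets by (rule loop.app_in) simp_all

lemma ET_app_eact:
  "\<eta> \<in> Hom ET X Y \<Longrightarrow> e \<in> loops \<Longrightarrow> v \<in> car X \<Longrightarrow> eact Y e (app \<eta> V v) = app \<eta> V (eact X e v)"
  using loop.app_natural[of \<eta> X Y "Arrow V [e] V" v] by (simp add: ET_Sets eact_def Arr_loop_cat)

lemma ET_Hom_ext:
  "\<eta> \<in> Hom ET X Y \<Longrightarrow> \<theta> \<in> Hom ET X Y \<Longrightarrow> (\<And>v. v \<in> car X \<Longrightarrow> app \<eta> V v = app \<theta> V v) \<Longrightarrow> \<eta> = \<theta>"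
  unfolding ET_Sets by (rule loop.Hom_Sets_ext) auto

lemma ET_app_Comp:
  "\<eta> \<in> Hom ET X Y \<Longrightarrow> \<theta> \<in> Hom ET Y Z \<Longrightarrow> v \<in> car X \<Longrightarrow>
     app (Comp ET \<theta> \<eta>) V v = app \<theta> V (app \<eta> V v)"
  unfolding ET_Sets by (rule loop.app_Comp) auto

lemma ET_app_Ide: "v \<in> car X \<Longrightarrow> app (Ide ET X) V v = v"
  unfolding ET_Sets by (rule loop.app_Ide) auto

text \<open>A free monoid imposes no relations, so an arbitrary family of operations
  \<open>t e\<close> extends to an action.\<close>

lemma mk_fun_ET:
  assumes "small TYPE('u) (Q :: 'u set)" "\<And>e q. e \<in> loops \<Longrightarrow> q \<in> Q \<Longrightarrow> t e q \<in> Q"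
  shows "mk_fun loop_cat (\<lambda>_. Q) (\<lambda>m. fold t (body m)) \<in> Obj ET"
    "car (mk_fun loop_cat (\<lambda>_. Q) (\<lambda>m. fold t (body m))) = Q"
    "e \<in> loops \<Longrightarrow> q \<in> Q \<Longrightarrow> eact (mk_fun loop_cat (\<lambda>_. Q) (\<lambda>m. fold t (body m))) e q = t e q"
proof -
  have fold_in: "fold t p q \<in> Q" if "set p \<subseteq> loops" "q \<in> Q" for p q
    using that by (induction p arbitrary: q) (auto simp: assms(2))
  show "mk_fun loop_cat (\<lambda>_. Q) (\<lambda>m. fold t (body m)) \<in> Obj ET"
    unfolding ET_Sets
    by (rule loop.mk_fun_Obj) (auto simp: assms(1) Arr_loop_cat fold_in)
  show "car (mk_fun loop_cat (\<lambda>_. Q) (\<lambda>m. fold t (body m))) = Q"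
    by simp
  show "eact (mk_fun loop_cat (\<lambda>_. Q) (\<lambda>m. fold t (body m))) e q = t e q" if "e \<in> loops" "q \<in> Q"
    using that by (simp add: eact_def Arr_loop_cat)
qed

text \<open>A map out of the one-point object is determined by its value at the point, and a single
  element of \<open>X\<close> is enough to reach that point.\<close>

lemma ET_inhabitedI:
  assumes iu: "inaccessible_universe TYPE('u)" and X: "X \<in> Obj (ET :: ('u eobj, 'u earr) cat)" and ne: "car X \<noteq> {}"
  shows "inhabited ET X"
proof -
  interpret inaccessible_universe "TYPE('u)" by fact
  define T :: "'u eobj" where "T = mk_fun loop_cat (\<lambda>_. {undefined}) (\<lambda>m. fold (\<lambda>_ v. v) (body m))"
  have T: "T \<in> Obj ET" "car T = {undefined}" "\<And>e v. e \<in> loops \<Longrightarrow> v \<in> car T \<Longrightarrow> eact T e v = v"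
    using mk_fun_ET[of "{undefined :: 'u}" "\<lambda>_ v. v"] by (auto simp: T_def small_finite)
  have ex: "\<exists>h. h \<in> Hom ET Y T" if "Y \<in> Obj ET" for Y :: "'u eobj"
    using ET_HomI[OF that T(1), of "\<lambda>_. undefined"] T by auto
  have un: "h = h'" if "h \<in> Hom ET Y T" "h' \<in> Hom ET Y T" for Y :: "'u eobj" and h h'
    using ET_Hom_ext[OF that] ET_app_in[OF that(1)] ET_app_in[OF that(2)] T(2) by auto
  have "terminal ET T"
    unfolding terminal_def using T(1) ex un by blast
  moreover obtain f where f: "f \<in> Hom ET X T" using ex[OF X] by blast
  moreover have "epi ET f"
    unfolding epi_def
  proof (intro conjI allI ballI impI)
    show "f \<in> Arr ET" using f by (simp add: Hom_def)
    fix Y g h assume g: "g \<in> Hom ET (Cod ET f) Y" and h: "h \<in> Hom ET (Cod ET f) Y"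
      and eq: "Comp ET g f = Comp ET h f"
    have c: "Cod ET f = T" using f by (simp add: Hom_def)
    obtain v where v: "v \<in> car X" using ne by blast
    have "app f V v = undefined" using ET_app_in[OF f v] T(2) by simp
    then have "app g V undefined = app h V undefined"
      using ET_app_Comp[OF f g[unfolded c] v] ET_app_Comp[OF f h[unfolded c] v] eq by simp
    then show "g = h"
      using g h T(2) unfolding c by (intro ET_Hom_ext[OF g[unfolded c] h[unfolded c]]) simp
  qed
  ultimately show ?thesis unfolding inhabited_def by blast
qed


section \<open>The geometric morphism of an algebra of unary operations\<close>

locale unary_algebra = infinite_carrier U S for U :: "'u itself" and S +
  fixes ops :: "nat enc_edge \<Rightarrow> 'u \<Rightarrow> 'u"
  assumes ops_in: "ops e \<in> S \<rightarrow> S"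
begin

definition pull_obj :: "'u inh_obj \<Rightarrow> 'u eobj" where
  "pull_obj F = mk_fun loop_cat (\<lambda>_. ext F) (\<lambda>m. fold (\<lambda>e. emap F (ops e)) (body m))"

definition pull_arr :: "'u inh_arr \<Rightarrow> 'u earr" where
  "pull_arr \<eta> = mk_nat loop_cat (pull_obj (source \<eta>)) (pull_obj (target \<eta>)) (\<lambda>_. ext_trans \<eta>)"

definition pull :: "('u inh_obj, 'u inh_arr, 'u eobj, 'u earr) func" where
  "pull = \<lparr>omap = restrict pull_obj (Obj IC), amap = restrict pull_arr (Arr IC)\<rparr>"

lemma
  assumes F: "F \<in> Obj IC"
  shows pull_obj: "pull_obj F \<in> Obj ET"
    and car_pull [simp]: "car (pull_obj F) = ext F"
    and eact_pull: "e \<in> loops \<Longrightarrow> u \<in> ext F \<Longrightarrow> eact (pull_obj F) e u = emap F (ops e) u"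
  using mk_fun_ET[of "ext F" "\<lambda>e. emap F (ops e)"] small_ext[OF F] emap_in[OF F ops_in]
  unfolding pull_obj_def by auto

lemma eact_br:
  assumes "F \<in> Obj IC" "e \<in> loops" "rep F A x a"
  shows "eact (pull_obj F) e (br F A x a) = br F A (\<lambda>i. ops e (x i)) a"
  using eact_pull[OF assms(1,2) br_in[OF assms(3)]] emap_br[OF assms(1) ops_in assms(3)] by simp

lemma br_induct [consumes 2, case_names br]:
  assumes "F \<in> Obj IC" "u \<in> ext F" "\<And>A a. fs A \<Longrightarrow> A \<subseteq> S \<Longrightarrow> rep F A (\<lambda>i. i) a \<Longrightarrow> P (br F A (\<lambda>i. i) a)"
  shows "P u"
  using ext_cases[OF assms(1,2)] assms(3) by (metis Pi_I rep_def subsetD)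

lemma rep_app: "\<eta> \<in> Hom IC F G \<Longrightarrow> rep F A x a \<Longrightarrow> rep G A x (app \<eta> A a)"
  using IC_app_in[of \<eta> F G A a] by (simp add: rep_def)

lemma
  assumes \<eta>: "\<eta> \<in> Hom IC F G"
  shows pull_arr_Hom: "pull_arr \<eta> \<in> Hom ET (pull_obj F) (pull_obj G)"
    and app_pull_arr: "rep F A x a \<Longrightarrow> app (pull_arr \<eta>) V (br F A x a) = br G A x (app \<eta> A a)"
proof -
  have st: "source \<eta> = F" "target \<eta> = G"
    using \<eta> by (auto simp: Hom_def inh_classifier_def functor_category_def)
  note F = IC_Hom_Obj(1)[OF \<eta>] and G = IC_Hom_Obj(2)[OF \<eta>]
  show "pull_arr \<eta> \<in> Hom ET (pull_obj F) (pull_obj G)"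
    unfolding pull_arr_def st
  proof (rule ET_HomI[OF pull_obj[OF F] pull_obj[OF G]])
    fix u assume "u \<in> car (pull_obj F)"
    then have u: "u \<in> ext F" by (simp add: F)
    show "ext_trans \<eta> u \<in> car (pull_obj G)"
      using F u by (induction rule: br_induct)
        (simp add: ext_trans_br[OF \<eta>] G br_in rep_app[OF \<eta>])
    fix e assume e: "e \<in> loops"
    show "eact (pull_obj G) e (ext_trans \<eta> u) = ext_trans \<eta> (eact (pull_obj F) e u)"
      using F u by (induction rule: br_induct)
        (simp add: ext_trans_br[OF \<eta>] eact_br[OF F e] eact_br[OF G e] rep_app[OF \<eta>] rep_comp[OF _ ops_in])
  qed
  show "app (pull_arr \<eta>) V (br F A x a) = br G A x (app \<eta> A a)" if "rep F A x a"
    unfolding pull_arr_def st using that F by (simp add: ext_trans_br[OF \<eta>] br_in)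
qed

lemma pull_sel: "F \<in> Obj IC \<Longrightarrow> omap pull F = pull_obj F" "\<eta> \<in> Hom IC F G \<Longrightarrow> amap pull \<eta> = pull_arr \<eta>"
  by (simp_all add: pull_def Hom_def)

lemma ET_ext_hom:
  assumes F: "F \<in> Obj IC" and h: "h \<in> Hom ET (pull_obj F) Y" "h' \<in> Hom ET (pull_obj F) Y"
    and eq: "\<And>A x a. rep F A x a \<Longrightarrow> app h V (br F A x a) = app h' V (br F A x a)"
  shows "h = h'"
proof (rule ET_Hom_ext[OF h])
  fix u assume "u \<in> car (pull_obj F)"
  then have "u \<in> ext F" by (simp add: F)
  with F show "app h V u = app h' V u" by (induction rule: br_induct) (rule eq)
qed

lemma functor_pull: "is_functor IC ET pull"
  unfolding is_functor_def
proof (intro conjI ballI impI)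
  show "omap pull \<in> Obj IC \<rightarrow>\<^sub>E Obj ET" by (auto simp: pull_def pull_obj)
  show "amap pull \<in> (\<Pi>\<^sub>E f\<in>Arr IC. Hom ET (omap pull (Dom IC f)) (omap pull (Cod IC f)))"
  proof (rule PiE_I)
    fix f assume "f \<in> Arr IC"
    then have f: "f \<in> Hom IC (Dom IC f) (Cod IC f)" by (simp add: Hom_def)
    show "amap pull f \<in> Hom ET (omap pull (Dom IC f)) (omap pull (Cod IC f))"
      using pull_arr_Hom[OF f] by (simp add: pull_sel(2)[OF f] pull_sel(1) IC_Hom_Obj[OF f])
  qed (simp add: pull_def)
next
  fix F assume F: "F \<in> Obj IC"
  have i: "Ide IC F \<in> Hom IC F F" by (rule categoryD(3)[OF category_IC F])
  have "pull_arr (Ide IC F) = Ide ET (pull_obj F)"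
    by (rule ET_ext_hom[OF F pull_arr_Hom[OF i] categoryD(3)[OF category_ET pull_obj[OF F]]])
       (simp add: app_pull_arr[OF i] ET_app_Ide F br_in, simp add: IC_app_Ide rep_def)
  then show "amap pull (Ide IC F) = Ide ET (omap pull F)"
    by (simp add: pull_sel(2)[OF i] pull_sel(1) F)
next
  fix f g assume "f \<in> Arr IC" "g \<in> Arr IC" "Cod IC f = Dom IC g"
  then have f: "f \<in> Hom IC (Dom IC f) (Cod IC f)" and g: "g \<in> Hom IC (Cod IC f) (Cod IC g)"
    by (simp_all add: Hom_def)
  note gf = categoryD(4)[OF category_IC f g]
  have "pull_arr (Comp IC g f) = Comp ET (pull_arr g) (pull_arr f)"
  proof (rule ET_ext_hom[OF IC_Hom_Obj(1)[OF f] pull_arr_Hom[OF gf]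
        categoryD(4)[OF category_ET pull_arr_Hom[OF f] pull_arr_Hom[OF g]]])
    fix A x a assume r: "rep (Dom IC f) A x a"
    then have "app (Comp IC g f) A a = app g A (app f A a)"
      by (intro IC_app_Comp[OF f g]) (auto simp: rep_def)
    then show "app (pull_arr (Comp IC g f)) V (br (Dom IC f) A x a) =
        app (Comp ET (pull_arr g) (pull_arr f)) V (br (Dom IC f) A x a)"
      using ET_app_Comp[OF pull_arr_Hom[OF f] pull_arr_Hom[OF g], of "br (Dom IC f) A x a"]
      by (simp add: app_pull_arr[OF gf r] app_pull_arr[OF f r] app_pull_arr[OF g rep_app[OF f r]]
          IC_Hom_Obj[OF f] br_in[OF r])
  qed
  then show "amap pull (Comp IC g f) = Comp ET (amap pull g) (amap pull f)"
    by (simp add: pull_sel(2)[OF f] pull_sel(2)[OF g] pull_sel(2)[OF gf])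
qed

text \<open>The right adjoint sends \<open>X\<close> to \<open>A \<mapsto> Hom(S\<^sup>A, X)\<close>.\<close>

definition equiv_maps :: "'u eobj \<Rightarrow> 'u set \<Rightarrow> (('u \<Rightarrow> 'u) \<Rightarrow> 'u) set" where
  "equiv_maps X A = {h \<in> (A \<rightarrow>\<^sub>E S) \<rightarrow>\<^sub>E car X.
     \<forall>e\<in>loops. \<forall>x\<in>A \<rightarrow>\<^sub>E S. h (\<lambda>i\<in>A. ops e (x i)) = eact X e (h x)}"

text \<open>The values are sets of functions on functions, so the functor exists only through codes;
  the choice fixes one with the prescribed values and transition maps. \<open>ev\<close> and
  \<open>curry_map\<close> later hide the codes.\<close>

definition push_obj :: "'u eobj \<Rightarrow> 'u inh_obj" where
  "push_obj X = (SOME F. F \<in> Obj IC \<and> (\<forall>A. fs A \<longrightarrow> omap F A = code (equiv_maps X A) ` equiv_maps X A) \<and>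
     (\<forall>A B f h. fs A \<longrightarrow> fs B \<longrightarrow> f \<in> A \<rightarrow> B \<longrightarrow> h \<in> equiv_maps X A \<longrightarrow>
       push F A B f (code (equiv_maps X A) h) =
       code (equiv_maps X B) (\<lambda>y\<in>B \<rightarrow>\<^sub>E S. h (\<lambda>i\<in>A. y (restrict f A i)))))"

lemma equiv_mapsI:
  assumes "h \<in> (A \<rightarrow>\<^sub>E S) \<rightarrow>\<^sub>E car X"
    and "\<And>e x. e \<in> loops \<Longrightarrow> x \<in> A \<rightarrow>\<^sub>E S \<Longrightarrow> h (\<lambda>i\<in>A. ops e (x i)) = eact X e (h x)"
  shows "h \<in> equiv_maps X A"
  using assms by (simp add: equiv_maps_def)

lemma equiv_mapsD:
  assumes "h \<in> equiv_maps X A"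
  shows "x \<in> A \<rightarrow>\<^sub>E S \<Longrightarrow> h x \<in> car X"
    "e \<in> loops \<Longrightarrow> x \<in> A \<rightarrow>\<^sub>E S \<Longrightarrow> h (\<lambda>i\<in>A. ops e (x i)) = eact X e (h x)"
  using assms unfolding equiv_maps_def by (auto simp only: mem_Collect_eq PiE_mem)

lemma small_equiv_maps:
  assumes X: "X \<in> Obj ET" and A: "fs A" shows "small TYPE('u) (equiv_maps X A)"
proof -
  have "small TYPE('u) (car X)" using loop.small_omap[of X V] X by (simp add: ET_Sets)
  then have "small TYPE('u) ((A \<rightarrow>\<^sub>E S) \<rightarrow>\<^sub>E car X)"
    using A by (intro small_PiE[OF small_PiE[OF small_finite small_S]]) auto
  then show ?thesis by (rule small_subset) (auto simp only: equiv_maps_def)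
qed

lemma push_obj_props:
  assumes X: "X \<in> Obj ET"
  shows "push_obj X \<in> Obj IC \<and> (\<forall>A. fs A \<longrightarrow> omap (push_obj X) A = code (equiv_maps X A) ` equiv_maps X A) \<and>
     (\<forall>A B f h. fs A \<longrightarrow> fs B \<longrightarrow> f \<in> A \<rightarrow> B \<longrightarrow> h \<in> equiv_maps X A \<longrightarrow>
       push (push_obj X) A B f (code (equiv_maps X A) h) =
       code (equiv_maps X B) (\<lambda>y\<in>B \<rightarrow>\<^sub>E S. h (\<lambda>i\<in>A. y (restrict f A i))))"
  unfolding push_obj_def
proof (rule someI_ex)
  let ?t = "\<lambda>A B f h. \<lambda>y\<in>B \<rightarrow>\<^sub>E S. h (\<lambda>i\<in>A. y (f i) :: 'u) :: 'u"
  obtain F where F: "F \<in> Obj IC" "\<And>A. fs A \<Longrightarrow> omap F A = code (equiv_maps X A) ` equiv_maps X A"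
    "\<And>A B f h. fs A \<Longrightarrow> fs B \<Longrightarrow> f \<in> A \<rightarrow> B \<Longrightarrow> h \<in> equiv_maps X A \<Longrightarrow>
       push F A B f (code (equiv_maps X A) h) = code (equiv_maps X B) (?t A B (restrict f A) h)"
  proof (rule mk_fun_IC[of "equiv_maps X" ?t])
    show "small TYPE('u) (equiv_maps X A)" if "fs A" for A
      by (rule small_equiv_maps[OF X that])
    fix A B :: "'u set" and f h assume "fs A" "fs B" and f: "f \<in> A \<rightarrow>\<^sub>E B" and h: "h \<in> equiv_maps X A"
    have xf: "(\<lambda>i\<in>A. y (f i)) \<in> A \<rightarrow>\<^sub>E S" if "y \<in> B \<rightarrow>\<^sub>E S" for y using that f by auto
    show "?t A B f h \<in> equiv_maps X B"
    proof (rule equiv_mapsI)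
      have hh: "h \<in> (A \<rightarrow>\<^sub>E S) \<rightarrow>\<^sub>E car X" using h by (simp add: equiv_maps_def)
      show "?t A B f h \<in> (B \<rightarrow>\<^sub>E S) \<rightarrow>\<^sub>E car X"
        unfolding restrict_PiE_iff using PiE_mem[OF hh xf] by (intro ballI)
      fix e y assume e: "e \<in> loops" and y: "y \<in> B \<rightarrow>\<^sub>E S"
      have "(\<lambda>i\<in>B. ops e (y i)) \<in> B \<rightarrow>\<^sub>E S" using y ops_in by auto
      moreover have "(\<lambda>i\<in>A. (\<lambda>i\<in>B. ops e (y i)) (f i)) = (\<lambda>i\<in>A. ops e ((\<lambda>i\<in>A. y (f i)) i))"
        by (rule restrict_ext) (use f in auto)
      ultimately show "?t A B f h (\<lambda>i\<in>B. ops e (y i)) = eact X e (?t A B f h y)"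
        using equiv_mapsD(2)[OF h e xf[OF y]] y by simp
    qed
  next
    fix A :: "'u set" and h assume "fs A" and h: "h \<in> equiv_maps X A"
    have r: "(\<lambda>i\<in>A. y (restrict (\<lambda>x. x) A i)) = y" if "y \<in> A \<rightarrow>\<^sub>E S" for y
      using that by (auto simp: PiE_iff extensional_def)
    have h': "h \<in> (A \<rightarrow>\<^sub>E S) \<rightarrow>\<^sub>E car X" using h by (simp add: equiv_maps_def)
    show "?t A A (restrict (\<lambda>x. x) A) h = h"
    proof
      fix y show "?t A A (restrict (\<lambda>x. x) A) h y = h y"
        using r[of y] PiE_arb[OF h', of y] by (cases "y \<in> A \<rightarrow>\<^sub>E S") simp_all
    qed
  next
    fix A B C :: "'u set" and f g h assume "fs A" "fs B" "fs C" and f: "f \<in> A \<rightarrow>\<^sub>E B" and g: "g \<in> B \<rightarrow>\<^sub>E C"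
      and h: "h \<in> equiv_maps X A"
    have "(\<lambda>i\<in>A. y (compose A g f i)) = (\<lambda>i\<in>A. (\<lambda>j\<in>B. y (g j)) (f i))" for y :: "'u \<Rightarrow> 'u"
      by (rule restrict_ext) (use f in \<open>auto simp: compose_def\<close>)
    moreover have "(\<lambda>j\<in>B. y (g j)) \<in> B \<rightarrow>\<^sub>E S" if "y \<in> C \<rightarrow>\<^sub>E S" for y using that g by auto
    ultimately show "?t A C (compose A g f) h = ?t B C g (?t A B f h)"
      by (intro restrict_ext) simp
  qed blast
  show "\<exists>F. F \<in> Obj IC \<and> (\<forall>A. fs A \<longrightarrow> omap F A = code (equiv_maps X A) ` equiv_maps X A) \<and>
     (\<forall>A B f h. fs A \<longrightarrow> fs B \<longrightarrow> f \<in> A \<rightarrow> B \<longrightarrow> h \<in> equiv_maps X A \<longrightarrow>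
       push F A B f (code (equiv_maps X A) h) =
       code (equiv_maps X B) (\<lambda>y\<in>B \<rightarrow>\<^sub>E S. h (\<lambda>i\<in>A. y (restrict f A i))))"
    by (intro exI[of _ F] conjI allI impI F) simp_all
qed

definition ev :: "'u eobj \<Rightarrow> 'u set \<Rightarrow> 'u \<Rightarrow> ('u \<Rightarrow> 'u) \<Rightarrow> 'u" where
  "ev X A v x = decode (equiv_maps X A) v (restrict x A)"

definition curry_map :: "'u eobj \<Rightarrow> 'u set \<Rightarrow> (('u \<Rightarrow> 'u) \<Rightarrow> 'u) \<Rightarrow> 'u" where
  "curry_map X A h = code (equiv_maps X A) (restrict h (A \<rightarrow>\<^sub>E S))"

lemma
  assumes X: "X \<in> Obj ET" and A: "fs A"
    and h: "\<And>x. x \<in> A \<rightarrow> S \<Longrightarrow> h x \<in> car X"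
    and cong: "\<And>x y. (\<And>i. i \<in> A \<Longrightarrow> x i = y i) \<Longrightarrow> h x = h y"
    and eq: "\<And>e x. e \<in> loops \<Longrightarrow> x \<in> A \<rightarrow> S \<Longrightarrow> h (\<lambda>i. ops e (x i)) = eact X e (h x)"
  shows curry_map_in: "curry_map X A h \<in> omap (push_obj X) A"
    and ev_curry_map: "x \<in> A \<rightarrow> S \<Longrightarrow> ev X A (curry_map X A h) x = h x"
proof -
  have m: "restrict h (A \<rightarrow>\<^sub>E S) \<in> equiv_maps X A"
    unfolding equiv_maps_def
  proof (intro CollectI conjI ballI)
    show "restrict h (A \<rightarrow>\<^sub>E S) \<in> (A \<rightarrow>\<^sub>E S) \<rightarrow>\<^sub>E car X" using h by auto
    fix e x assume e: "e \<in> loops" and x: "x \<in> A \<rightarrow>\<^sub>E S"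
    have "(\<lambda>i\<in>A. ops e (x i)) \<in> A \<rightarrow>\<^sub>E S" using x ops_in by auto
    moreover have "h (\<lambda>i\<in>A. ops e (x i)) = h (\<lambda>i. ops e (x i))" by (rule cong) simp
    ultimately show "restrict h (A \<rightarrow>\<^sub>E S) (\<lambda>i\<in>A. ops e (x i)) = eact X e (restrict h (A \<rightarrow>\<^sub>E S) x)"
      using eq[OF e, of x] x by auto
  qed
  then show "curry_map X A h \<in> omap (push_obj X) A"
    using push_obj_props[OF X] A by (simp add: curry_map_def)
  assume x: "x \<in> A \<rightarrow> S"
  have "h (restrict x A) = h x" by (rule cong) simp
  then show "ev X A (curry_map X A h) x = h x"
    using x decode_code[OF small_equiv_maps[OF X A] m] by (auto simp: ev_def curry_map_def)
qed

lemma
  assumes X: "X \<in> Obj ET" and A: "fs A" and v: "v \<in> omap (push_obj X) A"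
  shows ev_in: "x \<in> A \<rightarrow> S \<Longrightarrow> ev X A v x \<in> car X"
    and ev_ops: "e \<in> loops \<Longrightarrow> x \<in> A \<rightarrow> S \<Longrightarrow> ev X A v (\<lambda>i. ops e (x i)) = eact X e (ev X A v x)"
    and ev_push: "fs B \<Longrightarrow> f \<in> A \<rightarrow> B \<Longrightarrow> y \<in> B \<rightarrow> S \<Longrightarrow>
      ev X B (push (push_obj X) A B f v) y = ev X A v (\<lambda>i. y (f i))"
    and ev_ext: "w \<in> omap (push_obj X) A \<Longrightarrow> (\<And>x. x \<in> A \<rightarrow> S \<Longrightarrow> ev X A v x = ev X A w x) \<Longrightarrow> v = w"
proof -
  let ?h = "decode (equiv_maps X A)"
  have om: "omap (push_obj X) A = code (equiv_maps X A) ` equiv_maps X A"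
    using push_obj_props[OF X] A by blast
  then have m: "?h w \<in> equiv_maps X A" and c: "code (equiv_maps X A) (?h w) = w"
    if "w \<in> omap (push_obj X) A" for w
    using that decode_in[of w "equiv_maps X A"] code_decode[of w "equiv_maps X A"] by simp_all
  show "ev X A v x \<in> car X" if "x \<in> A \<rightarrow> S"
    using equiv_mapsD(1)[OF m[OF v], of "restrict x A"] that by (auto simp: ev_def)
  show "ev X A v (\<lambda>i. ops e (x i)) = eact X e (ev X A v x)" if "e \<in> loops" "x \<in> A \<rightarrow> S"
  proof -
    have "(\<lambda>i\<in>A. ops e (x i)) = (\<lambda>i\<in>A. ops e (restrict x A i))" by (rule restrict_ext) simp
    moreover have "restrict x A \<in> A \<rightarrow>\<^sub>E S" using that by auto
    ultimately show ?thesis using equiv_mapsD(2)[OF m[OF v] that(1), of "restrict x A"] by (simp add: ev_def)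
  qed
  show "ev X B (push (push_obj X) A B f v) y = ev X A v (\<lambda>i. y (f i))"
    if B: "fs B" and f: "f \<in> A \<rightarrow> B" and y: "y \<in> B \<rightarrow> S"
  proof -
    let ?k = "\<lambda>y\<in>B \<rightarrow>\<^sub>E S. ?h v (\<lambda>i\<in>A. y (restrict f A i))"
    have p: "push (push_obj X) A B f v = code (equiv_maps X B) ?k"
      using push_obj_props[OF X] A B f m[OF v] c[OF v] by metis
    have "push (push_obj X) A B f v \<in> omap (push_obj X) B"
      using push_obj_props[OF X] by (intro push_in A B f v) auto
    moreover have "?k \<in> equiv_maps X B"
    proof (rule equiv_mapsI)
      have xf: "(\<lambda>i\<in>A. y (f i)) \<in> A \<rightarrow>\<^sub>E S" if "y \<in> B \<rightarrow>\<^sub>E S" for y using that f by auto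
      have hh: "?h v \<in> (A \<rightarrow>\<^sub>E S) \<rightarrow>\<^sub>E car X" using m[OF v] by (simp add: equiv_maps_def)
      have rr: "(\<lambda>i\<in>A. y (restrict f A i)) = (\<lambda>i\<in>A. y (f i))" for y :: "'u \<Rightarrow> 'u" by auto
      show "?k \<in> (B \<rightarrow>\<^sub>E S) \<rightarrow>\<^sub>E car X"
      proof (rule restrict_PiE_iff[THEN iffD2], rule ballI)
        fix y assume "y \<in> B \<rightarrow>\<^sub>E S"
        then show "?h v (\<lambda>i\<in>A. y (restrict f A i)) \<in> car X" unfolding rr by (rule PiE_mem[OF hh xf])
      qed
      fix e y assume e: "e \<in> loops" and y: "y \<in> B \<rightarrow>\<^sub>E S"
      have "(\<lambda>i\<in>B. ops e (y i)) \<in> B \<rightarrow>\<^sub>E S" using y ops_in by auto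
      moreover have "(\<lambda>i\<in>A. (\<lambda>i\<in>B. ops e (y i)) (f i)) = (\<lambda>i\<in>A. ops e ((\<lambda>i\<in>A. y (f i)) i))"
        by (rule restrict_ext) (insert f, auto)
      ultimately show "?k (\<lambda>i\<in>B. ops e (y i)) = eact X e (?k y)"
        using equiv_mapsD(2)[OF m[OF v] e xf[OF y]] y by (simp cong: restrict_cong)
    qed
    ultimately have "decode (equiv_maps X B) (push (push_obj X) A B f v) = ?k"
      unfolding p by (intro decode_code small_equiv_maps X B)
    moreover have "(\<lambda>i\<in>A. restrict y B (restrict f A i)) = (\<lambda>i\<in>A. y (f i))"
      by (rule restrict_ext) (insert f, auto)
    moreover have "restrict y B \<in> B \<rightarrow>\<^sub>E S" using y by auto
    ultimately show ?thesis by (simp add: ev_def)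
  qed
  show "v = w" if w: "w \<in> omap (push_obj X) A" and eq: "\<And>x. x \<in> A \<rightarrow> S \<Longrightarrow> ev X A v x = ev X A w x"
  proof -
    have "?h v \<in> (A \<rightarrow>\<^sub>E S) \<rightarrow>\<^sub>E car X" "?h w \<in> (A \<rightarrow>\<^sub>E S) \<rightarrow>\<^sub>E car X"
      using m[OF v] m[OF w] by (simp_all add: equiv_maps_def)
    then have "?h v = ?h w"
    proof (rule PiE_ext)
      fix x assume x: "x \<in> A \<rightarrow>\<^sub>E S"
      then have "restrict x A = x" by (auto simp: PiE_iff extensional_def)
      then show "?h v x = ?h w x" using eq[of x] x by (auto simp: ev_def)
    qed
    then show ?thesis using c[OF v] c[OF w] by metis
  qed
qed

lemma ev_cong: "(\<And>i. i \<in> A \<Longrightarrow> x i = y i) \<Longrightarrow> ev X A v x = ev X A v y"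
  unfolding ev_def by (metis restrict_ext)

lemma push_obj: "X \<in> Obj ET \<Longrightarrow> push_obj X \<in> Obj IC"
  using push_obj_props by blast

end


section \<open>Representable functors and limits in the classifier\<close>

context inaccessible_universe
begin

text \<open>\<open>Y\<close> is the functor represented by \<open>A\<close>, and \<open>y0\<close>
  codes the identity of \<open>A\<close>. Only the universal property is exported: elements at
  \<open>A\<close> are the same as maps out of \<open>Y\<close>.\<close>

lemma yoneda:
  fixes A :: "'u set"
  assumes A: "fs A"
  obtains Y :: "'u inh_obj" and y0 where "Y \<in> Obj IC" "y0 \<in> omap Y A"
    "\<forall>F a. F \<in> Obj IC \<longrightarrow> a \<in> omap F A \<longrightarrow> (\<exists>!h. h \<in> Hom IC Y F \<and> app h A y0 = a)"
proof -
  let ?Q = "\<lambda>B. A \<rightarrow>\<^sub>E (B :: 'u set)"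
  have sm: "small TYPE('u) (?Q B)" if "fs B" for B
    using that A by (intro small_finite finite_PiE) auto
  obtain Y where Y: "Y \<in> Obj IC" and om: "\<And>B. fs B \<Longrightarrow> omap Y B = code (?Q B) ` ?Q B"
    and pu: "\<And>B C f q. fs B \<Longrightarrow> fs C \<Longrightarrow> f \<in> B \<rightarrow> C \<Longrightarrow> q \<in> ?Q B \<Longrightarrow>
       push Y B C f (code (?Q B) q) = code (?Q C) (compose A (restrict f B) q)"
  proof (rule mk_fun_IC[of ?Q "\<lambda>B C f q. compose A f q"])
    show "small TYPE('u) (?Q B)" if "fs B" for B by (rule sm[OF that])
    show "compose A f q \<in> ?Q C" if "fs B" "fs C" "f \<in> B \<rightarrow>\<^sub>E C" "q \<in> ?Q B" for B C f q
      using that by (auto simp: compose_def)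
    show "compose A (restrict (\<lambda>x. x) B) q = q" if "fs B" "q \<in> ?Q B" for B q
      using that by (auto simp: compose_def PiE_iff extensional_def fun_eq_iff)
    show "compose A (compose B g f) q = compose A g (compose A f q)"
      if "q \<in> ?Q B" for B and f g :: "'u \<Rightarrow> 'u" and q
      using that by (auto simp: compose_def PiE_iff fun_eq_iff)
  qed blast
  let ?id = "\<lambda>i\<in>A. i"
  let ?y0 = "code (?Q A) ?id :: 'u"
  have id: "?id \<in> ?Q A" by auto
  have y0: "?y0 \<in> omap Y A" unfolding om[OF A] using id by blast
  have gen: "push Y A B q ?y0 = code (?Q B) q" if "fs B" "q \<in> ?Q B" for B q
  proof -
    have "q \<in> A \<rightarrow> B" "compose A (restrict q A) ?id = q"
      using that(2) by (auto simp: compose_def PiE_iff extensional_def fun_eq_iff)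
    then show ?thesis using pu[OF A that(1) _ id, of q] by simp
  qed
  have "\<exists>!h. h \<in> Hom IC Y F \<and> app h A ?y0 = a" if F: "F \<in> Obj IC" and a: "a \<in> omap F A" for F a
  proof
    let ?h = "mk_nat finset_inh Y F (\<lambda>B v. push F A B (decode (?Q B) v) a)"
    have "?h \<in> Hom IC Y F"
    proof (rule mk_nat_IC_Hom[OF Y F])
      fix B v assume B: "fs B" "v \<in> omap Y B"
      then obtain q where q: "q \<in> ?Q B" "v = code (?Q B) q" using om by blast
      then show "push F A B (decode (?Q B) v) a \<in> omap F B"
        using B a by (intro push_in[OF F A]) (auto simp: decode_code[OF sm])
      fix C :: "'u set" and f assume C: "fs C" "f \<in> B \<rightarrow> C"
      have c: "compose A (restrict f B) q \<in> ?Q C" using C PiE_mem[OF q(1)] by (auto simp: compose_def Pi_iff)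
      have "push F B C f (push F A B q a) = push F A C (\<lambda>i. f (q i)) a"
        using q C B by (intro push_push[OF F A _ _ _ _ a]) auto
      also have "\<dots> = push F A C (compose A (restrict f B) q) a"
        by (rule push_cong) (use q in \<open>auto simp: compose_def\<close>)
      finally show "push F B C f (push F A B (decode (?Q B) v) a) = push F A C (decode (?Q C) (push Y B C f v)) a"
        using q B C pu[OF B(1) C q(1)] c by (simp add: decode_code[OF sm])
    qed
    moreover have "push F A A ?id a = a"
      using push_id[OF F A a] push_cong[of A ?id "\<lambda>i. i" F A a] by simp
    then have "app ?h A ?y0 = a"
      using app_mk_nat_IC[OF A y0, of F] id A by (simp add: decode_code[OF sm])
    ultimately show "?h \<in> Hom IC Y F \<and> app ?h A ?y0 = a" by blast
    fix g assume g: "g \<in> Hom IC Y F \<and> app g A ?y0 = a"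
    show "g = ?h"
    proof (rule IC_Hom_ext)
      show "g \<in> Hom IC Y F" "?h \<in> Hom IC Y F" using g \<open>?h \<in> _\<close> by auto
      fix B v assume B: "fs B" "v \<in> omap Y B"
      then obtain q where q: "q \<in> ?Q B" "v = code (?Q B) q" using om by blast
      have q': "q \<in> A \<rightarrow> B" using q by auto
      have "app k B v = push F A B q a" if "k \<in> Hom IC Y F" "app k A ?y0 = a" for k
        using IC_app_push[OF that(1) A B(1) q' y0] that(2) gen[OF B(1) q(1)] q(2) by simp
      then show "app g B v = app ?h B v" using g \<open>?h \<in> _\<close> \<open>app ?h A ?y0 = a\<close> by simp
    qed
  qed
  then show thesis by (intro that[OF Y y0]) simp
qed

text \<open>Compatible elements at \<open>A\<close> amount to a cone whose vertex is the functor
  represented by \<open>A\<close>. The mediating map of this cone is the required element of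
  \<open>L\<close> at \<open>A\<close>.\<close>

lemma IC_limit_pointwise:
  assumes J: "category J" and K: "is_functor J IC K" and lim: "is_limit J IC K L \<tau>" and A: "fs A"
    and k: "\<And>j. j \<in> Obj J \<Longrightarrow> k j \<in> omap (omap K j) A"
    and comp: "\<And>u. u \<in> Arr J \<Longrightarrow> app (amap K u) A (k (Dom J u)) = k (Cod J u)"
  shows "\<exists>!l. l \<in> omap L A \<and> (\<forall>j\<in>Obj J. app (\<tau> j) A l = k j)"
proof -
  obtain Y :: "'u inh_obj" and y0 where Y: "Y \<in> Obj IC" and y0: "y0 \<in> omap Y A"
    and yo': "\<forall>F a. F \<in> Obj IC \<longrightarrow> a \<in> omap F A \<longrightarrow> (\<exists>!h. h \<in> Hom IC Y F \<and> app h A y0 = a)"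
    by (rule yoneda[OF A])
  note yo = yo'[rule_format]
  have yu: "f = g" if f: "f \<in> Hom IC Y F" and g: "g \<in> Hom IC Y F" and eq: "app f A y0 = app g A y0" for F f g
    by (rule ex1E[OF yo[OF IC_Hom_Obj(2)[OF f] IC_app_in[OF f A y0]]]) (metis f g eq)
  have L: "L \<in> Obj IC" and \<tau>: "\<And>j. j \<in> Obj J \<Longrightarrow> \<tau> j \<in> Hom IC L (omap K j)"
    using lim by (auto simp: is_limit_def is_cone_def)
  have Kj: "omap K j \<in> Obj IC" if "j \<in> Obj J" for j using functorD(1)[OF K that] .
  have "\<forall>j\<in>Obj J. \<exists>h. h \<in> Hom IC Y (omap K j) \<and> app h A y0 = k j"
    using ex1_implies_ex[OF yo[OF Kj k]] by simp
  then obtain \<sigma> where \<sigma>: "\<And>j. j \<in> Obj J \<Longrightarrow> \<sigma> j \<in> Hom IC Y (omap K j)"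
    and \<sigma>0: "\<And>j. j \<in> Obj J \<Longrightarrow> app (\<sigma> j) A y0 = k j"
    by metis
  have cone: "is_cone J IC K Y \<sigma>"
    unfolding is_cone_def
  proof (intro conjI ballI Y \<sigma>)
    fix u assume u: "u \<in> Arr J"
    then have d: "Dom J u \<in> Obj J" "Cod J u \<in> Obj J" using categoryD(1,2)[OF J] by auto
    have Ku: "amap K u \<in> Hom IC (omap K (Dom J u)) (omap K (Cod J u))"
      by (rule functorD(2)[OF K]) (simp add: Hom_def u)
    have "app (Comp IC (amap K u) (\<sigma> (Dom J u))) A y0 = k (Cod J u)"
      using IC_app_Comp[OF \<sigma>[OF d(1)] Ku A y0] comp[OF u] \<sigma>0[OF d(1)] by simp
    then show "Comp IC (amap K u) (\<sigma> (Dom J u)) = \<sigma> (Cod J u)"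
      using yu[OF categoryD(4)[OF category_IC \<sigma>[OF d(1)] Ku] \<sigma>[OF d(2)]] \<sigma>0[OF d(2)] by simp
  qed
  then obtain h where h: "h \<in> Hom IC Y L" "\<And>j. j \<in> Obj J \<Longrightarrow> Comp IC (\<tau> j) h = \<sigma> j"
    and hu: "\<And>h'. h' \<in> Hom IC Y L \<Longrightarrow> (\<And>j. j \<in> Obj J \<Longrightarrow> Comp IC (\<tau> j) h' = \<sigma> j) \<Longrightarrow> h' = h"
    using lim unfolding is_limit_def by metis
  show ?thesis
  proof
    show "app h A y0 \<in> omap L A \<and> (\<forall>j\<in>Obj J. app (\<tau> j) A (app h A y0) = k j)"
      using IC_app_in[OF h(1) A y0] IC_app_Comp[OF h(1) \<tau> A y0] h(2) \<sigma>0 by metis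
    fix l assume l: "l \<in> omap L A \<and> (\<forall>j\<in>Obj J. app (\<tau> j) A l = k j)"
    obtain h' where h': "h' \<in> Hom IC Y L" "app h' A y0 = l"
      using ex1_implies_ex[OF yo[OF L, of l]] l by auto
    have "Comp IC (\<tau> j) h' = \<sigma> j" if j: "j \<in> Obj J" for j
    proof -
      have "app (Comp IC (\<tau> j) h') A y0 = k j"
        using IC_app_Comp[OF h'(1) \<tau>[OF j] A y0] h' l j by simp
      then show ?thesis
        using yu[OF categoryD(4)[OF category_IC h'(1) \<tau>[OF j]] \<sigma>[OF j]] \<sigma>0[OF j] by simp
    qed
    then show "l = app h A y0" using hu[OF h'(1)] h'(2) by simp
  qed
qed

end

section \<open>The right adjoint on arrows, unit and counit\<close>

context unary_algebra
begin

definition push_arr :: "'u earr \<Rightarrow> 'u inh_arr" where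
  "push_arr \<xi> = mk_nat finset_inh (push_obj (source \<xi>)) (push_obj (target \<xi>))
     (\<lambda>A v. curry_map (target \<xi>) A (\<lambda>x. app \<xi> V (ev (source \<xi>) A v x)))"

definition push_functor :: "('u eobj, 'u earr, 'u inh_obj, 'u inh_arr) func" where
  "push_functor = \<lparr>omap = restrict push_obj (Obj ET), amap = restrict push_arr (Arr ET)\<rparr>"

definition unit :: "'u inh_obj \<Rightarrow> 'u inh_arr" where
  "unit F = mk_nat finset_inh F (push_obj (pull_obj F)) (\<lambda>A a. curry_map (pull_obj F) A (\<lambda>x. br F A x a))"

definition counit :: "'u eobj \<Rightarrow> 'u earr" where
  "counit X = mk_nat loop_cat (pull_obj (push_obj X)) X (\<lambda>_. lift (push_obj X) (\<lambda>A x v. ev X A v x))"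

lemma
  assumes \<xi>: "\<xi> \<in> Hom ET X Y"
  shows push_arr_Hom: "push_arr \<xi> \<in> Hom IC (push_obj X) (push_obj Y)"
    and ev_push_arr: "fs A \<Longrightarrow> v \<in> omap (push_obj X) A \<Longrightarrow> x \<in> A \<rightarrow> S \<Longrightarrow>
      ev Y A (app (push_arr \<xi>) A v) x = app \<xi> V (ev X A v x)"
proof -
  note X = ET_Hom_Obj(1)[OF \<xi>] and Y = ET_Hom_Obj(2)[OF \<xi>]
  have st: "source \<xi> = X" "target \<xi> = Y"
    using \<xi> by (auto simp: Hom_def ET_Sets functor_category_def)
  let ?h = "\<lambda>A v. curry_map Y A (\<lambda>x. app \<xi> V (ev X A v x))"
  have c: "?h A v \<in> omap (push_obj Y) A"
      "\<And>x. x \<in> A \<rightarrow> S \<Longrightarrow> ev Y A (?h A v) x = app \<xi> V (ev X A v x)"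
    if A: "fs A" and v: "v \<in> omap (push_obj X) A" for A v
  proof -
    have a: "app \<xi> V (ev X A v x) \<in> car Y" if "x \<in> A \<rightarrow> S" for x
      by (rule ET_app_in[OF \<xi> ev_in[OF X A v that]])
    have b: "app \<xi> V (ev X A v x) = app \<xi> V (ev X A v y)" if "\<And>i. i \<in> A \<Longrightarrow> x i = y i" for x y
      using ev_cong[of A x y X v] that by simp
    have c: "app \<xi> V (ev X A v (\<lambda>i. ops e (x i))) = eact Y e (app \<xi> V (ev X A v x))"
      if "e \<in> loops" "x \<in> A \<rightarrow> S" for e x
      using ET_app_eact[OF \<xi> that(1) ev_in[OF X A v that(2)]] ev_ops[OF X A v that] by simp
    show "?h A v \<in> omap (push_obj Y) A" by (rule curry_map_in[OF Y A a b c])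
    show "ev Y A (?h A v) x = app \<xi> V (ev X A v x)" if "x \<in> A \<rightarrow> S" for x
      by (rule ev_curry_map[OF Y A a b c that])
  qed
  show "push_arr \<xi> \<in> Hom IC (push_obj X) (push_obj Y)"
    unfolding push_arr_def st
  proof (rule mk_nat_IC_Hom[OF push_obj[OF X] push_obj[OF Y] c(1)])
    fix A B :: "'u set" and f v assume *: "fs A" "fs B" "f \<in> A \<rightarrow> B" "v \<in> omap (push_obj X) A"
    note pv = push_in[OF push_obj[OF X] *]
    show "push (push_obj Y) A B f (?h A v) = ?h B (push (push_obj X) A B f v)"
    proof (rule ev_ext[OF Y *(2) push_in[OF push_obj[OF Y] *(1-3) c(1)[OF *(1,4)]] c(1)[OF *(2) pv]])
      fix y assume y: "y \<in> B \<rightarrow> S"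
      then have "(\<lambda>i. y (f i)) \<in> A \<rightarrow> S" using *(3) by auto
      then show "ev Y B (push (push_obj Y) A B f (?h A v)) y = ev Y B (?h B (push (push_obj X) A B f v)) y"
        using ev_push[OF Y *(1) c(1)[OF *(1,4)] *(2,3) y] c(2)[OF *(1,4)] c(2)[OF *(2) pv y]
          ev_push[OF X *(1,4,2,3) y] by simp
    qed
  qed
  show "ev Y A (app (push_arr \<xi>) A v) x = app \<xi> V (ev X A v x)"
    if "fs A" "v \<in> omap (push_obj X) A" "x \<in> A \<rightarrow> S"
    unfolding push_arr_def st app_mk_nat_IC[OF that(1,2)] by (rule c(2)[OF that])
qed

lemma push_functor_sel: "X \<in> Obj ET \<Longrightarrow> omap push_functor X = push_obj X"
  "\<xi> \<in> Hom ET X Y \<Longrightarrow> amap push_functor \<xi> = push_arr \<xi>"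
  by (simp_all add: push_functor_def Hom_def)

lemma push_ext:
  assumes X: "X \<in> Obj ET" and h: "h \<in> Hom IC F (push_obj X)" "h' \<in> Hom IC F (push_obj X)"
    and eq: "\<And>A a x. fs A \<Longrightarrow> a \<in> omap F A \<Longrightarrow> x \<in> A \<rightarrow> S \<Longrightarrow> ev X A (app h A a) x = ev X A (app h' A a) x"
  shows "h = h'"
  using ev_ext[OF X _ IC_app_in[OF h(1)] IC_app_in[OF h(2)] eq] by (intro IC_Hom_ext[OF h]) blast

lemma functor_push: "is_functor ET IC push_functor"
  unfolding is_functor_def
proof (intro conjI ballI impI)
  show "omap push_functor \<in> Obj ET \<rightarrow>\<^sub>E Obj IC" by (auto simp: push_functor_def push_obj)
  show "amap push_functor \<in> (\<Pi>\<^sub>E f\<in>Arr ET. Hom IC (omap push_functor (Dom ET f)) (omap push_functor (Cod ET f)))"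
  proof (rule PiE_I)
    fix f :: "'u earr" assume "f \<in> Arr ET"
    then have f: "f \<in> Hom ET (Dom ET f) (Cod ET f)" by (simp add: Hom_def)
    show "amap push_functor f \<in> Hom IC (omap push_functor (Dom ET f)) (omap push_functor (Cod ET f))"
      using push_arr_Hom[OF f] by (simp add: push_functor_sel(2)[OF f] push_functor_sel(1) ET_Hom_Obj[OF f])
  qed (simp add: push_functor_def)
next
  fix X :: "'u eobj" assume X: "X \<in> Obj ET"
  have i: "Ide ET X \<in> Hom ET X X" by (rule categoryD(3)[OF category_ET X])
  have "push_arr (Ide ET X) = Ide IC (push_obj X)"
    by (rule push_ext[OF X push_arr_Hom[OF i] categoryD(3)[OF category_IC push_obj[OF X]]])
       (simp add: ev_push_arr[OF i] ET_app_Ide ev_in[OF X] IC_app_Ide)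
  then show "amap push_functor (Ide ET X) = Ide IC (omap push_functor X)"
    by (simp add: push_functor_sel(2)[OF i] push_functor_sel(1) X)
next
  fix f g :: "'u earr" assume "f \<in> Arr ET" "g \<in> Arr ET" "Cod ET f = Dom ET g"
  then have f: "f \<in> Hom ET (Dom ET f) (Cod ET f)" and g: "g \<in> Hom ET (Cod ET f) (Cod ET g)"
    by (simp_all add: Hom_def)
  note gf = categoryD(4)[OF category_ET f g]
  have "push_arr (Comp ET g f) = Comp IC (push_arr g) (push_arr f)"
  proof (rule push_ext[OF ET_Hom_Obj(2)[OF g] push_arr_Hom[OF gf]
        categoryD(4)[OF category_IC push_arr_Hom[OF f] push_arr_Hom[OF g]]])
    fix A a x assume A: "fs A" and a: "a \<in> omap (push_obj (Dom ET f)) A" and x: "x \<in> A \<rightarrow> S"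
    show "ev (Cod ET g) A (app (push_arr (Comp ET g f)) A a) x =
        ev (Cod ET g) A (app (Comp IC (push_arr g) (push_arr f)) A a) x"
      using ev_push_arr[OF gf A a x] ev_push_arr[OF f A a x]
        ev_push_arr[OF g A IC_app_in[OF push_arr_Hom[OF f] A a] x]
        IC_app_Comp[OF push_arr_Hom[OF f] push_arr_Hom[OF g] A a]
        ET_app_Comp[OF f g ev_in[OF ET_Hom_Obj(1)[OF f] A a x]] by simp
  qed
  then show "amap push_functor (Comp ET g f) = Comp IC (amap push_functor g) (amap push_functor f)"
    by (simp add: push_functor_sel(2)[OF f] push_functor_sel(2)[OF g] push_functor_sel(2)[OF gf])
qed

lemma
  assumes F: "F \<in> Obj IC"
  shows unit_Hom: "unit F \<in> Hom IC F (push_obj (pull_obj F))"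
    and ev_unit: "rep F A x a \<Longrightarrow> ev (pull_obj F) A (app (unit F) A a) x = br F A x a"
proof -
  note X = pull_obj[OF F]
  let ?h = "\<lambda>A a. curry_map (pull_obj F) A (\<lambda>x. br F A x a)"
  have c: "?h A a \<in> omap (push_obj (pull_obj F)) A"
      "\<And>x. x \<in> A \<rightarrow> S \<Longrightarrow> ev (pull_obj F) A (?h A a) x = br F A x a"
    if A: "fs A" and a: "a \<in> omap F A" for A a
  proof -
    have r: "rep F A x a" if "x \<in> A \<rightarrow> S" for x using A a that by (simp add: rep_def)
    have 1: "br F A x a \<in> car (pull_obj F)" if "x \<in> A \<rightarrow> S" for x
      by (simp add: F br_in r that)
    have 2: "br F A x a = br F A y a" if "\<And>i. i \<in> A \<Longrightarrow> x i = y i" for x y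
      by (rule br_cong[OF that])
    have 3: "br F A (\<lambda>i. ops e (x i)) a = eact (pull_obj F) e (br F A x a)"
      if "e \<in> loops" "x \<in> A \<rightarrow> S" for e x
      using eact_br[OF F that(1) r[OF that(2)]] by simp
    show "?h A a \<in> omap (push_obj (pull_obj F)) A" by (rule curry_map_in[OF X A 1 2 3])
    show "ev (pull_obj F) A (?h A a) x = br F A x a" if "x \<in> A \<rightarrow> S" for x
      by (rule ev_curry_map[OF X A 1 2 3 that])
  qed
  show "unit F \<in> Hom IC F (push_obj (pull_obj F))"
    unfolding unit_def
  proof (rule mk_nat_IC_Hom[OF F push_obj[OF X] c(1)])
    fix A B :: "'u set" and f a assume *: "fs A" "fs B" "f \<in> A \<rightarrow> B" "a \<in> omap F A"
    note pa = push_in[OF F *]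
    show "push (push_obj (pull_obj F)) A B f (?h A a) = ?h B (push F A B f a)"
    proof (rule ev_ext[OF X *(2) push_in[OF push_obj[OF X] *(1-3) c(1)[OF *(1,4)]] c(1)[OF *(2) pa]])
      fix y assume y: "y \<in> B \<rightarrow> S"
      then have "(\<lambda>i. y (f i)) \<in> A \<rightarrow> S" using *(3) by auto
      then show "ev (pull_obj F) B (push (push_obj (pull_obj F)) A B f (?h A a)) y =
          ev (pull_obj F) B (?h B (push F A B f a)) y"
        using ev_push[OF X *(1) c(1)[OF *(1,4)] *(2,3) y] c(2)[OF *(1,4)] c(2)[OF *(2) pa y]
          br_push[OF F *(1,4,2,3) y] by simp
    qed
  qed
  show "ev (pull_obj F) A (app (unit F) A a) x = br F A x a" if "rep F A x a"
    using that c(2)[of A a x] unfolding unit_def rep_def by (simp add: app_mk_nat_IC)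
qed

lemma
  assumes X: "X \<in> Obj ET"
  shows counit_Hom: "counit X \<in> Hom ET (pull_obj (push_obj X)) X"
    and app_counit: "rep (push_obj X) A x v \<Longrightarrow> app (counit X) V (br (push_obj X) A x v) = ev X A v x"
proof -
  note R = push_obj[OF X]
  let ?h = "lift (push_obj X) (\<lambda>A x v. ev X A v x)"
  have h: "?h (br (push_obj X) A x v) = ev X A v x" if "rep (push_obj X) A x v" for A x v
    by (rule lift_br[OF R _ that]) (simp add: ev_push[OF X])
  show "counit X \<in> Hom ET (pull_obj (push_obj X)) X"
    unfolding counit_def
  proof (rule ET_HomI[OF pull_obj[OF R] X])
    fix u assume "u \<in> car (pull_obj (push_obj X))"
    then have u: "u \<in> ext (push_obj X)" by (simp add: R)
    show "?h u \<in> car X"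
      using R u by (induction rule: br_induct) (simp add: h, simp add: rep_def ev_in[OF X])
    fix e assume e: "e \<in> loops"
    show "eact X e (?h u) = ?h (eact (pull_obj (push_obj X)) e u)"
      using R u
    proof (induction rule: br_induct)
      case (br A a)
      have "ev X A a (\<lambda>i. ops e i) = eact X e (ev X A a (\<lambda>i. i))"
        using ev_ops[OF X _ _ e, of A a "\<lambda>i. i"] br by (simp add: rep_def)
      then show ?case
        by (simp add: h[OF br(3)] eact_br[OF R e br(3)] h[OF rep_comp[OF br(3) ops_in]])
    qed
  qed
  show "app (counit X) V (br (push_obj X) A x v) = ev X A v x" if "rep (push_obj X) A x v"
    unfolding counit_def using that R by (simp add: h br_in)
qed

text \<open>A tensor-hom adjunction. An element of \<open>ext F\<close> is a class of coordinates
  \<open>x\<close> together with an element \<open>a\<close>; the unit reads it as a function of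
  \<open>x\<close>, the counit evaluates such a function. Naturality and the triangle identities are
  all checked on representatives, where they reduce to evaluation.\<close>

lemma adjunction: "is_left_adjoint IC ET pull push_functor"
  unfolding is_left_adjoint_def
proof (intro conjI exI functor_pull functor_push)
  let ?\<eta> = "restrict unit (Obj IC)" and ?\<epsilon> = "restrict counit (Obj ET)"
  show "is_nat_trans IC IC (id_functor IC) (comp_functor IC push_functor pull) ?\<eta>"
    unfolding is_nat_trans_def
  proof (intro conjI ballI)
    show "?\<eta> \<in> (\<Pi>\<^sub>E a\<in>Obj IC. Hom IC (omap (id_functor IC) a) (omap (comp_functor IC push_functor pull) a))"
      by (simp add: id_functor_def comp_functor_def compose_def pull_sel push_functor_sel pull_obj unit_Hom)
    fix f assume fA: "f \<in> Arr IC"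
    then have f: "f \<in> Hom IC (Dom IC f) (Cod IC f)" by (simp add: Hom_def)
    note F = IC_Hom_Obj(1)[OF f] and G = IC_Hom_Obj(2)[OF f]
    note pf = push_arr_Hom[OF pull_arr_Hom[OF f]]
    have "Comp IC (unit (Cod IC f)) f = Comp IC (push_arr (pull_arr f)) (unit (Dom IC f))"
    proof (rule push_ext[OF pull_obj[OF G] categoryD(4)[OF category_IC f unit_Hom[OF G]]
          categoryD(4)[OF category_IC unit_Hom[OF F] pf]])
      fix A a x assume A: "fs A" and a: "a \<in> omap (Dom IC f) A" and x: "x \<in> A \<rightarrow> S"
      then have r: "rep (Dom IC f) A x a" by (simp add: rep_def)
      show "ev (pull_obj (Cod IC f)) A (app (Comp IC (unit (Cod IC f)) f) A a) x =
        ev (pull_obj (Cod IC f)) A (app (Comp IC (push_arr (pull_arr f)) (unit (Dom IC f))) A a) x"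
        using IC_app_Comp[OF f unit_Hom[OF G] A a] IC_app_Comp[OF unit_Hom[OF F] pf A a]
          ev_push_arr[OF pull_arr_Hom[OF f] A IC_app_in[OF unit_Hom[OF F] A a] x]
          ev_unit[OF F r] ev_unit[OF G rep_app[OF f r]] app_pull_arr[OF f r] by simp
    qed
    then show "Comp IC (?\<eta> (Cod IC f)) (amap (id_functor IC) f) =
        Comp IC (amap (comp_functor IC push_functor pull) f) (?\<eta> (Dom IC f))"
      by (simp add: id_functor_def comp_functor_def compose_def fA F G pull_sel(2)[OF f]
          push_functor_sel(2)[OF pull_arr_Hom[OF f]])
  qed
  show "is_nat_trans ET ET (comp_functor ET pull push_functor) (id_functor ET) ?\<epsilon>"
    unfolding is_nat_trans_def
  proof (intro conjI ballI)
    show "?\<epsilon> \<in> (\<Pi>\<^sub>E a\<in>Obj ET. Hom ET (omap (comp_functor ET pull push_functor) a) (omap (id_functor ET) a))"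
      by (simp add: id_functor_def comp_functor_def compose_def pull_sel push_functor_sel push_obj counit_Hom)
    fix f :: "'u earr" assume fA: "f \<in> Arr ET"
    then have f: "f \<in> Hom ET (Dom ET f) (Cod ET f)" by (simp add: Hom_def)
    note X = ET_Hom_Obj(1)[OF f] and Y = ET_Hom_Obj(2)[OF f]
    note pf = pull_arr_Hom[OF push_arr_Hom[OF f]]
    have "Comp ET (counit (Cod ET f)) (pull_arr (push_arr f)) = Comp ET f (counit (Dom ET f))"
    proof (rule ET_ext_hom[OF push_obj[OF X] categoryD(4)[OF category_ET pf counit_Hom[OF Y]]
          categoryD(4)[OF category_ET counit_Hom[OF X] f]])
      fix A x a assume r: "rep (push_obj (Dom ET f)) A x a"
      then have r': "fs A" "a \<in> omap (push_obj (Dom ET f)) A" "x \<in> A \<rightarrow> S" by (auto simp: rep_def)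
      have b: "br (push_obj (Dom ET f)) A x a \<in> car (pull_obj (push_obj (Dom ET f)))"
        by (simp add: push_obj[OF X] br_in[OF r])
      show "app (Comp ET (counit (Cod ET f)) (pull_arr (push_arr f))) V (br (push_obj (Dom ET f)) A x a) =
         app (Comp ET f (counit (Dom ET f))) V (br (push_obj (Dom ET f)) A x a)"
        using ET_app_Comp[OF pf counit_Hom[OF Y] b] ET_app_Comp[OF counit_Hom[OF X] f b]
          app_pull_arr[OF push_arr_Hom[OF f] r] app_counit[OF X r]
          app_counit[OF Y rep_app[OF push_arr_Hom[OF f] r]] ev_push_arr[OF f r'] by simp
    qed
    then show "Comp ET (?\<epsilon> (Cod ET f)) (amap (comp_functor ET pull push_functor) f) =
        Comp ET (amap (id_functor ET) f) (?\<epsilon> (Dom ET f))"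
      by (simp add: id_functor_def comp_functor_def compose_def fA X Y push_functor_sel(2)[OF f]
          pull_sel(2)[OF push_arr_Hom[OF f]])
  qed
  show "\<forall>F\<in>Obj IC. Comp ET (?\<epsilon> (omap pull F)) (amap pull (?\<eta> F)) = Ide ET (omap pull F)"
  proof
    fix F assume F: "F \<in> Obj IC"
    note X = pull_obj[OF F]
    have "Comp ET (counit (pull_obj F)) (pull_arr (unit F)) = Ide ET (pull_obj F)"
    proof (rule ET_ext_hom[OF F categoryD(4)[OF category_ET pull_arr_Hom[OF unit_Hom[OF F]] counit_Hom[OF X]]
          categoryD(3)[OF category_ET X]])
      fix A x a assume r: "rep F A x a"
      have b: "br F A x a \<in> car (pull_obj F)" by (simp add: F br_in[OF r])
      show "app (Comp ET (counit (pull_obj F)) (pull_arr (unit F))) V (br F A x a) =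
          app (Ide ET (pull_obj F)) V (br F A x a)"
        using ET_app_Comp[OF pull_arr_Hom[OF unit_Hom[OF F]] counit_Hom[OF X] b] ET_app_Ide[OF b]
          app_pull_arr[OF unit_Hom[OF F] r] app_counit[OF X rep_app[OF unit_Hom[OF F] r]] ev_unit[OF F r]
        by simp
    qed
    then show "Comp ET (?\<epsilon> (omap pull F)) (amap pull (?\<eta> F)) = Ide ET (omap pull F)"
      by (simp add: F X pull_sel(1)[OF F] pull_sel(2)[OF unit_Hom[OF F]])
  qed
  show "\<forall>X\<in>Obj ET. Comp IC (amap push_functor (?\<epsilon> X)) (?\<eta> (omap push_functor X)) = Ide IC (omap push_functor X)"
  proof
    fix X :: "'u eobj" assume X: "X \<in> Obj ET"
    note R = push_obj[OF X]
    note pc = push_arr_Hom[OF counit_Hom[OF X]]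
    have "Comp IC (push_arr (counit X)) (unit (push_obj X)) = Ide IC (push_obj X)"
    proof (rule push_ext[OF X categoryD(4)[OF category_IC unit_Hom[OF R] pc] categoryD(3)[OF category_IC R]])
      fix A v x assume A: "fs A" and v: "v \<in> omap (push_obj X) A" and x: "x \<in> A \<rightarrow> S"
      then have r: "rep (push_obj X) A x v" by (simp add: rep_def)
      show "ev X A (app (Comp IC (push_arr (counit X)) (unit (push_obj X))) A v) x =
          ev X A (app (Ide IC (push_obj X)) A v) x"
        using IC_app_Comp[OF unit_Hom[OF R] pc A v] IC_app_Ide[OF A v] ev_unit[OF R r] app_counit[OF X r]
          ev_push_arr[OF counit_Hom[OF X] A IC_app_in[OF unit_Hom[OF R] A v] x] by simp
    qed
    then show "Comp IC (amap push_functor (?\<epsilon> X)) (?\<eta> (omap push_functor X)) = Ide IC (omap push_functor X)"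
      by (simp add: X R push_functor_sel(1)[OF X] push_functor_sel(2)[OF counit_Hom[OF X]])
  qed
qed

section \<open>Preservation of finite limits\<close>

lemma br_enlarge:
  assumes "F \<in> Obj IC" "rep F A (\<lambda>i. i) a" "A \<subseteq> B" "fs B" "B \<subseteq> S"
  shows "br F A (\<lambda>i. i) a = br F B (\<lambda>i. i) (push F A B (\<lambda>i. i) a)"
  using br_push[OF assms(1), of A a B "\<lambda>i. i" "\<lambda>i. i"] assms by (auto simp: rep_def)

text \<open>The reason why a directed colimit commutes with finite limits: finitely many elements
  live over one finite subset of \<open>S\<close>. The extra point \<open>s0\<close> keeps this
  subset non-empty when \<open>I\<close> is empty.\<close>

lemma common_support:
  assumes fin: "finite I" and K: "\<And>j. j \<in> I \<Longrightarrow> K j \<in> Obj IC" and u: "\<And>j. j \<in> I \<Longrightarrow> u j \<in> ext (K j)"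
  obtains A k where "fs A" "A \<subseteq> S" "\<forall>j\<in>I. k j \<in> omap (K j) A"
    "\<forall>j\<in>I. u j = br (K j) A (\<lambda>i. i) (k j)"
proof -
  have "\<exists>p. rep (K j) (fst p) (\<lambda>i. i) (snd p) \<and> u j = br (K j) (fst p) (\<lambda>i. i) (snd p)" if "j \<in> I" for j
    using ext_cases[OF K u, OF that that] by (metis Pi_I fst_conv rep_def snd_conv subsetD)
  then obtain p where p: "\<And>j. j \<in> I \<Longrightarrow> rep (K j) (fst (p j)) (\<lambda>i. i) (snd (p j))"
    "\<And>j. j \<in> I \<Longrightarrow> u j = br (K j) (fst (p j)) (\<lambda>i. i) (snd (p j))" by metis
  obtain s0 where s0: "s0 \<in> S" using infinite_S by fastforce
  define A where "A = insert s0 (\<Union>j\<in>I. fst (p j))"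
  have A: "fs A" "A \<subseteq> S" using fin p(1) s0 by (auto simp: A_def rep_def)
  show thesis
  proof (rule that[OF A]; rule ballI)
    fix j assume j: "j \<in> I"
    have sub: "fst (p j) \<subseteq> A" using j by (auto simp: A_def)
    show "push (K j) (fst (p j)) A (\<lambda>i. i) (snd (p j)) \<in> omap (K j) A"
      using p(1)[OF j] sub A by (intro push_in K j) (auto simp: rep_def)
    show "u j = br (K j) A (\<lambda>i. i) (push (K j) (fst (p j)) A (\<lambda>i. i) (snd (p j)))"
      using br_enlarge[OF K[OF j] p(1)[OF j] sub A] p(2)[OF j] by simp
  qed
qed

text \<open>Over a common support \<open>A\<close>, elements that match in the extensions match
  already in the values at \<open>A\<close>, because an inclusion gives injective coordinates. The
  limit at \<open>A\<close> then supplies the element.\<close>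

lemma ext_limit_pointwise:
  assumes J: "category J" and fin: "finite (Obj J)" and K: "is_functor J IC K" and lim: "is_limit J IC K L \<tau>"
    and u: "\<And>j. j \<in> Obj J \<Longrightarrow> u j \<in> ext (omap K j)"
    and comp: "\<And>m. m \<in> Arr J \<Longrightarrow> app (pull_arr (amap K m)) V (u (Dom J m)) = u (Cod J m)"
  shows "\<exists>!l. l \<in> ext L \<and> (\<forall>j\<in>Obj J. app (pull_arr (\<tau> j)) V l = u j)"
proof -
  have Kj: "omap K j \<in> Obj IC" if "j \<in> Obj J" for j using functorD(1)[OF K that] .
  have L: "L \<in> Obj IC" and \<tau>: "\<And>j. j \<in> Obj J \<Longrightarrow> \<tau> j \<in> Hom IC L (omap K j)"
    using lim by (auto simp: is_limit_def is_cone_def)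
  have Km: "amap K m \<in> Hom IC (omap K (Dom J m)) (omap K (Cod J m))" if "m \<in> Arr J" for m
    by (rule functorD(2)[OF K]) (simp add: Hom_def that)
  have inj: "a = b" if "F \<in> Obj IC" "fs A" "A \<subseteq> S" "a \<in> omap F A" "b \<in> omap F A"
    "br F A (\<lambda>i. i) a = br F A (\<lambda>i. i) b" for F A a b
    using that by (intro br_inject[OF that(1), of A "\<lambda>i. i" a b]) (auto simp: rep_def)
  have uniq: "l = l'" if l: "l \<in> ext L" "l' \<in> ext L"
    and eq: "\<And>j. j \<in> Obj J \<Longrightarrow> app (pull_arr (\<tau> j)) V l = app (pull_arr (\<tau> j)) V l'" for l l'
  proof -
    \<comment> \<open>The two elements form a family indexed by \<open>bool\<close>, which brings
      both over one support; there they solve the same pointwise limit problem.\<close>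
    have lb: "(if b then l else l') \<in> ext L" for b using l by simp
    obtain A k where A: "fs A" "A \<subseteq> S" and k': "\<forall>b\<in>UNIV::bool set. k b \<in> omap L A"
      and lk': "\<forall>b\<in>UNIV. (if b then l else l') = br L A (\<lambda>i. i) (k b)"
      by (rule common_support[of "UNIV :: bool set" "\<lambda>_. L" "\<lambda>b. if b then l else l'", OF _ L lb]) simp_all
    have k: "k b \<in> omap L A" and lk: "(if b then l else l') = br L A (\<lambda>i. i) (k b)" for b
      using k' lk' by simp_all
    have r: "rep L A (\<lambda>i. i) (k b)" for b using A k by (auto simp: rep_def)
    have l': "l = br L A (\<lambda>i. i) (k True)" "l' = br L A (\<lambda>i. i) (k False)" using lk[of True] lk[of False] by auto
    have e: "app (\<tau> j) A (k True) = app (\<tau> j) A (k False)" if j: "j \<in> Obj J" for j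
    proof (rule inj[OF Kj[OF j] A])
      show "app (\<tau> j) A (k True) \<in> omap (omap K j) A" "app (\<tau> j) A (k False) \<in> omap (omap K j) A"
        using IC_app_in[OF \<tau>[OF j] A(1)] k by auto
      show "br (omap K j) A (\<lambda>i. i) (app (\<tau> j) A (k True)) = br (omap K j) A (\<lambda>i. i) (app (\<tau> j) A (k False))"
        using eq[OF j] unfolding l' by (simp add: app_pull_arr[OF \<tau>[OF j] r])
    qed
    have "\<exists>!l. l \<in> omap L A \<and> (\<forall>j\<in>Obj J. app (\<tau> j) A l = app (\<tau> j) A (k True))"
    proof (rule IC_limit_pointwise[OF J K lim A(1)])
      show "app (\<tau> j) A (k True) \<in> omap (omap K j) A" if "j \<in> Obj J" for j
        by (rule IC_app_in[OF \<tau>[OF that] A(1) k])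
      fix m assume m: "m \<in> Arr J"
      then have d: "Dom J m \<in> Obj J" "Comp IC (amap K m) (\<tau> (Dom J m)) = \<tau> (Cod J m)"
        using categoryD(1)[OF J] lim by (auto simp: is_limit_def is_cone_def)
      show "app (amap K m) A (app (\<tau> (Dom J m)) A (k True)) = app (\<tau> (Cod J m)) A (k True)"
        using IC_app_Comp[OF \<tau>[OF d(1)] Km[OF m] A(1) k] d(2) by simp
    qed
    then have "k True = k False" using k e by metis
    then show ?thesis using l' by simp
  qed
  obtain A k where A: "fs A" "A \<subseteq> S" and k': "\<forall>j\<in>Obj J. k j \<in> omap (omap K j) A"
    and uk': "\<forall>j\<in>Obj J. u j = br (omap K j) A (\<lambda>i. i) (k j)"
    by (rule common_support[OF fin Kj u])
  note k = bspec[OF k'] and uk = bspec[OF uk']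
  have r: "rep (omap K j) A (\<lambda>i. i) (k j)" if "j \<in> Obj J" for j using A k[OF that] by (auto simp: rep_def)
  have "\<exists>!l. l \<in> omap L A \<and> (\<forall>j\<in>Obj J. app (\<tau> j) A l = k j)"
  proof (rule IC_limit_pointwise[OF J K lim A(1) k])
    fix m assume m: "m \<in> Arr J"
    then have d: "Dom J m \<in> Obj J" "Cod J m \<in> Obj J" using categoryD(1,2)[OF J] by auto
    show "app (amap K m) A (k (Dom J m)) = k (Cod J m)"
    proof (rule inj[OF Kj[OF d(2)] A IC_app_in[OF Km[OF m] A(1) k[OF d(1)]] k[OF d(2)]])
      show "br (omap K (Cod J m)) A (\<lambda>i. i) (app (amap K m) A (k (Dom J m))) =
          br (omap K (Cod J m)) A (\<lambda>i. i) (k (Cod J m))"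
        using comp[OF m] by (simp add: uk d app_pull_arr[OF Km[OF m] r[OF d(1)]])
    qed
  qed
  then obtain l where l: "l \<in> omap L A" "\<And>j. j \<in> Obj J \<Longrightarrow> app (\<tau> j) A l = k j" by blast
  then have rl: "rep L A (\<lambda>i. i) l" using A by (auto simp: rep_def)
  show ?thesis
  proof
    show "br L A (\<lambda>i. i) l \<in> ext L \<and> (\<forall>j\<in>Obj J. app (pull_arr (\<tau> j)) V (br L A (\<lambda>i. i) l) = u j)"
      using br_in[OF rl] uk l(2) by (simp add: app_pull_arr[OF \<tau> rl])
    then show "l' = br L A (\<lambda>i. i) l" if "l' \<in> ext L \<and> (\<forall>j\<in>Obj J. app (pull_arr (\<tau> j)) V l' = u j)" for l'
      using that uniq[of l' "br L A (\<lambda>i. i) l"] by simp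
  qed
qed

text \<open>Limits in the encoding topos can be built on carriers: each element of the vertex of a
  cone has exactly one counterpart in \<open>ext L\<close>, and uniqueness makes the resulting
  function equivariant.\<close>

lemma preserves_limits_pull: "preserves_finite_limits IC ET pull"
  unfolding preserves_finite_limits_def
proof (intro allI impI; elim conjE)
  fix J :: "(nat, nat) cat" and K L \<tau>
  assume J: "category J" and fin: "finite (Obj J)" and K: "is_functor J IC K" and lim: "is_limit J IC K L \<tau>"
  have Kj: "omap K j \<in> Obj IC" if "j \<in> Obj J" for j using functorD(1)[OF K that] .
  have L: "L \<in> Obj IC" and \<tau>: "\<And>j. j \<in> Obj J \<Longrightarrow> \<tau> j \<in> Hom IC L (omap K j)"
    and \<tau>K: "\<And>m. m \<in> Arr J \<Longrightarrow> Comp IC (amap K m) (\<tau> (Dom J m)) = \<tau> (Cod J m)"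
    using lim by (auto simp: is_limit_def is_cone_def)
  have Km: "amap K m \<in> Hom IC (omap K (Dom J m)) (omap K (Cod J m))" if "m \<in> Arr J" for m
    by (rule functorD(2)[OF K]) (simp add: Hom_def that)
  have d: "Dom J m \<in> Obj J" "Cod J m \<in> Obj J" if "m \<in> Arr J" for m using that categoryD(1,2)[OF J] by auto
  let ?K = "comp_functor J pull K"
  have K1: "omap ?K j = pull_obj (omap K j)" if "j \<in> Obj J" for j
    using that by (simp add: comp_functor_def compose_def pull_sel Kj)
  have K2: "amap ?K m = pull_arr (amap K m)" if "m \<in> Arr J" for m
    using that pull_sel(2)[OF Km[OF that]] by (simp add: comp_functor_def compose_def)
  have p\<tau>: "amap pull (\<tau> j) = pull_arr (\<tau> j)" if "j \<in> Obj J" for j by (rule pull_sel(2)[OF \<tau>[OF that]])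
  show "is_limit J ET ?K (omap pull L) (\<lambda>j. amap pull (\<tau> j))"
    unfolding is_limit_def
  proof (intro conjI allI impI)
    show "is_cone J ET ?K (omap pull L) (\<lambda>j. amap pull (\<tau> j))"
      unfolding is_cone_def
    proof (intro conjI ballI)
      show "omap pull L \<in> Obj ET" by (simp add: pull_sel L pull_obj)
      show "amap pull (\<tau> j) \<in> Hom ET (omap pull L) (omap ?K j)" if "j \<in> Obj J" for j
        using pull_arr_Hom[OF \<tau>[OF that]] that by (simp add: p\<tau> pull_sel L K1)
      fix m assume m: "m \<in> Arr J"
      have "amap pull (Comp IC (amap K m) (\<tau> (Dom J m))) = Comp ET (amap pull (amap K m)) (amap pull (\<tau> (Dom J m)))"
        by (rule functorD(4)[OF functor_pull \<tau>[OF d(1)[OF m]] Km[OF m]])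
      then show "Comp ET (amap ?K m) (amap pull (\<tau> (Dom J m))) = amap pull (\<tau> (Cod J m))"
        by (simp add: \<tau>K[OF m] K2[OF m] pull_sel(2)[OF Km[OF m]])
    qed
    fix X \<sigma> assume "is_cone J ET ?K X \<sigma>"
    then have X: "X \<in> Obj ET" and \<sigma>: "\<And>j. j \<in> Obj J \<Longrightarrow> \<sigma> j \<in> Hom ET X (pull_obj (omap K j))"
      and \<sigma>K: "\<And>m. m \<in> Arr J \<Longrightarrow> Comp ET (pull_arr (amap K m)) (\<sigma> (Dom J m)) = \<sigma> (Cod J m)"
      by (auto simp: is_cone_def K1 K2)
    have ex: "\<exists>!l. l \<in> ext L \<and> (\<forall>j\<in>Obj J. app (pull_arr (\<tau> j)) V l = app (\<sigma> j) V v)" if v: "v \<in> car X" for v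
    proof (rule ext_limit_pointwise[OF J fin K lim])
      show "app (\<sigma> j) V v \<in> ext (omap K j)" if "j \<in> Obj J" for j
        using ET_app_in[OF \<sigma>[OF that] v] by (simp add: Kj that)
      show "app (pull_arr (amap K m)) V (app (\<sigma> (Dom J m)) V v) = app (\<sigma> (Cod J m)) V v" if m: "m \<in> Arr J" for m
        using ET_app_Comp[OF \<sigma>[OF d(1)[OF m]] pull_arr_Hom[OF Km[OF m]] v] \<sigma>K[OF m] by simp
    qed
    define h where "h v = (THE l. l \<in> ext L \<and> (\<forall>j\<in>Obj J. app (pull_arr (\<tau> j)) V l = app (\<sigma> j) V v))" for v
    have h: "h v \<in> ext L" "\<And>j. j \<in> Obj J \<Longrightarrow> app (pull_arr (\<tau> j)) V (h v) = app (\<sigma> j) V v"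
      if "v \<in> car X" for v
      using theI'[OF ex[OF that]] unfolding h_def by auto
    have hu: "l = h v" if "v \<in> car X" "l \<in> ext L" "\<And>j. j \<in> Obj J \<Longrightarrow> app (pull_arr (\<tau> j)) V l = app (\<sigma> j) V v" for v l
      using ex[OF that(1)] that(2,3) h[OF that(1)] by blast
    let ?h = "mk_nat loop_cat X (pull_obj L) (\<lambda>_. h)"
    have hH: "?h \<in> Hom ET X (pull_obj L)"
    proof (rule ET_HomI[OF X pull_obj[OF L]])
      fix v assume v: "v \<in> car X"
      show "h v \<in> car (pull_obj L)" using h(1)[OF v] by (simp add: L)
      fix e assume e: "e \<in> loops"
      show "eact (pull_obj L) e (h v) = h (eact X e v)"
      proof (rule hu[OF eact_in[OF X e v]])
        show "eact (pull_obj L) e (h v) \<in> ext L"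
          using eact_in[OF pull_obj[OF L] e] h(1)[OF v] by (simp add: L)
        fix j assume j: "j \<in> Obj J"
        show "app (pull_arr (\<tau> j)) V (eact (pull_obj L) e (h v)) = app (\<sigma> j) V (eact X e v)"
          using ET_app_eact[OF pull_arr_Hom[OF \<tau>[OF j]] e, of "h v"] h[OF v] j
            ET_app_eact[OF \<sigma>[OF j] e v] by (simp add: L)
      qed
    qed
    show "\<exists>!h. h \<in> Hom ET X (omap pull L) \<and> (\<forall>j\<in>Obj J. Comp ET (amap pull (\<tau> j)) h = \<sigma> j)"
      unfolding pull_sel(1)[OF L]
    proof
      show "?h \<in> Hom ET X (pull_obj L) \<and> (\<forall>j\<in>Obj J. Comp ET (amap pull (\<tau> j)) ?h = \<sigma> j)"
      proof (intro conjI ballI hH)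
        fix j assume j: "j \<in> Obj J"
        show "Comp ET (amap pull (\<tau> j)) ?h = \<sigma> j"
          unfolding p\<tau>[OF j]
        proof (rule ET_Hom_ext[OF categoryD(4)[OF category_ET hH pull_arr_Hom[OF \<tau>[OF j]]] \<sigma>[OF j]])
          fix v assume v: "v \<in> car X"
          show "app (Comp ET (pull_arr (\<tau> j)) ?h) V v = app (\<sigma> j) V v"
            using ET_app_Comp[OF hH pull_arr_Hom[OF \<tau>[OF j]] v] h(2)[OF v j] v by simp
        qed
      qed
      fix g assume g: "g \<in> Hom ET X (pull_obj L) \<and> (\<forall>j\<in>Obj J. Comp ET (amap pull (\<tau> j)) g = \<sigma> j)"
      show "g = ?h"
      proof (rule ET_Hom_ext[OF conjunct1[OF g] hH])
        fix v assume v: "v \<in> car X"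
        have "app g V v = h v"
        proof (rule hu[OF v])
          show "app g V v \<in> ext L" using ET_app_in[OF conjunct1[OF g] v] by (simp add: L)
          show "app (pull_arr (\<tau> j)) V (app g V v) = app (\<sigma> j) V v" if j: "j \<in> Obj J" for j
            using ET_app_Comp[OF conjunct1[OF g] pull_arr_Hom[OF \<tau>[OF j]] v] g j by (simp add: p\<tau>)
        qed
        then show "app g V v = app ?h V v" using v by simp
      qed
    qed
  qed
qed

section \<open>Reduction of connectedness to maps out of powers\<close>

definition algebra_geom :: "('u eobj, 'u earr, 'u inh_obj, 'u inh_arr) geom" where
  "algebra_geom = \<lparr>inverse_image = pull, direct_image = push_functor\<rparr>"

lemma geometric_algebra_geom: "geometric_morphism ET IC algebra_geom"
  by (simp add: geometric_morphism_def algebra_geom_def adjunction preserves_limits_pull)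

text \<open>Fullness tested on representable functors. The inverse image of the functor represented
  by \<open>A\<close> is the power of \<open>S\<close> with exponent \<open>A\<close>, so by the
  Yoneda lemma its maps to \<open>pull_obj G\<close> should be the elements of \<open>G\<close> at
  \<open>A\<close>. Functions on this power are written as functions of a total \<open>x\<close>
  that depend only on its values on \<open>A\<close>.\<close>

definition equivariantly_projective :: bool where
  "equivariantly_projective \<longleftrightarrow> (\<forall>G A \<phi>. G \<in> Obj IC \<longrightarrow> fs A \<longrightarrow> (\<forall>x\<in>A \<rightarrow> S. \<phi> x \<in> ext G) \<longrightarrow>
     (\<forall>x y. (\<forall>i\<in>A. x i = y i) \<longrightarrow> \<phi> x = \<phi> y) \<longrightarrow>
     (\<forall>e\<in>loops. \<forall>x\<in>A \<rightarrow> S. \<phi> (\<lambda>i. ops e (x i)) = emap G (ops e) (\<phi> x)) \<longrightarrow>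
     (\<exists>g\<in>omap G A. \<forall>x\<in>A \<rightarrow> S. \<phi> x = br G A x g))"

text \<open>Each element \<open>a\<close> of \<open>F\<close> at \<open>A\<close> gives a map from a
  power of \<open>S\<close> to \<open>ext F\<close>, and these maps jointly cover
  \<open>ext F\<close>. The hypothesis, applied to their composites with \<psi>, gives the
  components of a transformation. Injective coordinates exist because \<open>S\<close> is infinite;
  they make the components unique, and uniqueness makes them natural.\<close>

lemma fully_faithful_pull:
  assumes ep: equivariantly_projective
  shows "fully_faithful IC ET pull"
  unfolding fully_faithful_def
proof (intro ballI)
  fix F G assume F: "F \<in> Obj IC" and G: "G \<in> Obj IC"
  have ex_inj: "\<exists>x. x \<in> A \<rightarrow> S \<and> inj_on x A" if "fs A" for A :: "'u set"
    using finite_lepoll_infinite[OF infinite_S, of A] that by (auto simp: lepoll_def)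
  have uniq: "a = b" if *: "fs A" "a \<in> omap G A" "b \<in> omap G A" "\<And>x. x \<in> A \<rightarrow> S \<Longrightarrow> br G A x a = br G A x b" for A a b
  proof -
    obtain x where "x \<in> A \<rightarrow> S" "inj_on x A" using ex_inj[OF *(1)] by blast
    then show ?thesis using * by (intro br_inject[OF G, of A x a b]) (auto simp: rep_def)
  qed
  show "bij_betw (amap pull) (Hom IC F G) (Hom ET (omap pull F) (omap pull G))"
    unfolding bij_betw_def
  proof
    show "inj_on (amap pull) (Hom IC F G)"
    proof (rule inj_onI)
      fix \<alpha> \<beta> assume \<alpha>: "\<alpha> \<in> Hom IC F G" and \<beta>: "\<beta> \<in> Hom IC F G" and "amap pull \<alpha> = amap pull \<beta>"
      then have eq: "pull_arr \<alpha> = pull_arr \<beta>" by (simp add: pull_sel(2)[OF \<alpha>] pull_sel(2)[OF \<beta>])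
      show "\<alpha> = \<beta>"
      proof (rule IC_Hom_ext[OF \<alpha> \<beta>])
        fix A a assume A: "fs A" and a: "a \<in> omap F A"
        show "app \<alpha> A a = app \<beta> A a"
        proof (rule uniq[OF A IC_app_in[OF \<alpha> A a] IC_app_in[OF \<beta> A a]])
          fix x assume "x \<in> A \<rightarrow> S"
          then have r: "rep F A x a" using A a by (simp add: rep_def)
          show "br G A x (app \<alpha> A a) = br G A x (app \<beta> A a)"
            using app_pull_arr[OF \<alpha> r] app_pull_arr[OF \<beta> r] eq by simp
        qed
      qed
    qed
    show "amap pull ` Hom IC F G = Hom ET (omap pull F) (omap pull G)"
    proof (intro equalityI subsetI)
      fix \<xi> assume "\<xi> \<in> amap pull ` Hom IC F G"
      then show "\<xi> \<in> Hom ET (omap pull F) (omap pull G)"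
        using functorD(2)[OF functor_pull] by auto
    next
      fix \<psi> assume "\<psi> \<in> Hom ET (omap pull F) (omap pull G)"
      then have \<psi>: "\<psi> \<in> Hom ET (pull_obj F) (pull_obj G)" by (simp add: pull_sel F G)
      have "\<exists>g\<in>omap G A. \<forall>x\<in>A \<rightarrow> S. app \<psi> V (br F A x a) = br G A x g" if A: "fs A" and a: "a \<in> omap F A" for A a
      proof -
        have r: "rep F A x a" if "x \<in> A \<rightarrow> S" for x using A a that by (simp add: rep_def)
        have "\<forall>x\<in>A \<rightarrow> S. app \<psi> V (br F A x a) \<in> ext G"
          using ET_app_in[OF \<psi>] br_in[OF r] by (simp add: F G)
        moreover have "app \<psi> V (br F A x a) = app \<psi> V (br F A y a)" if "\<forall>i\<in>A. x i = y i" for x y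
          using br_cong[of A x y F a] that by simp
        moreover have "app \<psi> V (br F A (\<lambda>i. ops e (x i)) a) = emap G (ops e) (app \<psi> V (br F A x a))"
          if "e \<in> loops" "x \<in> A \<rightarrow> S" for e x
          using ET_app_eact[OF \<psi> that(1), of "br F A x a"] eact_br[OF F that(1) r[OF that(2)]]
            eact_pull[OF G that(1), of "app \<psi> V (br F A x a)"] ET_app_in[OF \<psi>, of "br F A x a"]
            br_in[OF r[OF that(2)]] by (simp add: F G)
        ultimately show ?thesis
          using ep[unfolded equivariantly_projective_def, rule_format, OF G A, of "\<lambda>x. app \<psi> V (br F A x a)"] by blast
      qed
      then obtain \<alpha> where \<alpha>: "\<And>A a. fs A \<Longrightarrow> a \<in> omap F A \<Longrightarrow> \<alpha> A a \<in> omap G A"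
        "\<And>A a x. fs A \<Longrightarrow> a \<in> omap F A \<Longrightarrow> x \<in> A \<rightarrow> S \<Longrightarrow> app \<psi> V (br F A x a) = br G A x (\<alpha> A a)"
        by metis
      let ?\<alpha> = "mk_nat finset_inh F G \<alpha>"
      have h: "?\<alpha> \<in> Hom IC F G"
      proof (rule mk_nat_IC_Hom[OF F G \<alpha>(1)])
        fix A B :: "'u set" and f a assume *: "fs A" "fs B" "f \<in> A \<rightarrow> B" "a \<in> omap F A"
        show "push G A B f (\<alpha> A a) = \<alpha> B (push F A B f a)"
        proof (rule uniq[OF *(2) push_in[OF G *(1-3) \<alpha>(1)[OF *(1,4)]] \<alpha>(1)[OF *(2) push_in[OF F *]]])
          fix x assume x: "x \<in> B \<rightarrow> S"
          then have xf: "(\<lambda>i. x (f i)) \<in> A \<rightarrow> S" using *(3) by auto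
          show "br G B x (push G A B f (\<alpha> A a)) = br G B x (\<alpha> B (push F A B f a))"
            using br_push[OF G *(1) \<alpha>(1)[OF *(1,4)] *(2,3) x] br_push[OF F *(1,4,2,3) x]
              \<alpha>(2)[OF *(1,4) xf] \<alpha>(2)[OF *(2) push_in[OF F *] x] by simp
        qed
      qed
      have "pull_arr ?\<alpha> = \<psi>"
      proof (rule ET_ext_hom[OF F pull_arr_Hom[OF h] \<psi>])
        fix A x a assume r: "rep F A x a"
        then show "app (pull_arr ?\<alpha>) V (br F A x a) = app \<psi> V (br F A x a)"
          using app_pull_arr[OF h r] \<alpha>(2)[of A a x] app_mk_nat_IC[of A a F G \<alpha>] by (simp add: rep_def)
      qed
      then show "\<psi> \<in> amap pull ` Hom IC F G" using h pull_sel(2)[OF h] by (metis imageI)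
    qed
  qed
qed

text \<open>A point \<open>s\<close> is sent to its class over the singleton of \<open>s\<close>.
  The resulting lower bound on the carrier is what makes rigid objects of unbounded size
  available.\<close>

lemma rigid_pull:
  assumes ep: equivariantly_projective
  shows "inhabited_topos_rigid TYPE('u) ET (pull_obj universal_inh)"
    and "S \<lesssim> car (pull_obj universal_inh)"
proof -
  let ?U = "universal_inh :: 'u inh_obj"
  note X = pull_obj[OF universal_Obj]
  have r: "rep ?U {s} (\<lambda>i. i) s" if "s \<in> S" for s
    using that by (simp add: rep_def universal_omap)
  have "s = t" if st: "s \<in> S" "t \<in> S" and eq: "br ?U {s} (\<lambda>i. i) s = br ?U {t} (\<lambda>i. i) t" for s t
  proof -
    obtain C where C: "fs C" "s \<in> C" "t \<in> C" "push ?U {s} C (\<lambda>i. i) s = push ?U {t} C (\<lambda>i. i) t"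
      using eq br_eq_iff[OF universal_Obj r[OF st(1)] r[OF st(2)]] by auto
    then show ?thesis
      using universal_push[of "{s}" C "\<lambda>i. i" s] universal_push[of "{t}" C "\<lambda>i. i" t] by simp
  qed
  then have "inj_on (\<lambda>s. br ?U {s} (\<lambda>i. i) s) S" by (auto simp: inj_on_def)
  moreover have "(\<lambda>s. br ?U {s} (\<lambda>i. i) s) ` S \<subseteq> car (pull_obj ?U)"
    by (auto simp: universal_Obj br_in r)
  ultimately show S: "S \<lesssim> car (pull_obj ?U)" unfolding lepoll_def by blast
  have "car (pull_obj ?U) \<noteq> {}" using S infinite_S by auto
  then have "inhabited ET (pull_obj ?U)"
    by (intro ET_inhabitedI X) (unfold_locales, rule inaccessible)
  moreover have "isomorphic ET (omap (inverse_image algebra_geom) ?U) (pull_obj ?U)"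
    using categoryD(3,5)[OF category_ET] X
    by (auto simp: algebra_geom_def pull_sel universal_Obj isomorphic_def
        intro!: bexI[of _ "Ide ET (pull_obj ?U)"])
  moreover have "connected_geometric_morphism ET IC algebra_geom"
    using geometric_algebra_geom fully_faithful_pull[OF ep]
    by (simp add: connected_geometric_morphism_def algebra_geom_def)
  ultimately show "inhabited_topos_rigid TYPE('u) ET (pull_obj ?U)"
    unfolding inhabited_topos_rigid_def using X by blast
qed

end


section \<open>Supports\<close>

context infinite_carrier
begin

text \<open>Every non-empty finite set over which \<open>u\<close> is represented counts, minimal or
  not. As emptiness is excluded, even an element that behaves as a constant has supports only of
  size at least one.\<close>

definition supp :: "'u inh_obj \<Rightarrow> 'u \<Rightarrow> 'u set \<Rightarrow> bool" where
  "supp F u B \<longleftrightarrow> fs B \<and> B \<subseteq> S \<and> (\<exists>b\<in>omap F B. u = br F B (\<lambda>i. i) b)"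

lemma supp_fs: "supp F u B \<Longrightarrow> fs B"
  and supp_subset: "supp F u B \<Longrightarrow> B \<subseteq> S"
  by (auto simp: supp_def)

lemma suppE:
  assumes "supp F u B"
  obtains b where "rep F B (\<lambda>i. i) b" "u = br F B (\<lambda>i. i) b"
  using assms by (auto simp: supp_def rep_def)

lemma supp_ex: "F \<in> Obj IC \<Longrightarrow> u \<in> ext F \<Longrightarrow> \<exists>B. supp F u B"
  unfolding supp_def by (metis ext_cases)

lemma supp_emap:
  assumes F: "F \<in> Obj IC" and s: "supp F u B" and w: "w \<in> S \<rightarrow> S"
  shows "supp F (emap F w u) (w ` B)"
proof -
  obtain b where r: "rep F B (\<lambda>i. i) b" and u: "u = br F B (\<lambda>i. i) b" by (rule suppE[OF s])
  have B: "fs B" "fs (w ` B)" "w ` B \<subseteq> S" "b \<in> omap F B" using r w by (auto simp: rep_def)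
  have "emap F w u = br F (w ` B) (\<lambda>i. i) (push F B (w ` B) w b)"
    using emap_br[OF F w r] br_push[OF F B(1,4,2), of w "\<lambda>i. i"] B u by auto
  moreover have "push F B (w ` B) w b \<in> omap F (w ` B)"
    by (rule push_in[OF F B(1,2) _ B(4)]) auto
  ultimately show ?thesis using B unfolding supp_def by blast
qed

lemma emap_cong:
  assumes F: "F \<in> Obj IC" and s: "supp F u B" and w: "w \<in> S \<rightarrow> S" "w' \<in> S \<rightarrow> S"
    and eq: "\<And>x. x \<in> B \<Longrightarrow> w x = w' x"
  shows "emap F w u = emap F w' u"
proof -
  obtain b where r: "rep F B (\<lambda>i. i) b" and u: "u = br F B (\<lambda>i. i) b" by (rule suppE[OF s])
  show ?thesis
    unfolding u emap_br[OF F w(1) r] emap_br[OF F w(2) r] by (rule br_cong[OF eq])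
qed

lemma emap_fixes:
  assumes F: "F \<in> Obj IC" and s: "supp F u B" and w: "w \<in> S \<rightarrow> S" and eq: "\<And>x. x \<in> B \<Longrightarrow> w x = x"
  shows "emap F w u = u"
proof -
  obtain b where r: "rep F B (\<lambda>i. i) b" and u: "u = br F B (\<lambda>i. i) b" by (rule suppE[OF s])
  show ?thesis
    unfolding u emap_br[OF F w r] by (rule br_cong[OF eq])
qed

lemma emap_emap:
  assumes F: "F \<in> Obj IC" and u: "u \<in> ext F" and w: "w \<in> S \<rightarrow> S" "w' \<in> S \<rightarrow> S"
  shows "emap F w (emap F w' u) = emap F (\<lambda>x. w (w' x)) u"
proof -
  obtain B where s: "supp F u B" using supp_ex[OF F u] ..
  obtain b where r: "rep F B (\<lambda>i. i) b" and u: "u = br F B (\<lambda>i. i) b" by (rule suppE[OF s])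
  have c: "(\<lambda>x. w (w' x)) \<in> S \<rightarrow> S" using w by auto
  show ?thesis
    unfolding u emap_br[OF F w(2) r] emap_br[OF F w(1) rep_comp[OF r w(2)]] emap_br[OF F c r] ..
qed

text \<open>Moving \<open>b\<close> to \<open>s\<close> while fixing \<open>a\<close> leaves
  \<open>u\<close> unchanged, because \<open>a\<close> alone supports it, yet turns the support at
  \<open>b\<close> into one at \<open>s\<close>.\<close>

lemma supp_two_points:
  assumes F: "F \<in> Obj IC" and a: "supp F u {a}" and b: "supp F u {b}" and ne: "a \<noteq> b" and s: "s \<in> S"
  shows "supp F u {s}"
proof -
  let ?w = "\<lambda>x. if x = b then s else x"
  have w: "?w \<in> S \<rightarrow> S" using s by auto
  have "emap F ?w u = u" by (rule emap_fixes[OF F a w]) (use ne in auto)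
  then show ?thesis using supp_emap[OF F b w] by simp
qed

text \<open>A retraction onto one support moves another support into the first one, so two minimal
  supports agree unless they are disjoint, and then they are singletons.\<close>

lemma minimal_supp_unique:
  assumes F: "F \<in> Obj IC" and E: "supp F u E" "card E \<le> k" and E': "supp F u E'" "card E' \<le> k"
    and min: "\<And>B. supp F u B \<Longrightarrow> k \<le> card B" and ne: "E \<noteq> E'" and s: "s \<in> S"
  shows "supp F u {s}"
proof (cases "E \<inter> E' = {}")
  case True
  have pt: "supp F u {a}" if a: "a \<in> E" and E: "supp F u E" and E': "supp F u E'" and d: "E \<inter> E' = {}" for a E E'
  proof -
    let ?r = "\<lambda>x. if x \<in> E then x else a"
    have r: "?r \<in> S \<rightarrow> S" using supp_subset[OF E] a by auto
    have "?r ` E' = {a}" using d supp_fs[OF E'] by auto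
    moreover have "emap F ?r u = u" by (rule emap_fixes[OF F E r]) simp
    ultimately show ?thesis using supp_emap[OF F E' r] by simp
  qed
  obtain a b where ab: "a \<in> E" "b \<in> E'" using supp_fs E(1) E'(1) by blast
  have "supp F u {a}" by (rule pt[OF ab(1) E(1) E'(1) True])
  moreover have "supp F u {b}" by (rule pt[OF ab(2) E'(1) E(1)]) (use True in blast)
  ultimately show ?thesis using supp_two_points[OF F _ _ _ s] ab True by blast
next
  case False
  then obtain t where t: "t \<in> E" "t \<in> E'" by blast
  let ?r = "\<lambda>x. if x \<in> E then x else t"
  have fin: "finite E" "finite E'" using supp_fs E(1) E'(1) by blast+
  have r: "?r \<in> S \<rightarrow> S" using supp_subset[OF E(1)] t by auto
  have "emap F ?r u = u" by (rule emap_fixes[OF F E(1) r]) simp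
  then have "k \<le> card (?r ` E')" using min supp_emap[OF F E'(1) r] by simp
  also have "\<dots> \<le> card (E \<inter> E')" by (rule card_mono) (use fin t in auto)
  finally have "k \<le> card (E \<inter> E')" .
  then have "card (E \<inter> E') = card E" "card (E \<inter> E') = card E'"
    using E(2) E'(2) card_mono[OF fin(1), of "E \<inter> E'"] card_mono[OF fin(2), of "E \<inter> E'"] by auto
  then have "E \<inter> E' = E" "E \<inter> E' = E'"
    using card_subset_eq[OF fin(1), of "E \<inter> E'"] card_subset_eq[OF fin(2), of "E \<inter> E'"] by auto
  then show ?thesis using ne by blast
qed

section \<open>The least size of a support\<close>

definition msupp :: "'u inh_obj \<Rightarrow> 'u \<Rightarrow> nat" where
  "msupp F u = (LEAST n. \<exists>B. supp F u B \<and> card B = n)"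

lemma msupp_ex: "F \<in> Obj IC \<Longrightarrow> u \<in> ext F \<Longrightarrow> \<exists>B. supp F u B \<and> card B = msupp F u"
  unfolding msupp_def by (rule LeastI_ex) (use supp_ex in blast)

lemma msupp_le: "supp F u B \<Longrightarrow> msupp F u \<le> card B"
  unfolding msupp_def by (rule Least_le) blast

text \<open>Self-maps of \<open>S\<close> never increase the size. Hence a point that codes several
  others has a value at least as complex as theirs, which is the source of the bound and of the
  maximum used for \<phi>.\<close>

lemma msupp_emap:
  assumes "F \<in> Obj IC" "u \<in> ext F" "w \<in> S \<rightarrow> S"
  shows "msupp F (emap F w u) \<le> msupp F u"
proof -
  obtain B where B: "supp F u B" "card B = msupp F u" using msupp_ex[OF assms(1,2)] by blast
  have "msupp F (emap F w u) \<le> card (w ` B)"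
    by (rule msupp_le[OF supp_emap[OF assms(1) B(1) assms(3)]])
  also have "\<dots> \<le> card B" using supp_fs[OF B(1)] by (intro card_image_le) auto
  finally show ?thesis using B(2) by simp
qed

end


section \<open>A rigid unary algebra\<close>

text \<open>A bijection between \<open>S\<close> and the set of sequences in \<open>S\<close> makes unary operations as expressive
  as operations of countable arity.\<close>

locale coded_carrier = infinite_carrier U S for U :: "'u itself" and S +
  fixes c :: "(nat \<Rightarrow> 'u) \<Rightarrow> 'u" and p :: "nat \<Rightarrow> 'u \<Rightarrow> 'u"
  assumes c_in: "(\<And>n. f n \<in> S) \<Longrightarrow> c f \<in> S"
    and p_in: "s \<in> S \<Longrightarrow> p n s \<in> S"
    and p_c: "(\<And>n. f n \<in> S) \<Longrightarrow> p n (c f) = f n"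
    and c_p: "s \<in> S \<Longrightarrow> c (\<lambda>n. p n s) = s"
begin

definition zero :: 'u where "zero = (SOME s. s \<in> S)"
definition one :: 'u where "one = (SOME s. s \<in> S - {zero})"

lemma zero_in: "zero \<in> S" and one_in: "one \<in> S" and one_neq_zero: "one \<noteq> zero"
proof -
  show "zero \<in> S" unfolding zero_def using infinite_S by (metis finite.emptyI some_in_eq)
  have "S - {zero} \<noteq> {}" using infinite_S by (metis finite.emptyI finite_Diff_insert finite_insert Diff_empty)
  then have "one \<in> S - {zero}" unfolding one_def by (rule some_in_eq[THEN iffD2])
  then show "one \<in> S" "one \<noteq> zero" by auto
qed

text \<open>The quaternary discriminator of universal algebra, read off the first four entries of a
  coded sequence.\<close>

definition switch :: "'u \<Rightarrow> 'u" where
  "switch s = (if p 0 s = p 1 s then p 2 s else p 3 s)"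

text \<open>Tails are compared up to a shift, as \<open>m\<close> and \<open>n\<close> may differ. A
  sequence and the same sequence without its first entry therefore have equal tail classes.\<close>

definition tail_class :: "'u \<Rightarrow> (nat \<Rightarrow> 'u) set" where
  "tail_class s = {r. (\<forall>i. r i \<in> S) \<and> (\<exists>m n. \<forall>i. p (m + i) s = r (n + i))}"

definition tail_rep :: "'u \<Rightarrow> 'u" where
  "tail_rep s = c (SOME r. r \<in> tail_class s)"

text \<open>An enumeration by natural numbers, to match the indices of the loops. The projections
  begin at index 4, whence the summand 4 in later uses.\<close>

definition base :: "nat \<Rightarrow> 'u \<Rightarrow> 'u" where
  "base k = (if k = 0 then (\<lambda>_. zero) else if k = 1 then (\<lambda>_. one) else if k = 2 then switch
     else if k = 3 then tail_rep else p (k - 4))"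

definition pair :: "'u \<Rightarrow> 'u \<Rightarrow> 'u" where
  "pair s t = c (\<lambda>n. if n = 0 then s else t)"

text \<open>The first half of the coded pair is a parameter that survives the operation, so
  \<open>w\<close> can be applied to one of two points that are coded together.\<close>

definition par :: "('u \<Rightarrow> 'u) \<Rightarrow> 'u \<Rightarrow> 'u" where
  "par w s = pair (p 0 s) (w (p 1 s))"

text \<open>The index \<open>i\<close> alone selects the operation:
  \<open>Proj \<infinity> i\<close> reaches every \<open>base i\<close>, and
  \<open>Proj' (Suc i) i\<close> reaches every \<open>par (base i)\<close>.\<close>

fun ops :: "nat enc_edge \<Rightarrow> 'u \<Rightarrow> 'u" where
  "ops (Proj n i) = base i"
| "ops (Proj' n i) = par (base i)"
| "ops e = (\<lambda>s. s)"

lemma tail_class_self: "s \<in> S \<Longrightarrow> (\<lambda>i. p i s) \<in> tail_class s"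
  by (auto simp: tail_class_def p_in)

lemma tail_rep_class:
  assumes "s \<in> S"
  obtains r where "r \<in> tail_class s" "tail_rep s = c r"
  using assms tail_class_self someI_ex[of "\<lambda>r. r \<in> tail_class s"] unfolding tail_rep_def by blast

lemma pair_in: "s \<in> S \<Longrightarrow> t \<in> S \<Longrightarrow> pair s t \<in> S"
  and p_pair: "s \<in> S \<Longrightarrow> t \<in> S \<Longrightarrow> p 0 (pair s t) = s" "s \<in> S \<Longrightarrow> t \<in> S \<Longrightarrow> p 1 (pair s t) = t"
  unfolding pair_def by (auto intro!: c_in simp: p_c)

lemma base_in: "base k \<in> S \<rightarrow> S"
proof
  fix s assume s: "s \<in> S"
  obtain r where "r \<in> tail_class s" "tail_rep s = c r" using tail_rep_class[OF s] .
  then have "tail_rep s \<in> S" by (auto simp: tail_class_def intro!: c_in)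
  then show "base k s \<in> S"
    using s by (auto simp: base_def zero_in one_in switch_def p_in)
qed

lemma par_in: "w \<in> S \<rightarrow> S \<Longrightarrow> par w \<in> S \<rightarrow> S"
  by (intro Pi_I) (simp add: par_def pair_in p_in Pi_mem[of w S "\<lambda>_. S"])

sublocale unary_algebra U S ops
proof
  show "ops e \<in> S \<rightarrow> S" for e by (cases e) (auto simp: base_in par_in simp del: Pi_iff)
qed

text \<open>For a subset \<open>I\<close> of \<open>A\<close>, the discriminator shows that
  \<open>y\<close> looks either only at the values on \<open>I\<close> or only at those off
  \<open>I\<close>. The sets of the first kind behave like an ultrafilter on the finite set
  \<open>A\<close>, so a single point \<open>a\<close> decides.\<close>

lemma equivariant_projection:
  fixes A :: "'u set" and y :: "('u \<Rightarrow> 'u) \<Rightarrow> 'u"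
  assumes A: "fs A"
    and y_in: "\<And>x. x \<in> A \<rightarrow> S \<Longrightarrow> y x \<in> S"
    and cong: "\<And>x x'. (\<And>i. i \<in> A \<Longrightarrow> x i = x' i) \<Longrightarrow> y x = y x'"
    and hom: "\<And>k x. x \<in> A \<rightarrow> S \<Longrightarrow> y (\<lambda>i. base k (x i)) = base k (y x)"
  shows "\<exists>a\<in>A. \<forall>x\<in>A \<rightarrow> S. y x = x a"
proof -
  have y_p: "y (\<lambda>i. p n (x i)) = p n (y x)" if "x \<in> A \<rightarrow> S" for n x
    using hom[OF that, of "n + 4"] by (simp add: base_def)
  have y_const: "y (\<lambda>_. zero) = zero" "y (\<lambda>_. one) = one"
    using hom[of "\<lambda>_. zero" 0] hom[of "\<lambda>_. zero" 1] zero_in by (auto simp: base_def)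
  \<comment> \<open>The projections jointly determine an element, so compatibility with them gives
    compatibility with the coding of sequences. Through it \<open>y\<close> respects operations of
    several arguments.\<close>
  have y_c: "y (\<lambda>i. c (\<lambda>n. f n i)) = c (\<lambda>n. y (f n))" if f: "\<And>n. f n \<in> A \<rightarrow> S" for f
  proof -
    let ?z = "\<lambda>i. c (\<lambda>n. f n i)"
    have z: "?z \<in> A \<rightarrow> S" using f by (auto intro!: c_in)
    have "p n (y ?z) = y (f n)" for n
    proof -
      have "y (\<lambda>i. p n (?z i)) = y (f n)"
        by (rule cong) (use f in \<open>auto intro!: p_c\<close>)
      then show ?thesis using y_p[OF z] by simp
    qed
    then show ?thesis using c_p[OF y_in[OF z]] by simp
  qed
  let ?sw = "\<lambda>a b u v :: 'u. if a = b then u else v"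
  have y_sw: "y (\<lambda>i. ?sw (a i) (b i) (u i) (v i)) = ?sw (y a) (y b) (y u) (y v)"
    if "a \<in> A \<rightarrow> S" "b \<in> A \<rightarrow> S" "u \<in> A \<rightarrow> S" "v \<in> A \<rightarrow> S" for a b u v
  proof -
    define f where "f n = (if n = 0 then a else if n = 1 then b else if n = 2 then u else v)" for n :: nat
    have f: "f n \<in> A \<rightarrow> S" for n using that by (simp add: f_def)
    let ?z = "\<lambda>i. c (\<lambda>n. f n i)"
    have z: "?z \<in> A \<rightarrow> S" using f by (auto intro!: c_in)
    have pz: "p n (?z i) = f n i" if "i \<in> A" for n i using f that by (intro p_c) auto
    have pyz: "p n (y ?z) = y (f n)" for n
      unfolding y_c[OF f] by (rule p_c) (rule y_in[OF f])
    have "y (\<lambda>i. ?sw (a i) (b i) (u i) (v i)) = y (\<lambda>i. base 2 (?z i))"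
      by (rule cong) (simp add: base_def switch_def pz, simp add: f_def)
    also have "\<dots> = switch (y ?z)" by (simp add: hom[OF z]) (simp add: base_def)
    also have "\<dots> = ?sw (y a) (y b) (y u) (y v)"
      by (simp add: switch_def pyz) (simp add: f_def)
    finally show ?thesis .
  qed
  let ?mix = "\<lambda>I u v i. if i \<in> I then u i else v i :: 'u"
  have dich: "(\<forall>u\<in>A \<rightarrow> S. \<forall>v\<in>A \<rightarrow> S. y (?mix I u v) = y u) \<or> (\<forall>u\<in>A \<rightarrow> S. \<forall>v\<in>A \<rightarrow> S. y (?mix I u v) = y v)" for I
  proof -
    \<comment> \<open>The indicator of \<open>I\<close> in terms of the two constants. Comparing it
      with \<open>zero\<close> coordinatewise selects between \<open>u\<close> and \<open>v\<close>;
      after \<open>y\<close> the comparison no longer involves \<open>u\<close> and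
      \<open>v\<close>, so the outcome is the same for all of them.\<close>
    let ?b = "\<lambda>i. if i \<in> I then zero else one"
    have "y (?mix I u v) = ?sw (y (\<lambda>_. zero)) (y ?b) (y u) (y v)" if uv: "u \<in> A \<rightarrow> S" "v \<in> A \<rightarrow> S" for u v
    proof -
      have "y (?mix I u v) = y (\<lambda>i. ?sw zero (?b i) (u i) (v i))"
        by (rule cong) (use one_neq_zero in auto)
      also have "\<dots> = ?sw (y (\<lambda>_. zero)) (y ?b) (y u) (y v)"
        using y_sw[of "\<lambda>_. zero" ?b u v] uv zero_in one_in by auto
      finally show ?thesis .
    qed
    then show ?thesis by (cases "y (\<lambda>_. zero) = y ?b") auto
  qed
  have "\<exists>a\<in>A. \<forall>u\<in>A \<rightarrow> S. \<forall>v\<in>A \<rightarrow> S. y (?mix {a} u v) = y u"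
  proof (rule ccontr)
    assume "\<not> ?thesis"
    then have N: "y (?mix {a} u v) = y v" if "a \<in> A" "u \<in> A \<rightarrow> S" "v \<in> A \<rightarrow> S" for a u v
      using dich[of "{a}"] that by blast
    \<comment> \<open>If no single coordinate decides, coordinates can be exchanged one at a time
      without effect. Having exchanged all of \<open>A\<close>, one finds that \<open>y\<close>
      identifies the two constants.\<close>
    have "y (?mix B u v) = y v" if "finite B" "B \<subseteq> A" "u \<in> A \<rightarrow> S" "v \<in> A \<rightarrow> S" for B u v
      using that
    proof (induction B)
      case (insert a B)
      have m: "?mix B u v \<in> A \<rightarrow> S" using insert.prems by auto
      have "?mix (insert a B) u v = ?mix {a} u (?mix B u v)" by auto
      then show ?case using N[OF _ _ m, of a u] insert by simp
    qed simp
    then have "y (?mix A (\<lambda>_. zero) (\<lambda>_. one)) = y (\<lambda>_. one)"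
      using A zero_in one_in by auto
    moreover have "y (?mix A (\<lambda>_. zero) (\<lambda>_. one)) = y (\<lambda>_. zero)" by (rule cong) simp
    ultimately show False using y_const one_neq_zero by simp
  qed
  then obtain a where a: "a \<in> A" and F: "\<And>u v. u \<in> A \<rightarrow> S \<Longrightarrow> v \<in> A \<rightarrow> S \<Longrightarrow> y (?mix {a} u v) = y u"
    by blast
  define \<alpha> where "\<alpha> s = y (\<lambda>_. s)" for s
  have \<alpha>_in: "\<alpha> s \<in> S" if "s \<in> S" for s using that by (auto simp: \<alpha>_def intro!: y_in)
  have y_\<alpha>: "y x = \<alpha> (x a)" if x: "x \<in> A \<rightarrow> S" for x
  proof -
    \<comment> \<open>Replacing every coordinate other than \<open>a\<close> by \<open>x a\<close>
      does not change \<open>y x\<close> and makes the argument constant.\<close>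
    have "?mix {a} x (\<lambda>_. x a) = (\<lambda>_. x a)" by auto
    then show ?thesis using F[OF x, of "\<lambda>_. x a"] Pi_mem[OF x a] by (simp add: \<alpha>_def)
  qed
  have \<alpha>_inj: "s = t" if "s \<in> S" "t \<in> S" "\<alpha> s = \<alpha> t" for s t
  proof (rule ccontr)
    assume "s \<noteq> t"
    then have "one = y (\<lambda>_. ?sw s t zero one)" using y_const by simp
    also have "\<dots> = ?sw (\<alpha> s) (\<alpha> t) zero one"
      using y_sw[of "\<lambda>_. s" "\<lambda>_. t" "\<lambda>_. zero" "\<lambda>_. one"] that zero_in one_in y_const by (simp add: \<alpha>_def)
    finally show False using that one_neq_zero by simp
  qed
  have \<alpha>_p: "\<alpha> (p n s) = p n (\<alpha> s)" if "s \<in> S" for n s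
    using y_p[of "\<lambda>_. s" n] that by (simp add: \<alpha>_def)
  have \<alpha>_tail: "\<alpha> (tail_rep s) = tail_rep (\<alpha> s)" if "s \<in> S" for s
    using hom[of "\<lambda>_. s" 3] that by (simp add: \<alpha>_def base_def)
  text \<open>The orbit of \<open>s\<close> and its image under \<open>\<alpha>\<close> have the same tails, so \<open>\<alpha>\<close> fixes the chosen
    representative of their tail class.\<close>
  have "\<alpha> s = s" if s: "s \<in> S" for s
  proof -
    define f where "f n = (\<alpha> ^^ n) s" for n
    have f: "f n \<in> S" for n by (induction n) (auto simp: f_def s \<alpha>_in)
    have fS: "f (Suc n) = \<alpha> (f n)" for n by (simp add: f_def)
    let ?z = "c f"
    have z: "?z \<in> S" by (rule c_in[OF f])
    have pz: "p n ?z = f n" for n by (rule p_c[OF f])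
    have p\<alpha>z: "p n (\<alpha> ?z) = f (Suc n)" for n using \<alpha>_p[OF z] by (simp add: pz fS)
    have "tail_class (\<alpha> ?z) = tail_class ?z"
    proof -
      have "(\<exists>m n. \<forall>i. f (Suc (m + i)) = r (n + i)) \<longleftrightarrow> (\<exists>m n. \<forall>i. f (m + i) = r (n + i))" for r
      proof
        assume "\<exists>m n. \<forall>i. f (Suc (m + i)) = r (n + i)"
        then obtain m n where "\<And>i. f (Suc (m + i)) = r (n + i)" by blast
        then have "\<forall>i. f (Suc m + i) = r (n + i)" by simp
        then show "\<exists>m n. \<forall>i. f (m + i) = r (n + i)" by blast
      next
        assume "\<exists>m n. \<forall>i. f (m + i) = r (n + i)"
        then obtain m n where mn: "\<And>i. f (m + i) = r (n + i)" by blast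
        have "\<forall>i. f (Suc (m + i)) = r (Suc n + i)" using mn[of "Suc _"] by simp
        then show "\<exists>m n. \<forall>i. f (Suc (m + i)) = r (n + i)" by blast
      qed
      then show ?thesis by (simp add: tail_class_def pz p\<alpha>z)
    qed
    then have fixed: "\<alpha> (tail_rep ?z) = tail_rep ?z"
      using \<alpha>_tail[OF z] by (simp add: tail_rep_def)
    obtain r where r: "r \<in> tail_class ?z" and w: "tail_rep ?z = c r" using tail_rep_class[OF z] .
    then have rS: "r i \<in> S" for i by (simp add: tail_class_def)
    obtain m n where mn: "\<And>i. f (m + i) = r (n + i)" using r by (auto simp: tail_class_def pz)
    \<comment> \<open>\<alpha> fixes the code of \<open>r\<close> and commutes with the projections,
      so it fixes every entry of \<open>r\<close>.\<close>
    have "\<alpha> (r n) = r n"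
      using \<alpha>_p[OF c_in[of r, OF rS], of n] fixed p_c[of r n, OF rS] by (simp add: w)
    then have "\<alpha> (f m) = f m" using mn[of 0] by simp
    \<comment> \<open>The orbit is stationary from \<open>m\<close> on; injectivity of \<alpha>
      carries this back to its start.\<close>
    then have "\<alpha> (f 0) = f 0"
    proof (induction m)
      case (Suc m)
      then show ?case using \<alpha>_inj[OF \<alpha>_in[OF f] f, of m] by (simp add: fS)
    qed
    then show ?thesis by (simp add: f_def)
  qed
  then show ?thesis using a y_\<alpha> by (intro bexI[of _ a]) auto
qed

section \<open>Equivariant maps from a power into an extension\<close>

lemma Proj_loops: "Proj \<infinity> i \<in> loops" "Proj' (Suc i) i \<in> loops"
  by (auto simp: loops_def)

text \<open>Let \<open>u\<close> be the value at the point \<open>xs\<close> of maximal support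
  size. A small support of the value at the pair of \<open>xs\<close> and \<open>x\<close> consists
  of coded pairs. Read as a graph from first to second halves, it tells how to rewrite
  \<open>u\<close> into the value at \<open>x\<close>, and the dependence of this graph on
  \<open>x\<close> is equivariant.\<close>

theorem equivariantly_projective_ops: equivariantly_projective
  unfolding equivariantly_projective_def
proof (intro allI impI)
  fix G and A :: "'u set" and \<phi> :: "('u \<Rightarrow> 'u) \<Rightarrow> 'u"
  assume G: "G \<in> Obj IC" and A: "fs A" and \<phi>0: "\<forall>x\<in>A \<rightarrow> S. \<phi> x \<in> ext G"
    and cong0: "\<forall>x y. (\<forall>i\<in>A. x i = y i) \<longrightarrow> \<phi> x = \<phi> y"
    and eq: "\<forall>e\<in>loops. \<forall>x\<in>A \<rightarrow> S. \<phi> (\<lambda>i. ops e (x i)) = emap G (ops e) (\<phi> x)"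
  have \<phi>: "\<phi> x \<in> ext G" if "x \<in> A \<rightarrow> S" for x using \<phi>0 that by blast
  have cong: "\<phi> x = \<phi> y" if "\<And>i. i \<in> A \<Longrightarrow> x i = y i" for x y using cong0 that by blast
  have \<phi>_base: "\<phi> (\<lambda>i. base k (x i)) = emap G (base k) (\<phi> x)" if "x \<in> A \<rightarrow> S" for k x
    using eq[rule_format, OF Proj_loops(1) that, of k] by simp
  have \<phi>_par: "\<phi> (\<lambda>i. par (base k) (x i)) = emap G (par (base k)) (\<phi> x)" if "x \<in> A \<rightarrow> S" for k x
    using eq[rule_format, OF Proj_loops(2) that, of k] by simp
  have \<phi>_p: "\<phi> (\<lambda>i. p n (x i)) = emap G (p n) (\<phi> x)" if "x \<in> A \<rightarrow> S" for n x
    using \<phi>_base[OF that, of "n + 4"] by (simp add: base_def)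
  have pS: "p n \<in> S \<rightarrow> S" for n by (simp add: p_in)
  have "\<exists>N. \<forall>x. x \<in> A \<rightarrow> S \<longrightarrow> msupp G (\<phi> x) \<le> N"
  proof (rule ccontr)
    assume "\<not> ?thesis"
    then have "\<forall>N. \<exists>x. x \<in> A \<rightarrow> S \<and> N < msupp G (\<phi> x)" by (meson not_le)
    then obtain X where X: "\<And>N. X N \<in> A \<rightarrow> S" "\<And>N. N < msupp G (\<phi> (X N))" by metis
    \<comment> \<open>A sequence of points with unbounded support sizes would consist of projections
      of the one point \<open>?z\<close>, whose own support bounds them all.\<close>
    let ?z = "\<lambda>i. c (\<lambda>n. X n i)"
    have z: "?z \<in> A \<rightarrow> S" using X(1) by (auto intro!: c_in)
    have "msupp G (\<phi> (X n)) \<le> msupp G (\<phi> ?z)" for n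
    proof -
      have "\<phi> (X n) = \<phi> (\<lambda>i. p n (?z i))"
        by (rule cong) (use X(1) in \<open>auto intro!: p_c[symmetric]\<close>)
      also have "\<dots> = emap G (p n) (\<phi> ?z)" by (rule \<phi>_p[OF z])
      finally show ?thesis using msupp_emap[OF G \<phi>[OF z] pS] by simp
    qed
    then show False using X(2)[of "msupp G (\<phi> ?z)"] by (meson not_le)
  qed
  then obtain N where N: "\<And>x. x \<in> A \<rightarrow> S \<Longrightarrow> msupp G (\<phi> x) \<le> N" by blast
  \<comment> \<open>Bounded sizes attain a maximum; the rule asks for a strict bound, hence
    \<open>Suc N\<close>.\<close>
  have "\<exists>x. x \<in> A \<rightarrow> S \<and> (\<forall>y. y \<in> A \<rightarrow> S \<longrightarrow> msupp G (\<phi> y) \<le> msupp G (\<phi> x))"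
    by (rule Lattices_Big.ex_has_greatest_nat[of _ "\<lambda>_. zero" _ "Suc N"]) (auto simp: zero_in less_Suc_eq_le N)
  then obtain xs where xs: "xs \<in> A \<rightarrow> S" and max: "\<And>x. x \<in> A \<rightarrow> S \<Longrightarrow> msupp G (\<phi> x) \<le> msupp G (\<phi> xs)"
    by blast
  define u where "u = \<phi> xs"
  define K where "K = msupp G u"
  have u: "u \<in> ext G" unfolding u_def by (rule \<phi>[OF xs])
  have Kmin: "K \<le> card B" if "supp G u B" for B unfolding K_def by (rule msupp_le[OF that])
  \<comment> \<open>Pairing with \<open>xs\<close> keeps the maximal size: the value at
    \<open>Z x\<close> is mapped onto \<open>u\<close> and so needs at least \<open>K\<close>
    points, and by the choice of \<open>xs\<close> it needs no more.\<close>
  define Z where "Z x = (\<lambda>i. pair (xs i) (x i))" for x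
  have Z: "Z x \<in> A \<rightarrow> S" if "x \<in> A \<rightarrow> S" for x using that xs by (auto simp: Z_def intro!: pair_in)
  have Z0: "emap G (p 0) (\<phi> (Z x)) = u" if x: "x \<in> A \<rightarrow> S" for x
  proof -
    have "\<phi> (\<lambda>i. p 0 (Z x i)) = u"
      unfolding u_def by (rule cong) (simp add: Z_def p_pair Pi_mem[OF x] Pi_mem[OF xs])
    then show ?thesis using \<phi>_p[OF Z[OF x]] by simp
  qed
  have Z1: "emap G (p 1) (\<phi> (Z x)) = \<phi> x" if x: "x \<in> A \<rightarrow> S" for x
  proof -
    have "\<phi> (\<lambda>i. p 1 (Z x i)) = \<phi> x"
      by (rule cong) (simp add: Z_def p_pair(2)[unfolded One_nat_def] Pi_mem[OF x] Pi_mem[OF xs])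
    then show ?thesis using \<phi>_p[OF Z[OF x]] by simp
  qed
  \<comment> \<open>The support is chosen as a function of the value and not of \<open>x\<close>, so
    it depends only on \<open>x\<close> restricted to \<open>A\<close>.\<close>
  define EE where "EE v = (SOME E. supp G v E \<and> card E \<le> K)" for v
  have EE: "supp G (\<phi> (Z x)) (EE (\<phi> (Z x)))" "card (EE (\<phi> (Z x))) \<le> K" if x: "x \<in> A \<rightarrow> S" for x
  proof -
    have "\<exists>E. supp G (\<phi> (Z x)) E \<and> card E \<le> K"
      using msupp_ex[OF G \<phi>[OF Z[OF x]]] max[OF Z[OF x]] by (auto simp: K_def u_def)
    from someI_ex[OF this] show "supp G (\<phi> (Z x)) (EE (\<phi> (Z x)))" "card (EE (\<phi> (Z x))) \<le> K"
      by (auto simp: EE_def)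
  qed
  \<comment> \<open>If \<open>r\<close> follows the graph \<open>EE\<close>, then \<open>r\<close>
    after \<open>p 0\<close> agrees with \<open>p 1\<close> on a support of the value at
    \<open>Z x\<close>. One of them yields \<open>emap G r u\<close>, the other \<phi>
    \<open>x\<close>.\<close>
  have r_eq: "\<phi> x = emap G r u" if x: "x \<in> A \<rightarrow> S" and r: "r \<in> S \<rightarrow> S"
    and e: "\<And>e. e \<in> EE (\<phi> (Z x)) \<Longrightarrow> r (p 0 e) = p 1 e" for x r
  proof -
    have rp: "(\<lambda>s. r (p 0 s)) \<in> S \<rightarrow> S" using r p_in by auto
    have "emap G r u = emap G (\<lambda>s. r (p 0 s)) (\<phi> (Z x))"
      unfolding Z0[OF x, symmetric] by (rule emap_emap[OF G \<phi>[OF Z[OF x]] r pS])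
    also have "\<dots> = emap G (p 1) (\<phi> (Z x))"
      by (rule emap_cong[OF G EE(1)[OF x] rp pS e])
    finally show ?thesis using Z1[OF x] by simp
  qed
  show "\<exists>g\<in>omap G A. \<forall>x\<in>A \<rightarrow> S. \<phi> x = br G A x g"
  proof (cases "\<forall>s\<in>S. supp G u {s}")
    case True
    \<comment> \<open>Degenerate case: \<open>u\<close> is supported by every single point, hence
      unchanged by each self-map of \<open>S\<close> that has a fixed point.\<close>
    have const: "emap G r u = u" if r: "r \<in> S \<rightarrow> S" and s: "s \<in> S" "r s = s" for r s
      by (rule emap_fixes[OF G True[rule_format, OF s(1)] r]) (use s in auto)
    have \<phi>u: "\<phi> x = u" if x: "x \<in> A \<rightarrow> S" for x
    proof -
      have "K \<le> 1" using Kmin[OF True[rule_format, OF zero_in]] by simp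
      then have "card (EE (\<phi> (Z x))) = 1"
        using EE(2)[OF x] supp_fs[OF EE(1)[OF x]] by (metis card_0_eq le_antisym le_trans less_one not_le)
      then obtain e where e: "EE (\<phi> (Z x)) = {e}" by (rule card_1_singletonE)
      have eS: "e \<in> S" using supp_subset[OF EE(1)[OF x]] e by simp
      \<comment> \<open>At most the point \<open>p 0 e\<close> is moved, so the different point
        \<open>t\<close> is fixed and \<open>const\<close> applies.\<close>
      let ?r = "\<lambda>s. if s = p 0 e then p 1 e else s"
      obtain t where t: "t \<in> S" "t \<noteq> p 0 e" using zero_in one_in one_neq_zero by metis
      have r: "?r \<in> S \<rightarrow> S" using eS p_in by auto
      show ?thesis using r_eq[OF x r] const[OF r t(1)] t(2) e by simp
    qed
    obtain g0 where g0: "rep G {zero} (\<lambda>i. i) g0" "u = br G {zero} (\<lambda>i. i) g0"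
      using True zero_in by (blast elim: suppE)
    obtain a0 where a0: "a0 \<in> A" using A by blast
    have g: "g0 \<in> omap G {zero}" using g0 by (simp add: rep_def)
    show ?thesis
    proof (intro bexI[of _ "push G {zero} A (\<lambda>_. a0) g0"] ballI)
      show "push G {zero} A (\<lambda>_. a0) g0 \<in> omap G A"
        by (rule push_in[OF G _ A _ g]) (use a0 in auto)
      fix x assume x: "x \<in> A \<rightarrow> S"
      then have xa: "x a0 \<in> S" using a0 by auto
      have cS: "(\<lambda>_. x a0) \<in> S \<rightarrow> S" using xa by auto
      have "br G A x (push G {zero} A (\<lambda>_. a0) g0) = br G {zero} (\<lambda>_. x a0) g0"
        using br_push[OF G _ g A _ x, of "\<lambda>_. a0"] a0 by simp
      also have "\<dots> = emap G (\<lambda>_. x a0) u"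
        unfolding g0(2) using emap_br[OF G cS g0(1)] by simp
      also have "\<dots> = u" by (rule const[OF cS xa refl])
      finally show "\<phi> x = br G A x (push G {zero} A (\<lambda>_. a0) g0)" using \<phi>u[OF x] by simp
    qed
  next
    case False
    obtain B where B: "supp G u B" "card B = K" using msupp_ex[OF G u] by (auto simp: K_def)
    obtain g0 where g0: "rep G B (\<lambda>i. i) g0" "u = br G B (\<lambda>i. i) g0" by (rule suppE[OF B(1)])
    \<comment> \<open>Some singleton is not a support of \<open>u\<close>, which rules out the
      degenerate outcome of \<open>minimal_supp_unique\<close>.\<close>
    have uniq: "E = B" if "supp G u E" "card E \<le> K" for E
      using minimal_supp_unique[OF G that B(1)] B(2) Kmin False by auto
    have p0: "p 0 ` EE (\<phi> (Z x)) = B" "inj_on (p 0) (EE (\<phi> (Z x)))" if x: "x \<in> A \<rightarrow> S" for x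
    proof -
      have fin: "finite (EE (\<phi> (Z x)))" using supp_fs[OF EE(1)[OF x]] by simp
      have s: "supp G u (p 0 ` EE (\<phi> (Z x)))"
        using supp_emap[OF G EE(1)[OF x] pS, of 0] Z0[OF x] by simp
      have "card (p 0 ` EE (\<phi> (Z x))) \<le> K"
        using card_image_le[OF fin, of "p 0"] EE(2)[OF x] by simp
      then show eq: "p 0 ` EE (\<phi> (Z x)) = B" by (rule uniq[OF s])
      show "inj_on (p 0) (EE (\<phi> (Z x)))"
        using card_image_le[OF fin, of "p 0"] EE(2)[OF x] B(2) eq by (intro eq_card_imp_inj_on[OF fin]) simp
    qed
    \<comment> \<open>\<open>EE\<close> now projects bijectively onto \<open>B\<close>, so it is the
      graph of a function on \<open>B\<close>, and \<open>y b x\<close> is its value at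
      \<open>b\<close>.\<close>
    define y where "y b x = p 1 (inv_into (EE (\<phi> (Z x))) (p 0) b)" for b x
    have yp: "y (p 0 e) x = p 1 e" if "x \<in> A \<rightarrow> S" "e \<in> EE (\<phi> (Z x))" for e x
      using inv_into_f_f[OF p0(2)[OF that(1)] that(2)] by (simp add: y_def)
    have "\<exists>a\<in>A. \<forall>x\<in>A \<rightarrow> S. y b x = x a" if b: "b \<in> B" for b
    proof (rule equivariant_projection[OF A])
      have ee: "\<exists>e. e \<in> EE (\<phi> (Z x)) \<and> p 0 e = b" if "x \<in> A \<rightarrow> S" for x
        using p0(1)[OF that] b by blast
      show "y b x \<in> S" if x: "x \<in> A \<rightarrow> S" for x
        using ee[OF x] yp[OF x] supp_subset[OF EE(1)[OF x]] p_in by (metis subsetD)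
      show "y b x = y b x'" if "\<And>i. i \<in> A \<Longrightarrow> x i = x' i" for x x'
      proof -
        have "\<phi> (Z x) = \<phi> (Z x')" by (rule cong) (simp add: Z_def that)
        then show ?thesis by (simp add: y_def)
      qed
      fix k x assume x: "x \<in> A \<rightarrow> S"
      \<comment> \<open>Applying \<open>base k\<close> to \<open>x\<close> amounts to applying
        \<open>?W\<close> to \<open>Z x\<close>. Since \<open>?W\<close> keeps first halves, the
        image of the old graph is a candidate for the new one, and uniqueness of small supports has
        to identify the two.\<close>
      let ?x' = "\<lambda>i. base k (x i)" and ?W = "par (base k)"
      have x': "?x' \<in> A \<rightarrow> S" using x base_in[of k] by auto
      have W: "?W \<in> S \<rightarrow> S" by (rule par_in[OF base_in])
      have "\<phi> (Z ?x') = \<phi> (\<lambda>i. ?W (Z x i))"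
        by (rule cong) (simp add: Z_def par_def p_pair(1) p_pair(2)[unfolded One_nat_def] Pi_mem[OF x] Pi_mem[OF xs])
      then have v': "\<phi> (Z ?x') = emap G ?W (\<phi> (Z x))" using \<phi>_par[OF Z[OF x]] by simp
      have sW: "supp G (\<phi> (Z ?x')) (?W ` EE (\<phi> (Z x)))"
        unfolding v' by (rule supp_emap[OF G EE(1)[OF x] W])
      have cW: "card (?W ` EE (\<phi> (Z x))) \<le> K"
        using card_image_le[of "EE (\<phi> (Z x))" ?W] supp_fs[OF EE(1)[OF x]] EE(2)[OF x] by simp
      have p0s: "supp G u (p 0 ` D)" if "supp G (\<phi> (Z ?x')) D" for D
        using supp_emap[OF G that pS, of 0] Z0[OF x'] by simp
      have "EE (\<phi> (Z ?x')) = ?W ` EE (\<phi> (Z x))"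
      proof (rule ccontr)
        assume ne: "EE (\<phi> (Z ?x')) \<noteq> ?W ` EE (\<phi> (Z x))"
        have min: "K \<le> card D" if "supp G (\<phi> (Z ?x')) D" for D
          using Kmin[OF p0s[OF that]] card_image_le[of D "p 0"] supp_fs[OF that] by simp
        \<comment> \<open>Two different small supports would make the singleton of
          \<open>pair s s\<close> a support of the value at \<open>Z ?x'\<close>; its projection
          along \<open>p 0\<close> would be a support of \<open>u\<close>, for every
          \<open>s\<close>.\<close>
        have "supp G u {s}" if s: "s \<in> S" for s
          using p0s[OF minimal_supp_unique[OF G EE[OF x'] sW cW min ne pair_in[OF s s]]]
          by (simp add: p_pair(1) s)
        then show False using False by blast
      qed
      moreover obtain e where e: "e \<in> EE (\<phi> (Z x))" "p 0 e = b" using ee[OF x] by blast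
      ultimately have We: "?W e \<in> EE (\<phi> (Z ?x'))" by simp
      have eS: "e \<in> S" using e supp_subset[OF EE(1)[OF x]] by blast
      have "base k (p 1 e) \<in> S" using base_in[of k] p_in[OF eS] by auto
      then have "p 0 (?W e) = b" "p 1 (?W e) = base k (p 1 e)"
        using p_pair[OF p_in[OF eS, of 0]] e by (simp_all add: par_def)
      then show "y b ?x' = base k (y b x)"
        using yp[OF x' We] yp[OF x e(1)] e(2) by simp
    qed
    then obtain \<pi> where \<pi>: "\<And>b. b \<in> B \<Longrightarrow> \<pi> b \<in> A" "\<And>b x. b \<in> B \<Longrightarrow> x \<in> A \<rightarrow> S \<Longrightarrow> y b x = x (\<pi> b)"
      by metis
    have g: "g0 \<in> omap G B" "fs B" using g0 by (simp_all add: rep_def)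
    show ?thesis
    proof (intro bexI[of _ "push G B A \<pi> g0"] ballI)
      show "push G B A \<pi> g0 \<in> omap G A"
        by (rule push_in[OF G g(2) A _ g(1)]) (use \<pi>(1) in auto)
      fix x assume x: "x \<in> A \<rightarrow> S"
      \<comment> \<open>On \<open>B\<close> this is \<open>x\<close> after \<pi>, which is the graph
        \<open>EE\<close>; the identity off \<open>B\<close> merely keeps the values in
        \<open>S\<close>.\<close>
      let ?r = "\<lambda>s. if s \<in> B then x (\<pi> s) else s"
      have r: "?r \<in> S \<rightarrow> S" using Pi_mem[OF x \<pi>(1)] by simp
      have "\<phi> x = emap G ?r u"
      proof (rule r_eq[OF x r])
        fix e assume e: "e \<in> EE (\<phi> (Z x))"
        then have "p 0 e \<in> B" using p0(1)[OF x] by blast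
        then show "?r (p 0 e) = p 1 e" using yp[OF x e] \<pi>(2)[OF _ x] by simp
      qed
      also have "\<dots> = br G B ?r g0" unfolding g0(2) by (rule emap_br[OF G r g0(1)])
      also have "\<dots> = br G B (\<lambda>b. x (\<pi> b)) g0" by (rule br_cong) simp
      also have "\<dots> = br G A x (push G B A \<pi> g0)"
        by (rule br_push[OF G g(2,1) A _ x]) (use \<pi>(1) in auto)
      finally show "\<phi> x = br G A x (push G B A \<pi> g0)" .
    qed
  qed
qed

end


section \<open>Large rigid objects\<close>

lemma isomorphic_car_lepoll:
  assumes "isomorphic ET X Y" shows "car X \<lesssim> car Y"
proof -
  obtain f g where f: "f \<in> Hom ET X Y" and g: "g \<in> Hom ET Y X" and gf: "Comp ET g f = Ide ET X"
    using assms unfolding isomorphic_def by blast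
  have "app g V (app f V v) = v" if "v \<in> car X" for v
    using ET_app_Comp[OF f g that] ET_app_Ide[OF that] gf by simp
  then have "inj_on (app f V) (car X)" by (metis inj_onI)
  moreover have "app f V ` car X \<subseteq> car Y" using ET_app_in[OF f] by auto
  ultimately show ?thesis unfolding lepoll_def by blast
qed

context inaccessible_universe
begin

text \<open>Sequences of sequences in \<open>T'\<close> are double sequences, and a bijection of
  pairs of numbers with numbers reindexes them as sequences. Hence the set of sequences in
  \<open>T'\<close> is in bijection with the set of sequences in itself.\<close>

lemma coded_carrier_exists:
  fixes T :: "'u set"
  assumes T: "small TYPE('u) T"
  obtains S :: "'u set" and c p where "coded_carrier S c p" "T \<lesssim> S"
proof -
  \<comment> \<open>Two distinct extra points make the set of sequences infinite even when
    \<open>T\<close> has at most one element.\<close>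
  obtain a b :: 'u where ab: "a \<noteq> b"
    using infinite_universe by (metis (full_types) UNIV_eq_I finite.simps singleton_iff)
  define T' where "T' = T \<union> {a, b}"
  define Q where "Q = ((UNIV :: nat set) \<rightarrow>\<^sub>E T')"
  have "small TYPE('u) T'"
    unfolding T'_def using small_UN[of "UNIV :: bool set" "\<lambda>x. if x then T else {a, b}"] T
    by (auto simp: small_finite UNIV_bool Un_commute)
  then have Q: "small TYPE('u) Q"
    unfolding Q_def by (intro small_PiE[OF small_countable]) auto
  let ?e = "code Q :: (nat \<Rightarrow> 'u) \<Rightarrow> 'u" and ?d = "decode Q :: 'u \<Rightarrow> nat \<Rightarrow> 'u"
  let ?S = "?e ` Q"
  have Q_iff: "f \<in> Q \<longleftrightarrow> (\<forall>n. f n \<in> T')" for f by (auto simp: Q_def)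
  have dQ: "?d s n \<in> T'" if "s \<in> ?S" for s n using decode_in[OF that] by (simp add: Q_iff)
  define c where "c f = ?e (\<lambda>n. ?d (f (fst (prod_decode n))) (snd (prod_decode n)))" for f
  define p where "p i s = ?e (\<lambda>m. ?d s (prod_encode (i, m)))" for i s
  have "coded_carrier ?S c p"
  proof unfold_locales
    show "small TYPE('u) ?S" by (rule small_image[OF Q])
    have "inj (\<lambda>n m :: nat. if m = n then a else b)"
      by (rule injI) (metis ab)
    then have "infinite (range (\<lambda>n m :: nat. if m = n then a else b))"
      by (rule range_inj_infinite)
    moreover have "range (\<lambda>n m :: nat. if m = n then a else b) \<subseteq> Q" by (auto simp: Q_iff T'_def)
    ultimately have "infinite Q" using finite_subset by blast
    then show "infinite ?S" using finite_imageD[OF _ inj_code[OF Q]] by blast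
  next
    fix f assume f: "\<And>n :: nat. f n \<in> ?S"
    have q: "(\<lambda>n. ?d (f (fst (prod_decode n))) (snd (prod_decode n))) \<in> Q"
      using dQ[OF f] by (simp add: Q_iff)
    then show "c f \<in> ?S" by (simp add: c_def)
    show "p n (c f) = f n" for n
      using decode_code[OF Q q] code_decode[OF f] by (simp add: p_def c_def)
  next
    fix s n assume s: "s \<in> ?S"
    have q: "(\<lambda>m. ?d s (prod_encode (n, m))) \<in> Q" for n using dQ[OF s] by (simp add: Q_iff)
    then show "p n s \<in> ?S" by (simp add: p_def)
    show "c (\<lambda>n. p n s) = s"
      using decode_code[OF Q q] code_decode[OF s] by (simp add: p_def c_def)
  qed
  moreover have "T \<lesssim> ?S"
    unfolding lepoll_def
  proof (intro exI conjI)
    have k: "(\<lambda>_. t) \<in> Q" if "t \<in> T" for t using that by (simp add: Q_iff T'_def)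
    show "inj_on (\<lambda>t. ?e (\<lambda>_. t)) T"
      by (rule inj_onI) (simp add: code_inject[OF Q k k] fun_eq_iff)
    show "(\<lambda>t. ?e (\<lambda>_. t)) ` T \<subseteq> ?S" using k by blast
  qed
  ultimately show thesis by (rule that)
qed

lemma large_rigid_object:
  fixes T :: "'u set"
  assumes "small TYPE('u) T"
  obtains X :: "'u eobj" where "inhabited_topos_rigid TYPE('u) ET X" "T \<lesssim> car X"
proof -
  obtain S c p where S: "coded_carrier S c p" and T: "T \<lesssim> (S :: 'u set)"
    using coded_carrier_exists[OF assms] .
  interpret coded_carrier U S c p by (rule S)
  show thesis
    using that[OF rigid_pull(1)[OF equivariantly_projective_ops]]
      lepoll_trans[OF T rigid_pull(2)[OF equivariantly_projective_ops]] by blast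
qed

text \<open>Cantor's theorem for the union \<open>?W\<close> of the carriers of the supposed
  representatives: a rigid object at least as large as the power set of \<open>?W\<close> is
  isomorphic to none of them.\<close>

lemma proper_class_rigid:
  "proper_class_many TYPE('u) {X :: 'u eobj. inhabited_topos_rigid TYPE('u) ET X} (isomorphic ET)"
  unfolding proper_class_many_def
proof
  let ?K = "{X :: 'u eobj. inhabited_topos_rigid TYPE('u) ET X}"
  assume "\<exists>S. S \<subseteq> ?K \<and> small TYPE('u) S \<and> (\<forall>x\<in>?K. \<exists>y\<in>S. isomorphic ET x y)"
  then obtain S where S: "S \<subseteq> ?K" "small TYPE('u) S" "\<And>X. X \<in> ?K \<Longrightarrow> \<exists>Y\<in>S. isomorphic ET X Y"
    by blast
  have "small TYPE('u) (car X)" if "X \<in> S" for X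
    using that S(1) loop.small_omap[of X V] by (auto simp: inhabited_topos_rigid_def ET_Sets)
  then have W: "small TYPE('u) (\<Union>X\<in>S. car X)" by (rule small_UN[OF S(2)])
  let ?W = "\<Union>X\<in>S. car X"
  have P: "small TYPE('u) (Pow ?W)" by (rule small_Pow[OF W])
  obtain X where X: "X \<in> ?K" and le: "(code (Pow ?W) ` Pow ?W :: 'u set) \<lesssim> car X"
    using large_rigid_object[OF small_image[OF P]] by blast
  obtain Y where Y: "Y \<in> S" "isomorphic ET X Y" using S(3)[OF X] by blast
  have "Pow ?W \<lesssim> (code (Pow ?W) ` Pow ?W :: 'u set)"
    by (rule eqpoll_imp_lepoll[OF eqpoll_sym[OF code_eqpoll[OF P]]])
  then have "Pow ?W \<lesssim> car Y"
    using lepoll_trans[OF lepoll_trans[OF _ le] isomorphic_car_lepoll[OF Y(2)]] by blast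
  moreover have "car Y \<lesssim> ?W" by (rule subset_imp_lepoll) (use Y(1) in blast)
  ultimately have "Pow ?W \<lesssim> ?W" by (rule lepoll_trans)
  then show False using lesspoll_trans1[OF _ lesspoll_Pow_self] by blast
qed

end


section \<open>Quotient topoi of rigid objects\<close>

lemma isomorphic_sym: "isomorphic C a b \<Longrightarrow> isomorphic C b a"
  unfolding isomorphic_def by blast

lemma isomorphic_trans:
  assumes C: "category C" and ab: "isomorphic C a b" and bc: "isomorphic C b c"
  shows "isomorphic C a c"
proof -
  obtain f g where f: "f \<in> Hom C a b" and g: "g \<in> Hom C b a" and gf: "Comp C g f = Ide C a" "Comp C f g = Ide C b"
    using ab unfolding isomorphic_def by blast
  obtain h k where h: "h \<in> Hom C b c" and k: "k \<in> Hom C c b" and kh: "Comp C k h = Ide C b" "Comp C h k = Ide C c"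
    using bc unfolding isomorphic_def by blast
  note comp = categoryD(4)[OF C] and assoc = categoryD(7)[OF C]
  have "Comp C (Comp C g k) (Comp C h f) = Comp C g (Comp C (Comp C k h) f)"
    using assoc[OF f h k] assoc[OF comp[OF f h] k g] by simp
  then have "Comp C (Comp C g k) (Comp C h f) = Ide C a"
    using kh gf categoryD(6)[OF C f] by simp
  moreover have "Comp C (Comp C h f) (Comp C g k) = Comp C h (Comp C (Comp C f g) k)"
    using assoc[OF k g f] assoc[OF comp[OF k g] f h] by simp
  then have "Comp C (Comp C h f) (Comp C g k) = Ide C c"
    using kh gf categoryD(6)[OF C k] by simp
  ultimately show ?thesis
    using comp[OF f h] comp[OF k g] ab bc unfolding isomorphic_def by blast
qed

lemma isomorphic_functor:
  assumes F: "is_functor C D F" and ab: "isomorphic C a b"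
  shows "isomorphic D (omap F a) (omap F b)"
proof -
  obtain f g where f: "f \<in> Hom C a b" and g: "g \<in> Hom C b a" and gf: "Comp C g f = Ide C a" "Comp C f g = Ide C b"
    and o: "a \<in> Obj C" "b \<in> Obj C"
    using ab unfolding isomorphic_def by blast
  have "Comp D (amap F g) (amap F f) = Ide D (omap F a)" "Comp D (amap F f) (amap F g) = Ide D (omap F b)"
    using functorD(4)[OF F f g] functorD(4)[OF F g f] functorD(3)[OF F] gf o by simp_all
  then show ?thesis
    using functorD(1,2)[OF F] f g o unfolding isomorphic_def by blast
qed

lemma Hom_functor_category_nat_trans:
  "f \<in> Hom (functor_category C D) P Q \<Longrightarrow> is_nat_trans C D P Q (body f)"
  by (auto simp: Hom_def functor_category_def)

lemma isomorphic_component: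
  assumes "isomorphic (functor_category C D) P Q" and c: "c \<in> Obj C"
  shows "isomorphic D (omap P c) (omap Q c)"
proof -
  let ?FC = "functor_category C D"
  obtain f g where f: "f \<in> Hom ?FC P Q" and g: "g \<in> Hom ?FC Q P" and gf: "Comp ?FC g f = Ide ?FC P"
    "Comp ?FC f g = Ide ?FC Q" and PQ: "is_functor C D P" "is_functor C D Q"
    using assms(1) unfolding isomorphic_def by (auto simp: functor_category_def)
  have "body f c \<in> Hom D (omap P c) (omap Q c)" "body g c \<in> Hom D (omap Q c) (omap P c)"
    using Hom_functor_category_nat_trans[OF f] Hom_functor_category_nat_trans[OF g] c
    by (simp_all add: is_nat_trans_def PiE_iff)
  moreover have "Comp D (body g c) (body f c) = Ide D (omap P c)" "Comp D (body f c) (body g c) = Ide D (omap Q c)"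
    using gf c by (auto simp: functor_category_def dest!: fun_cong[where x = c])
  ultimately show ?thesis
    using functorD(1)[OF PQ(1) c] functorD(1)[OF PQ(2) c] unfolding isomorphic_def by blast
qed

text \<open>A map \<open>a : L G \<rightarrow> X\<close> is recovered from its transpose \<open>R a \<circ> \<eta>\<^sub>G\<close>.\<close>

lemma left_adjoint_maps_eq:
  assumes C: "category C" and D: "category D" and adj: "is_left_adjoint C D L R" and G: "G \<in> Obj C"
    and a: "a \<in> Hom D (omap L G) X" and b: "b \<in> Hom D (omap L G) X"
    and uniq: "\<And>Z h h'. h \<in> Hom C G Z \<Longrightarrow> h' \<in> Hom C G Z \<Longrightarrow> h = h'"
  shows "a = b"
proof -
  have L: "is_functor C D L" and R: "is_functor D C R" using adj by (auto simp: is_left_adjoint_def)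
  obtain \<eta> \<epsilon> where \<eta>: "is_nat_trans C C (id_functor C) (comp_functor C R L) \<eta>"
    and \<epsilon>: "is_nat_trans D D (comp_functor D L R) (id_functor D) \<epsilon>"
    and tri: "\<And>a. a \<in> Obj C \<Longrightarrow> Comp D (\<epsilon> (omap L a)) (amap L (\<eta> a)) = Ide D (omap L a)"
    using adj unfolding is_left_adjoint_def by blast
  have LG: "omap L G \<in> Obj D" by (rule functorD(1)[OF L G])
  have \<eta>G: "\<eta> G \<in> Hom C G (omap R (omap L G))"
    using \<eta> G by (auto simp: is_nat_trans_def id_functor_def comp_functor_def compose_def PiE_iff)
  have \<epsilon>H: "\<epsilon> Y \<in> Hom D (omap L (omap R Y)) Y" if "Y \<in> Obj D" for Y
    using \<epsilon> that by (auto simp: is_nat_trans_def id_functor_def comp_functor_def compose_def PiE_iff)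
  have X: "X \<in> Obj D" by (rule categoryD(9)[OF D a])
  have key: "f = Comp D (\<epsilon> X) (amap L (Comp C (amap R f) (\<eta> G)))" if f: "f \<in> Hom D (omap L G) X" for f
  proof -
    have Rf: "amap R f \<in> Hom C (omap R (omap L G)) (omap R X)" by (rule functorD(2)[OF R f])
    have L\<eta>: "amap L (\<eta> G) \<in> Hom D (omap L G) (omap L (omap R (omap L G)))" by (rule functorD(2)[OF L \<eta>G])
    have LRf: "amap L (amap R f) \<in> Hom D (omap L (omap R (omap L G))) (omap L (omap R X))"
      by (rule functorD(2)[OF L Rf])
    have fA: "f \<in> Arr D" "Dom D f = omap L G" "Cod D f = X" using f by (auto simp: Hom_def)
    have nat: "Comp D (\<epsilon> X) (amap L (amap R f)) = Comp D f (\<epsilon> (omap L G))"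
      using \<epsilon> fA X LG unfolding is_nat_trans_def id_functor_def comp_functor_def compose_def by auto
    have "Comp D (\<epsilon> X) (amap L (Comp C (amap R f) (\<eta> G))) =
        Comp D (\<epsilon> X) (Comp D (amap L (amap R f)) (amap L (\<eta> G)))"
      using functorD(4)[OF L \<eta>G Rf] by simp
    also have "\<dots> = Comp D (Comp D f (\<epsilon> (omap L G))) (amap L (\<eta> G))"
      using categoryD(7)[OF D L\<eta> LRf \<epsilon>H[OF X]] nat by simp
    also have "\<dots> = Comp D f (Ide D (omap L G))"
      using categoryD(7)[OF D L\<eta> \<epsilon>H[OF LG] f] tri[OF G] by simp
    also have "\<dots> = f" by (rule categoryD(5)[OF D f])
    finally show ?thesis by simp
  qed
  have "Comp C (amap R a) (\<eta> G) = Comp C (amap R b) (\<eta> G)"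
    using categoryD(4)[OF C \<eta>G functorD(2)[OF R a]] categoryD(4)[OF C \<eta>G functorD(2)[OF R b]]
    by (rule uniq)
  then show ?thesis using key[OF a] key[OF b] by simp
qed

section \<open>Comparison of two quotients onto the classifier\<close>

context inaccessible_universe
begin

abbreviation UI :: "'u inh_obj" where "UI \<equiv> universal_inh"

text \<open>At a singleton the universal object has only one element; naturality along the inclusion
  of a point determines all other values.\<close>

lemma End_universal:
  assumes \<gamma>: "\<gamma> \<in> Hom IC UI UI" shows "\<gamma> = Ide IC UI"
proof (rule IC_Hom_ext[OF \<gamma> categoryD(3)[OF category_IC universal_Obj]])
  fix A a assume A: "fs A" and "a \<in> omap UI A"
  then have a: "a \<in> A" by (simp add: universal_omap)
  have "app \<gamma> {a} a = a"
    using IC_app_in[OF \<gamma>, of "{a}" a] by (simp add: universal_omap)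
  then have "app \<gamma> A a = a"
    using IC_app_push[OF \<gamma>, of "{a}" A "\<lambda>i. i" a] universal_push[of "{a}" A "\<lambda>i. i" a] A a
    by (simp add: universal_omap)
  then show "app \<gamma> A a = app (Ide IC UI) A a"
    using IC_app_Ide[OF A \<open>a \<in> omap UI A\<close>] by simp
qed

text \<open>An element at \<open>A\<close> can be pushed to an element at a one-point set, and by
  the Yoneda lemma such an element is a map out of the universal object.\<close>

lemma universal_to_nonempty:
  assumes G: "G \<in> Obj IC" and A: "fs A" and g: "g \<in> omap G A"
  shows "\<exists>h. h \<in> Hom IC UI G"
proof -
  let ?pt = "{undefined :: 'u}"
  let ?g = "push G A ?pt (\<lambda>_. undefined) g"
  have g': "?g \<in> omap G ?pt" by (rule push_in[OF G A _ _ g]) auto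
  have "mk_nat finset_inh UI G (\<lambda>A x. push G ?pt A (\<lambda>_. x) ?g) \<in> Hom IC UI G"
  proof (rule mk_nat_IC_Hom[OF universal_Obj G])
    fix A x assume A: "fs A" "x \<in> omap UI A"
    then have x: "x \<in> A" by (simp add: universal_omap)
    show "push G ?pt A (\<lambda>_. x) ?g \<in> omap G A"
      by (rule push_in[OF G _ A(1) _ g']) (use x in auto)
    fix B :: "'u set" and f assume B: "fs B" "f \<in> A \<rightarrow> B"
    show "push G A B f (push G ?pt A (\<lambda>_. x) ?g) = push G ?pt B (\<lambda>_. push UI A B f x) ?g"
      using push_push[OF G _ A(1) B(1) _ B(2) g', of "\<lambda>_. x"] universal_push[OF A(1) B x] x by simp
  qed
  then show ?thesis ..
qed

text \<open>The target is a constant functor with two values. Distinct parallel maps distinguish the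
  universal object from a functor that is empty everywhere.\<close>

lemma two_maps_from_universal:
  obtains Z h h' where "h \<in> Hom IC UI Z" "h' \<in> Hom IC UI Z" "h \<noteq> h'"
proof -
  have sm: "small TYPE('u) (UNIV :: bool set)" by (rule small_finite) simp
  obtain Z where Z: "Z \<in> Obj IC" and om: "\<And>A. fs A \<Longrightarrow> omap Z A = code (UNIV :: bool set) ` UNIV"
    and pu: "\<And>A B f q. fs A \<Longrightarrow> fs B \<Longrightarrow> f \<in> A \<rightarrow> B \<Longrightarrow> q \<in> (UNIV :: bool set) \<Longrightarrow> push Z A B f (code UNIV q) = code UNIV q"
    by (rule mk_fun_IC[of "\<lambda>_. UNIV :: bool set" "\<lambda>_ _ _ q. q"]) (auto simp: sm)
  let ?h = "\<lambda>b :: bool. mk_nat finset_inh UI Z (\<lambda>_ _. code UNIV b)"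
  have h: "?h b \<in> Hom IC UI Z" for b
    by (rule mk_nat_IC_Hom[OF universal_Obj Z]) (simp_all add: om pu)
  have "app (?h True) {undefined :: 'u} undefined \<noteq> app (?h False) {undefined} undefined"
    by (simp add: app_mk_nat_IC universal_omap code_inject[OF sm])
  then have "?h True \<noteq> ?h False" by metis
  then show thesis using that[OF h h] by blast
qed

text \<open>The universal object is sent to \<open>x\<close> by the second equivalence and back to
  \<open>G\<close> by the first. Through \<open>inverse_image g\<close> the image of
  \<open>G\<close> under \<open>f\<close> becomes isomorphic to the image of the universal object
  under \<open>f'\<close>, so a map from the universal object to \<open>G\<close> is all that
  remains.\<close>

lemma map_between_quotients:
  fixes f f' :: "('u eobj, 'u earr, 'u inh_obj, 'u inh_arr) geom"
    and s :: "('u inh_obj, 'u inh_arr) cat \<times> ('u eobj, 'u earr, 'u inh_obj, 'u inh_arr) geom"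
  assumes f: "connected_geometric_morphism ET IC f" and f': "connected_geometric_morphism ET IC f'"
    and e: "equivalent_quotients ET (IC, f) s" and e': "equivalent_quotients ET (IC, f') s"
  shows "\<exists>t. t \<in> Hom ET (omap (inverse_image f) UI) (omap (inverse_image f') UI)"
proof -
  obtain \<F> g where s: "s = (\<F>, g)" by (cases s)
  obtain a b where ab: "is_equivalence IC \<F> a b"
    and iso: "isomorphic (functor_category \<F> ET) (comp_functor \<F> (inverse_image f) b) (inverse_image g)"
    using e by (auto simp: s equivalent_quotients_def)
  obtain a' b' where ab': "is_equivalence IC \<F> a' b'"
    and iso': "isomorphic (functor_category \<F> ET) (comp_functor \<F> (inverse_image f') b') (inverse_image g)"
    using e' by (auto simp: s equivalent_quotients_def)
  have adj: "is_left_adjoint IC ET (inverse_image f) (direct_image f)"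
    and F: "is_functor IC ET (inverse_image f)"
    using f by (auto simp: connected_geometric_morphism_def geometric_morphism_def is_left_adjoint_def)
  have F': "is_functor IC ET (inverse_image f')" and ff': "fully_faithful IC ET (inverse_image f')"
    using f' by (auto simp: connected_geometric_morphism_def geometric_morphism_def is_left_adjoint_def)
  have func: "is_functor IC \<F> a'" "is_functor \<F> IC b" "is_functor \<F> IC b'"
    using ab ab' by (auto simp: is_equivalence_def)
  note tr = isomorphic_trans[OF category_ET]
  define x where "x = omap a' UI"
  have x: "x \<in> Obj \<F>" unfolding x_def by (rule functorD(1)[OF func(1) universal_Obj])
  have "isomorphic IC (omap (comp_functor IC b' a') UI) (omap (id_functor IC) UI)"
    using ab' by (intro isomorphic_component[OF _ universal_Obj]) (auto simp: is_equivalence_def)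
  then have "isomorphic IC (omap b' x) UI"
    by (simp add: comp_functor_def id_functor_def compose_def universal_Obj x_def)
  then have i1: "isomorphic ET (omap (inverse_image f') (omap b' x)) (omap (inverse_image f') UI)"
    by (rule isomorphic_functor[OF F'])
  have i2: "isomorphic ET (omap (inverse_image f') (omap b' x)) (omap (inverse_image g) x)"
    using isomorphic_component[OF iso' x] x by (simp add: comp_functor_def compose_def)
  define G where "G = omap b x"
  have G: "G \<in> Obj IC" unfolding G_def by (rule functorD(1)[OF func(2) x])
  have i3: "isomorphic ET (omap (inverse_image f) G) (omap (inverse_image g) x)"
    using isomorphic_component[OF iso x] x by (simp add: comp_functor_def compose_def G_def)
  have "isomorphic ET (omap (inverse_image f) G) (omap (inverse_image f') UI)"
    using tr[OF i3 tr[OF isomorphic_sym[OF i2] i1]] .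
  then obtain u v where u: "u \<in> Hom ET (omap (inverse_image f) G) (omap (inverse_image f') UI)"
    and v: "v \<in> Hom ET (omap (inverse_image f') UI) (omap (inverse_image f) G)"
    and uv: "Comp ET u v = Ide ET (omap (inverse_image f') UI)"
    unfolding isomorphic_def by blast
  \<comment> \<open>If \<open>G\<close> were empty everywhere, it would have at most one map to each
    object, and by adjointness so would its image under \<open>f\<close>. The isomorphic image of
    the universal object under \<open>f'\<close> has two, as that functor is faithful.\<close>
  have "\<exists>A y. fs A \<and> y \<in> omap G A"
  proof (rule ccontr)
    assume empty: "\<not> ?thesis"
    have uniq: "h = h'" if "h \<in> Hom IC G Z" "h' \<in> Hom IC G Z" for Z h h'
      using that by (rule IC_Hom_ext) (use empty in blast)
    obtain Z h h' where h: "h \<in> Hom IC UI Z" "h' \<in> Hom IC UI Z" "h \<noteq> h'"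
      by (rule two_maps_from_universal)
    note m = functorD(2)[OF F' h(1)] functorD(2)[OF F' h(2)]
    have "Comp ET (amap (inverse_image f') h) u = Comp ET (amap (inverse_image f') h') u"
      using categoryD(4)[OF category_ET u m(1)] categoryD(4)[OF category_ET u m(2)]
      by (rule left_adjoint_maps_eq[OF category_IC category_ET adj G _ _ uniq])
    then have "Comp ET (amap (inverse_image f') h) (Comp ET u v) = Comp ET (amap (inverse_image f') h') (Comp ET u v)"
      using categoryD(7)[OF category_ET v u m(1)] categoryD(7)[OF category_ET v u m(2)] by simp
    then have "amap (inverse_image f') h = amap (inverse_image f') h'"
      using categoryD(5)[OF category_ET m(1)] categoryD(5)[OF category_ET m(2)] uv by simp
    moreover have "inj_on (amap (inverse_image f')) (Hom IC UI Z)"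
      using ff' universal_Obj IC_Hom_Obj(2)[OF h(1)] by (auto simp: fully_faithful_def bij_betw_def)
    ultimately show False using h by (auto dest: inj_onD)
  qed
  then obtain h where "h \<in> Hom IC UI G" using universal_to_nonempty[OF G] by blast
  then have "amap (inverse_image f) h \<in> Hom ET (omap (inverse_image f) UI) (omap (inverse_image f) G)"
    by (rule functorD(2)[OF F])
  then show ?thesis using categoryD(4)[OF category_ET _ u] by blast
qed

text \<open>Full faithfulness transfers \<open>End_universal\<close> to the inverse images, which
  makes both composites of the two maps identities.\<close>

lemma equivalent_quotients_isomorphic:
  fixes f f' :: "('u eobj, 'u earr, 'u inh_obj, 'u inh_arr) geom"
    and s :: "('u inh_obj, 'u inh_arr) cat \<times> ('u eobj, 'u earr, 'u inh_obj, 'u inh_arr) geom"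
  assumes f: "connected_geometric_morphism ET IC f" and f': "connected_geometric_morphism ET IC f'"
    and e: "equivalent_quotients ET (IC, f) s" and e': "equivalent_quotients ET (IC, f') s"
  shows "isomorphic ET (omap (inverse_image f) UI) (omap (inverse_image f') UI)"
proof -
  obtain t where t: "t \<in> Hom ET (omap (inverse_image f) UI) (omap (inverse_image f') UI)"
    using map_between_quotients[OF f f' e e'] by blast
  obtain t' where t': "t' \<in> Hom ET (omap (inverse_image f') UI) (omap (inverse_image f) UI)"
    using map_between_quotients[OF f' f e' e] by blast
  have End: "k = Ide ET (omap (inverse_image f) UI)"
    if f: "connected_geometric_morphism ET IC f"
    and k: "k \<in> Hom ET (omap (inverse_image f) UI) (omap (inverse_image f) UI)"
    for k and f :: "('u eobj, 'u earr, 'u inh_obj, 'u inh_arr) geom"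
  proof -
    have F: "is_functor IC ET (inverse_image f)" and ff: "fully_faithful IC ET (inverse_image f)"
      using f by (auto simp: connected_geometric_morphism_def geometric_morphism_def is_left_adjoint_def)
    have "bij_betw (amap (inverse_image f)) (Hom IC UI UI)
        (Hom ET (omap (inverse_image f) UI) (omap (inverse_image f) UI))"
      using ff universal_Obj unfolding fully_faithful_def by simp
    then have "k \<in> amap (inverse_image f) ` Hom IC UI UI" using k by (simp add: bij_betw_def)
    then obtain \<gamma> where "\<gamma> \<in> Hom IC UI UI" "k = amap (inverse_image f) \<gamma>" by (rule imageE)
    then show ?thesis using End_universal functorD(3)[OF F universal_Obj] by simp
  qed
  have "Comp ET t' t = Ide ET (omap (inverse_image f) UI)" "Comp ET t t' = Ide ET (omap (inverse_image f') UI)"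
    using End[OF f categoryD(4)[OF category_ET t t']] End[OF f' categoryD(4)[OF category_ET t' t]] by auto
  then show ?thesis
    using t t' categoryD(8)[OF category_ET t] categoryD(8)[OF category_ET t'] unfolding isomorphic_def by blast
qed

text \<open>Small many quotients representing all would yield small many rigid objects representing
  all. Two rigid objects are compared through one quotient \<open>s\<close> to which both of theirs
  are equivalent.\<close>

lemma proper_class_quotients:
  assumes topos: "grothendieck_topos TYPE('u) IC"
  shows "proper_class_many TYPE('u)
    (quotient_topoi TYPE('u) ET :: (('u inh_obj, 'u inh_arr) cat \<times> ('u eobj, 'u earr, 'u inh_obj, 'u inh_arr) geom) set)
    (equivalent_quotients ET)"
  unfolding proper_class_many_def
proof
  let ?Q = "quotient_topoi TYPE('u) ET ::
    (('u inh_obj, 'u inh_arr) cat \<times> ('u eobj, 'u earr, 'u inh_obj, 'u inh_arr) geom) set"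
  let ?K = "{X :: 'u eobj. inhabited_topos_rigid TYPE('u) ET X}"
  assume "\<exists>S. S \<subseteq> ?Q \<and> small TYPE('u) S \<and> (\<forall>x\<in>?Q. \<exists>y\<in>S. equivalent_quotients ET x y)"
  then obtain S where S: "small TYPE('u) S" "\<And>x. x \<in> ?Q \<Longrightarrow> \<exists>y\<in>S. equivalent_quotients ET x y"
    by blast
  have "\<forall>X\<in>?K. \<exists>f. isomorphic ET (omap (inverse_image f) UI) X \<and> connected_geometric_morphism ET IC f"
    by (auto simp: inhabited_topos_rigid_def)
  then obtain \<phi> where \<phi>: "\<And>X. X \<in> ?K \<Longrightarrow> isomorphic ET (omap (inverse_image (\<phi> X)) UI) X"
    "\<And>X. X \<in> ?K \<Longrightarrow> connected_geometric_morphism ET IC (\<phi> X)" by metis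
  define pick where "pick s = (SOME X. X \<in> ?K \<and> equivalent_quotients ET (IC, \<phi> X) s)" for s :: "('u inh_obj, 'u inh_arr) cat \<times> ('u eobj, 'u earr, 'u inh_obj, 'u inh_arr) geom"
  \<comment> \<open>\<open>pick s\<close> is arbitrary when no rigid object belongs to
    \<open>s\<close>; the intersection discards values outside \<open>?K\<close>.\<close>
  let ?S = "pick ` S \<inter> ?K"
  have "small TYPE('u) ?S" by (rule small_subset[OF small_image[OF S(1)]]) auto
  moreover have "\<exists>Y\<in>?S. isomorphic ET X Y" if X: "X \<in> ?K" for X
  proof -
    have "(IC, \<phi> X) \<in> ?Q" using topos \<phi>(2)[OF X] by (simp add: quotient_topoi_def)
    then obtain s where s: "s \<in> S" "equivalent_quotients ET (IC, \<phi> X) s" using S(2) by blast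
    then have "pick s \<in> ?K \<and> equivalent_quotients ET (IC, \<phi> (pick s)) s"
      unfolding pick_def using X by (intro someI_ex[of "\<lambda>X. X \<in> ?K \<and> equivalent_quotients ET (IC, \<phi> X) s"]) blast
    then have Y: "pick s \<in> ?K" "equivalent_quotients ET (IC, \<phi> (pick s)) s" by auto
    have "isomorphic ET (omap (inverse_image (\<phi> X)) UI) (omap (inverse_image (\<phi> (pick s))) UI)"
      by (rule equivalent_quotients_isomorphic[OF \<phi>(2)[OF X] \<phi>(2)[OF Y(1)] s(2) Y(2)])
    then have "isomorphic ET X (pick s)"
      using isomorphic_trans[OF category_ET isomorphic_trans[OF category_ET isomorphic_sym[OF \<phi>(1)[OF X]]] \<phi>(1)[OF Y(1)]]
      by blast
    then show ?thesis using s(1) Y(1) by blast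
  qed
  ultimately show False
    using proper_class_rigid unfolding proper_class_many_def by (meson Int_lower2)
qed

end


section \<open>Functor categories as Grothendieck topoi\<close>

lemma opposite_sel [simp]:
  "Obj (opposite C) = Obj C" "Arr (opposite C) = Arr C" "Dom (opposite C) = Cod C" "Cod (opposite C) = Dom C"
  "Ide (opposite C) = Ide C" "Comp (opposite C) g f = Comp C f g"
  by (simp_all add: opposite_def)

lemma opposite_opposite [simp]: "opposite (opposite C) = (C :: ('o, 'm) cat)"
  by (cases C) (simp add: opposite_def)

lemma category_opposite: "category C \<Longrightarrow> category (opposite C)"
  unfolding category_def by (auto simp: Hom_def)

definition trivial_topology :: "('o, 'm) cat \<Rightarrow> 'o \<Rightarrow> 'm set set" where
  "trivial_topology C c = {{f \<in> Arr C. Cod C f = c}}"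

text \<open>For transitivity, pulling back along the identity shows that a sieve which is locally
  maximal is maximal.\<close>

lemma grothendieck_topology_trivial:
  assumes C: "category C" shows "grothendieck_topology C (trivial_topology C)"
proof -
  have comp: "Comp C h g \<in> Arr C" "Cod C (Comp C h g) = Cod C h" "Dom C (Comp C h g) = Dom C g"
    if "h \<in> Arr C" "g \<in> Arr C" "Cod C g = Dom C h" for h g
    using categoryD(4)[OF C, of g "Dom C g" "Cod C g" h "Cod C h"] that by (auto simp: Hom_def)
  have ide: "Ide C c \<in> Arr C" "Cod C (Ide C c) = c" "Dom C (Ide C c) = c" if "c \<in> Obj C" for c
    using categoryD(3)[OF C that] by (auto simp: Hom_def)
  have "T = {f \<in> Arr C. Cod C f = c}"
    if c: "c \<in> Obj C" and T: "sieve C c T"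
    and pb: "\<forall>h\<in>{f \<in> Arr C. Cod C f = c}. pullback_sieve C h T = {f \<in> Arr C. Cod C f = Dom C h}" for c T
  proof
    show "T \<subseteq> {f \<in> Arr C. Cod C f = c}" using T by (simp add: sieve_def)
    have "pullback_sieve C (Ide C c) T = {f \<in> Arr C. Cod C f = c}" using pb ide[OF c] by simp
    then show "{f \<in> Arr C. Cod C f = c} \<subseteq> T"
      using categoryD(6)[OF C] ide[OF c] by (fastforce simp: pullback_sieve_def Hom_def)
  qed
  then show ?thesis
    unfolding grothendieck_topology_def trivial_topology_def
    by (auto simp: sieve_def pullback_sieve_def comp)
qed

text \<open>The maximal sieve on \<open>c\<close> contains the identity, so a matching family is
  determined by its member there.\<close>

lemma sheaf_category_trivial:
  assumes C: "category C"
  shows "sheaf_category C (trivial_topology C) =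
    (functor_category (opposite C) set_cat :: (('o, 'm, 'u) sfun, ('o, 'm, 'u) strans) cat)"
proof -
  interpret op: index_category "opposite C" by standard (rule category_opposite[OF C])
  have "is_sheaf C (trivial_topology C) P" if P: "is_functor (opposite C) set_cat P" for P :: "('o, 'm, 'u) sfun"
  proof -
    have P': "P \<in> Obj op.Sets" using P by (simp add: op.Obj_Sets)
    have "\<exists>!y. y \<in> omap P c \<and> (\<forall>f\<in>{f \<in> Arr C. Cod C f = c}. body (amap P f) y = x f)"
      if c: "c \<in> Obj C" and x: "\<forall>f\<in>{f \<in> Arr C. Cod C f = c}. x f \<in> omap P (Dom C f)"
      and xc: "\<forall>f\<in>{f \<in> Arr C. Cod C f = c}. \<forall>g\<in>Arr C. Cod C g = Dom C f \<longrightarrow> body (amap P g) (x f) = x (Comp C f g)"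
      for c x
    proof
      have ide: "Ide C c \<in> Arr C" "Cod C (Ide C c) = c" "Dom C (Ide C c) = c"
        using categoryD(3)[OF C c] by (auto simp: Hom_def)
      have "body (amap P f) (x (Ide C c)) = x f" if "f \<in> Arr C" "Cod C f = c" for f
        using xc ide that categoryD(6)[OF C, of f "Dom C f" c] by (simp add: Hom_def)
      then show "x (Ide C c) \<in> omap P c \<and> (\<forall>f\<in>{f \<in> Arr C. Cod C f = c}. body (amap P f) (x (Ide C c)) = x f)"
        using x ide by auto
      fix y assume y: "y \<in> omap P c \<and> (\<forall>f\<in>{f \<in> Arr C. Cod C f = c}. body (amap P f) y = x f)"
      then have "body (amap P (Ide C c)) y = x (Ide C c)" using ide by blast
      then show "y = x (Ide C c)"
        using op.act_Ide[OF P', of c y] y c by (simp add: act_def)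
    qed
    then show ?thesis unfolding is_sheaf_def trivial_topology_def by auto
  qed
  then show ?thesis
    unfolding sheaf_category_def full_subcategory_def
    by (auto simp: functor_category_def)
qed

section \<open>Precomposition and equivalences of functor categories\<close>

definition precomp ::
  "('o, 'm) cat \<Rightarrow> ('p, 'n) cat \<Rightarrow> ('q, 'k) cat \<Rightarrow> ('o, 'm, 'p, 'n) func \<Rightarrow>
   (('p, 'n, 'q, 'k) func, (('p, 'n, 'q, 'k) func, 'p \<Rightarrow> 'k) arrow,
    ('o, 'm, 'q, 'k) func, (('o, 'm, 'q, 'k) func, 'o \<Rightarrow> 'k) arrow) func" where
  "precomp A B D \<Psi> =
     \<lparr>omap = (\<lambda>G\<in>Obj (functor_category B D). comp_functor A G \<Psi>),
      amap = (\<lambda>m\<in>Arr (functor_category B D). Arrow (comp_functor A (source m) \<Psi>)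
        (\<lambda>a\<in>Obj A. body m (omap \<Psi> a)) (comp_functor A (target m) \<Psi>))\<rparr>"

lemma functor_category_sel [simp]:
  "Obj (functor_category C D) = {F. is_functor C D F}"
  "Dom (functor_category C D) = source" "Cod (functor_category C D) = target"
  "Ide (functor_category C D) F = Arrow F (\<lambda>a\<in>Obj C. Ide D (omap F a)) F"
  "Comp (functor_category C D) g f = Arrow (source f) (\<lambda>a\<in>Obj C. Comp D (body g a) (body f a)) (target g)"
  by (simp_all add: functor_category_def)

lemma Arr_functor_category:
  "m \<in> Arr (functor_category C D) \<longleftrightarrow>
     is_functor C D (source m) \<and> is_functor C D (target m) \<and> is_nat_trans C D (source m) (target m) (body m)"
  by (cases m) (auto simp: functor_category_def)

lemma comp_functor_sel:
  "a \<in> Obj A \<Longrightarrow> omap (comp_functor A G F) a = omap G (omap F a)"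
  "f \<in> Arr A \<Longrightarrow> amap (comp_functor A G F) f = amap G (amap F f)"
  by (simp_all add: comp_functor_def compose_def)

lemma is_functorI:
  assumes "omap F \<in> extensional (Obj C)" "amap F \<in> extensional (Arr C)"
    and "\<And>a. a \<in> Obj C \<Longrightarrow> omap F a \<in> Obj D"
    and "\<And>f. f \<in> Arr C \<Longrightarrow> amap F f \<in> Hom D (omap F (Dom C f)) (omap F (Cod C f))"
    and "\<And>a. a \<in> Obj C \<Longrightarrow> amap F (Ide C a) = Ide D (omap F a)"
    and "\<And>f g. f \<in> Arr C \<Longrightarrow> g \<in> Arr C \<Longrightarrow> Cod C f = Dom C g \<Longrightarrow> amap F (Comp C g f) = Comp D (amap F g) (amap F f)"
  shows "is_functor C D F"
  using assms unfolding is_functor_def by (auto simp: PiE_iff)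

lemma is_functor_comp:
  assumes A: "category A" and F: "is_functor A B F" and G: "is_functor B D G"
  shows "is_functor A D (comp_functor A G F)"
proof (rule is_functorI)
  show "omap (comp_functor A G F) \<in> extensional (Obj A)" "amap (comp_functor A G F) \<in> extensional (Arr A)"
    by (simp_all add: comp_functor_def)
  show "omap (comp_functor A G F) a \<in> Obj D" if "a \<in> Obj A" for a
    using functorD(1)[OF G functorD(1)[OF F that]] that by (simp add: comp_functor_sel)
  show "amap (comp_functor A G F) (Ide A a) = Ide D (omap (comp_functor A G F) a)" if "a \<in> Obj A" for a
    using functorD(3)[OF F that] functorD(3)[OF G functorD(1)[OF F that]] categoryD(3)[OF A that] that
    by (simp add: comp_functor_sel Hom_def)
next
  fix f assume f: "f \<in> Arr A"
  then have "f \<in> Hom A (Dom A f) (Cod A f)" by (simp add: Hom_def)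
  from functorD(2)[OF G functorD(2)[OF F this]]
  show "amap (comp_functor A G F) f \<in> Hom D (omap (comp_functor A G F) (Dom A f)) (omap (comp_functor A G F) (Cod A f))"
    using f categoryD(1,2)[OF A f] by (simp add: comp_functor_sel)
next
  fix f g assume f: "f \<in> Arr A" and g: "g \<in> Arr A" and c: "Cod A f = Dom A g"
  then have h: "f \<in> Hom A (Dom A f) (Cod A f)" "g \<in> Hom A (Cod A f) (Cod A g)" by (simp_all add: Hom_def)
  show "amap (comp_functor A G F) (Comp A g f) = Comp D (amap (comp_functor A G F) g) (amap (comp_functor A G F) f)"
    using functorD(4)[OF F h] functorD(4)[OF G functorD(2)[OF F h(1)] functorD(2)[OF F h(2)]]
      categoryD(4)[OF A h] f g by (simp add: comp_functor_sel HomD(1))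
qed

lemma is_nat_transD:
  assumes "is_nat_trans C D F G \<alpha>"
  shows "a \<in> Obj C \<Longrightarrow> \<alpha> a \<in> Hom D (omap F a) (omap G a)"
    "f \<in> Arr C \<Longrightarrow> Comp D (\<alpha> (Cod C f)) (amap F f) = Comp D (amap G f) (\<alpha> (Dom C f))"
    "\<alpha> \<in> extensional (Obj C)"
  using assms by (auto simp: is_nat_trans_def PiE_iff)

lemma functor_eqI:
  assumes "is_functor C D F" "is_functor C D G"
    and "\<And>a. a \<in> Obj C \<Longrightarrow> omap F a = omap G a" "\<And>f. f \<in> Arr C \<Longrightarrow> amap F f = amap G f"
  shows "F = G"
proof -
  have "omap F = omap G" "amap F = amap G"
    using assms unfolding is_functor_def
    by (auto simp: PiE_iff intro!: extensionalityI[of _ "Obj C"] extensionalityI[of _ "Arr C"])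
  then show ?thesis by (cases F; cases G) simp
qed

lemma Arrow_functor_category_Hom:
  "Arrow F' \<alpha> G' \<in> Hom (functor_category C D) F G \<longleftrightarrow>
     F' = F \<and> G' = G \<and> is_functor C D F \<and> is_functor C D G \<and> is_nat_trans C D F G \<alpha>"
  by (auto simp: Hom_def Arr_functor_category)

lemma is_functor_id: "category C \<Longrightarrow> is_functor C C (id_functor C)"
proof (rule is_functorI)
  assume C: "category C"
  show "omap (id_functor C) a \<in> Obj C" if "a \<in> Obj C" for a using that by (simp add: id_functor_def)
  show "amap (id_functor C) f \<in> Hom C (omap (id_functor C) (Dom C f)) (omap (id_functor C) (Cod C f))"
    if "f \<in> Arr C" for f
    using that categoryD(1,2)[OF C that] by (simp add: id_functor_def Hom_def)
  show "amap (id_functor C) (Ide C a) = Ide C (omap (id_functor C) a)" if "a \<in> Obj C" for a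
    using that categoryD(3)[OF C that] by (simp add: id_functor_def HomD(1))
  show "amap (id_functor C) (Comp C g f) = Comp C (amap (id_functor C) g) (amap (id_functor C) f)"
    if "f \<in> Arr C" "g \<in> Arr C" "Cod C f = Dom C g" for f g
    using that categoryD(4)[OF C, of f "Dom C f" "Cod C f" g "Cod C g"] by (simp add: id_functor_def Hom_def)
qed (simp_all add: id_functor_def)

lemma isomorphic_refl: "category C \<Longrightarrow> a \<in> Obj C \<Longrightarrow> isomorphic C a a"
  unfolding isomorphic_def using categoryD(3) categoryD(5) by metis

lemma precomp_obj: "is_functor B D G \<Longrightarrow> omap (precomp A B D \<Psi>) G = comp_functor A G \<Psi>"
  by (simp add: precomp_def)

lemma precomp_arr:
  "m \<in> Arr (functor_category B D) \<Longrightarrow> amap (precomp A B D \<Psi>) m =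
     Arrow (comp_functor A (source m) \<Psi>) (\<lambda>a\<in>Obj A. body m (omap \<Psi> a)) (comp_functor A (target m) \<Psi>)"
  by (simp add: precomp_def)

lemma is_functor_precomp:
  assumes A: "category A" and B: "category B" and D: "category D" and \<Psi>: "is_functor A B \<Psi>"
  shows "is_functor (functor_category B D) (functor_category A D) (precomp A B D \<Psi>)"
proof (rule is_functorI)
  note comp = is_functor_comp[OF A \<Psi>]
  note cBD = category_functor_category[OF B D]
  have o: "omap \<Psi> a \<in> Obj B" if "a \<in> Obj A" for a using functorD(1)[OF \<Psi> that] .
  have \<Psi>f: "amap \<Psi> f \<in> Hom B (omap \<Psi> (Dom A f)) (omap \<Psi> (Cod A f))" if "f \<in> Arr A" for f
    by (rule functorD(2)[OF \<Psi>]) (simp add: Hom_def that)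
  show "omap (precomp A B D \<Psi>) \<in> extensional (Obj (functor_category B D))"
    "amap (precomp A B D \<Psi>) \<in> extensional (Arr (functor_category B D))"
    by (simp_all add: precomp_def)
  show "omap (precomp A B D \<Psi>) G \<in> Obj (functor_category A D)" if "G \<in> Obj (functor_category B D)" for G
    using that by (simp add: precomp_def comp)
  show "amap (precomp A B D \<Psi>) (Ide (functor_category B D) G) =
      Ide (functor_category A D) (omap (precomp A B D \<Psi>) G)" if G: "G \<in> Obj (functor_category B D)" for G
    using G HomD(1)[OF categoryD(3)[OF cBD G]] o
    by (auto simp: precomp_obj precomp_arr comp_functor_sel intro!: restrict_ext)
  show "amap (precomp A B D \<Psi>) (Comp (functor_category B D) g f) =
      Comp (functor_category A D) (amap (precomp A B D \<Psi>) g) (amap (precomp A B D \<Psi>) f)"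
    if f: "f \<in> Arr (functor_category B D)" and g: "g \<in> Arr (functor_category B D)"
      and fg: "Cod (functor_category B D) f = Dom (functor_category B D) g" for f g
    using HomD(1)[OF categoryD(4)[OF cBD, of f "source f" "target f" g "target g"]] f g fg o
    by (auto simp: precomp_arr Hom_def intro!: restrict_ext)
  fix m assume m: "m \<in> Arr (functor_category B D)"
  then have n: "is_functor B D (source m)" "is_functor B D (target m)"
    "is_nat_trans B D (source m) (target m) (body m)" by (auto simp: Arr_functor_category)
  have "is_nat_trans A D (comp_functor A (source m) \<Psi>) (comp_functor A (target m) \<Psi>) (\<lambda>a\<in>Obj A. body m (omap \<Psi> a))"
    unfolding is_nat_trans_def
  proof (intro conjI ballI)
    show "(\<lambda>a\<in>Obj A. body m (omap \<Psi> a)) \<in>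
        (\<Pi>\<^sub>E a\<in>Obj A. Hom D (omap (comp_functor A (source m) \<Psi>) a) (omap (comp_functor A (target m) \<Psi>) a))"
      using is_nat_transD(1)[OF n(3) o] by (simp add: comp_functor_sel)
    fix f assume f: "f \<in> Arr A"
    show "Comp D ((\<lambda>a\<in>Obj A. body m (omap \<Psi> a)) (Cod A f)) (amap (comp_functor A (source m) \<Psi>) f) =
        Comp D (amap (comp_functor A (target m) \<Psi>) f) ((\<lambda>a\<in>Obj A. body m (omap \<Psi> a)) (Dom A f))"
      using is_nat_transD(2)[OF n(3) HomD(1)[OF \<Psi>f[OF f]]] HomD(2,3)[OF \<Psi>f[OF f]] f categoryD(1,2)[OF A f]
      by (simp add: comp_functor_sel)
  qed
  then show "amap (precomp A B D \<Psi>) m \<in> Hom (functor_category A D)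
      (omap (precomp A B D \<Psi>) (Dom (functor_category B D) m)) (omap (precomp A B D \<Psi>) (Cod (functor_category B D) m))"
    using m by (simp add: precomp_obj precomp_arr n Arrow_functor_category_Hom comp)
qed

text \<open>Extensional functors compose associatively on the nose, so this is an equality and the
  isomorphisms of an equivalence can be transported directly.\<close>

lemma precomp_comp:
  assumes A: "category A" and B: "category B" and C: "category C" and D: "category D"
    and \<Psi>: "is_functor A B \<Psi>" and \<Phi>: "is_functor B C \<Phi>"
  shows "comp_functor (functor_category C D) (precomp A B D \<Psi>) (precomp B C D \<Phi>) =
    precomp A C D (comp_functor A \<Phi> \<Psi>)"
proof (rule functor_eqI)
  note p\<Phi> = is_functor_precomp[OF B C D \<Phi>]
  have assoc: "comp_functor A (comp_functor B F \<Phi>) \<Psi> = comp_functor A F (comp_functor A \<Phi> \<Psi>)"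
    if F: "is_functor C D F" for F
  proof (rule functor_eqI[OF is_functor_comp[OF A \<Psi> is_functor_comp[OF B \<Phi> F]]
        is_functor_comp[OF A is_functor_comp[OF A \<Psi> \<Phi>] F]])
    show "omap (comp_functor A (comp_functor B F \<Phi>) \<Psi>) a = omap (comp_functor A F (comp_functor A \<Phi> \<Psi>)) a"
      if "a \<in> Obj A" for a using that functorD(1)[OF \<Psi> that] by (simp add: comp_functor_sel)
    show "amap (comp_functor A (comp_functor B F \<Phi>) \<Psi>) f = amap (comp_functor A F (comp_functor A \<Phi> \<Psi>)) f"
      if "f \<in> Arr A" for f
      using that HomD(1)[OF functorD(2)[OF \<Psi>, of f "Dom A f" "Cod A f"]] by (simp add: comp_functor_sel Hom_def)
  qed
  show "is_functor (functor_category C D) (functor_category A D)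
      (comp_functor (functor_category C D) (precomp A B D \<Psi>) (precomp B C D \<Phi>))"
    by (rule is_functor_comp[OF category_functor_category[OF C D] p\<Phi> is_functor_precomp[OF A B D \<Psi>]])
  show "is_functor (functor_category C D) (functor_category A D) (precomp A C D (comp_functor A \<Phi> \<Psi>))"
    by (rule is_functor_precomp[OF A C D is_functor_comp[OF A \<Psi> \<Phi>]])
  show "omap (comp_functor (functor_category C D) (precomp A B D \<Psi>) (precomp B C D \<Phi>)) F =
      omap (precomp A C D (comp_functor A \<Phi> \<Psi>)) F" if "F \<in> Obj (functor_category C D)" for F
    using that by (simp add: comp_functor_sel precomp_obj is_functor_comp[OF B \<Phi>] assoc)
  fix m assume m: "m \<in> Arr (functor_category C D)"
  then have n: "is_functor C D (source m)" "is_functor C D (target m)" by (auto simp: Arr_functor_category)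
  have m': "amap (precomp B C D \<Phi>) m \<in> Arr (functor_category B D)"
    using functorD(2)[OF p\<Phi>, of m "source m" "target m"] m by (simp add: Hom_def)
  have "(\<lambda>a\<in>Obj A. (\<lambda>b\<in>Obj B. body m (omap \<Phi> b)) (omap \<Psi> a)) = (\<lambda>a\<in>Obj A. body m (omap (comp_functor A \<Phi> \<Psi>) a))"
    using functorD(1)[OF \<Psi>] by (auto simp: comp_functor_sel intro!: restrict_ext)
  then show "amap (comp_functor (functor_category C D) (precomp A B D \<Psi>) (precomp B C D \<Phi>)) m =
      amap (precomp A C D (comp_functor A \<Phi> \<Psi>)) m"
    using m m' by (simp add: comp_functor_sel precomp_arr assoc n)
qed

lemma precomp_id:
  assumes A: "category A" and D: "category D"
  shows "precomp A A D (id_functor A) = id_functor (functor_category A D)"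
proof (rule functor_eqI)
  have unit: "comp_functor A F (id_functor A) = F" if F: "is_functor A D F" for F
    by (rule functor_eqI[OF is_functor_comp[OF A is_functor_id[OF A] F] F])
       (simp_all add: comp_functor_sel, simp_all add: id_functor_def)
  show "is_functor (functor_category A D) (functor_category A D) (precomp A A D (id_functor A))"
    by (rule is_functor_precomp[OF A A D is_functor_id[OF A]])
  show "is_functor (functor_category A D) (functor_category A D) (id_functor (functor_category A D))"
    by (rule is_functor_id[OF category_functor_category[OF A D]])
  show "omap (precomp A A D (id_functor A)) F = omap (id_functor (functor_category A D)) F"
    if "F \<in> Obj (functor_category A D)" for F
    using that by (simp add: precomp_obj unit) (simp add: id_functor_def)
  fix m assume m: "m \<in> Arr (functor_category A D)"
  then have n: "is_functor A D (source m)" "is_functor A D (target m)"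
    "is_nat_trans A D (source m) (target m) (body m)" by (auto simp: Arr_functor_category)
  have "(\<lambda>a\<in>Obj A. body m (omap (id_functor A) a)) = body m"
    using is_nat_transD(3)[OF n(3)] by (intro extensionalityI[of _ "Obj A"]) (auto simp: id_functor_def)
  then show "amap (precomp A A D (id_functor A)) m = amap (id_functor (functor_category A D)) m"
    using m by (simp add: precomp_arr unit n id_functor_def[of "functor_category A D"])
qed

text \<open>Whiskering: applying \<open>F\<close> to the components of \<delta> gives a
  transformation between the two composites, and it is natural in \<open>F\<close> as well.\<close>

lemma isomorphic_precomp:
  assumes A: "category A" and B: "category B" and D: "category D"
    and iso: "isomorphic (functor_category A B) W W'"
  shows "isomorphic (functor_category (functor_category B D) (functor_category A D))
    (precomp A B D W) (precomp A B D W')"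
proof -
  let ?BD = "functor_category B D" and ?AD = "functor_category A D"
  note cAD = category_functor_category[OF A D] and cBD = category_functor_category[OF B D]
  define T where "T \<delta> W W' F = Arrow (comp_functor A F W) (\<lambda>a\<in>Obj A. amap F (\<delta> a)) (comp_functor A F W')" for \<delta> W W' and F :: "('c, 'd, 'e, 'f) func"
  define TT where "TT \<delta> W W' = Arrow (precomp A B D W) (\<lambda>F\<in>Obj ?BD. T \<delta> W W' F) (precomp A B D W')" for \<delta> W W'
  have T: "T \<delta> W W' F \<in> Hom ?AD (comp_functor A F W) (comp_functor A F W')"
    if F: "is_functor B D F" and W: "is_functor A B W" "is_functor A B W'" and \<delta>: "is_nat_trans A B W W' \<delta>" for \<delta> W W' F
    unfolding T_def Arrow_functor_category_Hom
  proof (intro conjI refl is_functor_comp[OF A _ F] W)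
    show "is_nat_trans A D (comp_functor A F W) (comp_functor A F W') (\<lambda>a\<in>Obj A. amap F (\<delta> a))"
      unfolding is_nat_trans_def
    proof (intro conjI ballI)
      show "(\<lambda>a\<in>Obj A. amap F (\<delta> a)) \<in> (\<Pi>\<^sub>E a\<in>Obj A. Hom D (omap (comp_functor A F W) a) (omap (comp_functor A F W') a))"
        using functorD(2)[OF F is_nat_transD(1)[OF \<delta>]] by (simp add: comp_functor_sel)
      fix f assume f: "f \<in> Arr A"
      then have fH: "f \<in> Hom A (Dom A f) (Cod A f)" by (simp add: Hom_def)
      note d = categoryD(1)[OF A f] and c = categoryD(2)[OF A f]
      show "Comp D ((\<lambda>a\<in>Obj A. amap F (\<delta> a)) (Cod A f)) (amap (comp_functor A F W) f) =
          Comp D (amap (comp_functor A F W') f) ((\<lambda>a\<in>Obj A. amap F (\<delta> a)) (Dom A f))"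
        using functorD(4)[OF F functorD(2)[OF W(1) fH] is_nat_transD(1)[OF \<delta> c]]
          functorD(4)[OF F is_nat_transD(1)[OF \<delta> d] functorD(2)[OF W(2) fH]] is_nat_transD(2)[OF \<delta> f] f c d
        by (simp add: comp_functor_sel)
    qed
  qed
  have TT: "TT \<delta> W W' \<in> Hom (functor_category ?BD ?AD) (precomp A B D W) (precomp A B D W')"
    if W: "is_functor A B W" "is_functor A B W'" and \<delta>: "is_nat_trans A B W W' \<delta>" for \<delta> W W'
    unfolding TT_def Arrow_functor_category_Hom
  proof (intro conjI refl is_functor_precomp[OF A B D] W)
    show "is_nat_trans ?BD ?AD (precomp A B D W) (precomp A B D W') (\<lambda>F\<in>Obj ?BD. T \<delta> W W' F)"
      unfolding is_nat_trans_def
    proof (intro conjI ballI)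
      show "(\<lambda>F\<in>Obj ?BD. T \<delta> W W' F) \<in> (\<Pi>\<^sub>E F\<in>Obj ?BD. Hom ?AD (omap (precomp A B D W) F) (omap (precomp A B D W') F))"
        using T[OF _ W \<delta>] by (simp add: precomp_obj)
      fix m assume m: "m \<in> Arr ?BD"
      then have n: "is_functor B D (source m)" "is_functor B D (target m)"
        "is_nat_trans B D (source m) (target m) (body m)" by (auto simp: Arr_functor_category)
      have "Comp D (amap (target m) (\<delta> a)) (body m (omap W a)) = Comp D (body m (omap W' a)) (amap (source m) (\<delta> a))"
        if "a \<in> Obj A" for a
        using is_nat_transD(2)[OF n(3), of "\<delta> a"] is_nat_transD(1)[OF \<delta> that] by (simp add: Hom_def)
      then show "Comp ?AD ((\<lambda>F\<in>Obj ?BD. T \<delta> W W' F) (Cod ?BD m)) (amap (precomp A B D W) m) =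
          Comp ?AD (amap (precomp A B D W') m) ((\<lambda>F\<in>Obj ?BD. T \<delta> W W' F) (Dom ?BD m))"
        using m by (auto simp: precomp_arr n T_def intro!: restrict_ext)
    qed
  qed
  have inv: "Comp (functor_category ?BD ?AD) (TT \<gamma> W' W) (TT \<delta> W W') = Ide (functor_category ?BD ?AD) (precomp A B D W)"
    if W: "is_functor A B W" "is_functor A B W'" and \<delta>: "is_nat_trans A B W W' \<delta>" and \<gamma>: "is_nat_trans A B W' W \<gamma>"
      and i: "\<And>a. a \<in> Obj A \<Longrightarrow> Comp B (\<gamma> a) (\<delta> a) = Ide B (omap W a)" for \<delta> \<gamma> W W'
  proof -
    have "Comp D (amap F (\<gamma> a)) (amap F (\<delta> a)) = Ide D (omap F (omap W a))"
      if F: "is_functor B D F" and a: "a \<in> Obj A" for F a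
      using functorD(4)[OF F is_nat_transD(1)[OF \<delta> a] is_nat_transD(1)[OF \<gamma> a]] i[OF a]
        functorD(3)[OF F functorD(1)[OF W(1) a]] by simp
    then show ?thesis
      by (auto simp: TT_def T_def precomp_obj comp_functor_sel intro!: restrict_ext)
  qed
  obtain d g where d: "d \<in> Hom (functor_category A B) W W'" and g: "g \<in> Hom (functor_category A B) W' W"
    and W: "is_functor A B W" "is_functor A B W'"
    and gd: "Comp (functor_category A B) g d = Ide (functor_category A B) W"
      "Comp (functor_category A B) d g = Ide (functor_category A B) W'"
    using iso unfolding isomorphic_def by auto
  note n = Hom_functor_category_nat_trans[OF d] Hom_functor_category_nat_trans[OF g]
  have "Comp B (body g a) (body d a) = Ide B (omap W a)" "Comp B (body d a) (body g a) = Ide B (omap W' a)"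
    if "a \<in> Obj A" for a
    using gd that by (auto dest!: fun_cong[where x = a])
  then show ?thesis
    unfolding isomorphic_def
    using TT[OF W n(1)] TT[OF W(2,1) n(2)] inv[OF W n] inv[OF W(2,1) n(2,1)] is_functor_precomp[OF A B D] W
    by (auto simp del: functor_category_sel(2-))
qed

lemma equivalence_functor_category:
  assumes A: "category A" and B: "category B" and D: "category D" and eq: "is_equivalence A B \<Psi> \<Phi>"
  shows "is_equivalence (functor_category A D) (functor_category B D) (precomp B A D \<Phi>) (precomp A B D \<Psi>)"
proof -
  have \<Psi>: "is_functor A B \<Psi>" and \<Phi>: "is_functor B A \<Phi>" and
    i: "isomorphic (functor_category A A) (comp_functor A \<Phi> \<Psi>) (id_functor A)"
    "isomorphic (functor_category B B) (comp_functor B \<Psi> \<Phi>) (id_functor B)"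
    using eq by (auto simp: is_equivalence_def)
  show ?thesis
    unfolding is_equivalence_def precomp_comp[OF A B A D \<Psi> \<Phi>] precomp_comp[OF B A B D \<Phi> \<Psi>]
      precomp_id[OF A D, symmetric] precomp_id[OF B D, symmetric]
    by (intro conjI is_functor_precomp isomorphic_precomp A B D \<Psi> \<Phi> i)
qed

section \<open>Passage to a small skeleton\<close>

context inaccessible_universe
begin

text \<open>\<open>A\<close> is equivalent to its small full subcategory on \<open>K\<close>, a copy
  \<open>B\<close> of which lives in \<open>'u\<close>. The site is the opposite of
  \<open>B\<close>, because sheaves are contravariant. Normalising \<open>std\<close>, \<gamma> and
  \<beta> on \<open>K\<close> makes one composite of the equivalence equal to the identity
  functor.\<close>

lemma grothendieck_topos_functor_category:
  fixes A :: "('o, 'm) cat"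
  assumes A: "category A" and K: "K \<subseteq> Obj A" "small TYPE('u) K"
    and R: "small TYPE('u) {f \<in> Arr A. Dom A f \<in> K \<and> Cod A f \<in> K}"
    and std: "\<And>a. a \<in> Obj A \<Longrightarrow> std a \<in> K"
    and \<gamma>: "\<And>a. a \<in> Obj A \<Longrightarrow> \<gamma> a \<in> Hom A a (std a)" and \<beta>: "\<And>a. a \<in> Obj A \<Longrightarrow> \<beta> a \<in> Hom A (std a) a"
    and \<beta>\<gamma>: "\<And>a. a \<in> Obj A \<Longrightarrow> Comp A (\<beta> a) (\<gamma> a) = Ide A a"
    and \<gamma>\<beta>: "\<And>a. a \<in> Obj A \<Longrightarrow> Comp A (\<gamma> a) (\<beta> a) = Ide A (std a)"
    and stdO: "\<And>a. a \<in> K \<Longrightarrow> std a = a \<and> \<gamma> a = Ide A a \<and> \<beta> a = Ide A a"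
  shows "grothendieck_topos TYPE('u) (functor_category A (set_cat :: ('u set, 'u fn) cat))"
proof -
  let ?R = "{f \<in> Arr A. Dom A f \<in> K \<and> Cod A f \<in> K}"
  let ?co = "code K :: 'o \<Rightarrow> 'u" and ?do = "decode K :: 'u \<Rightarrow> 'o"
  let ?ca = "code ?R :: 'm \<Rightarrow> 'u" and ?da = "decode ?R :: 'u \<Rightarrow> 'm"
  note comp = categoryD(4)[OF A] and ide = categoryD(3)[OF A] and assoc = categoryD(7)[OF A]
    and idr = categoryD(5)[OF A] and idl = categoryD(6)[OF A]
  have do [simp]: "?do (?co a) = a" if "a \<in> K" for a by (rule decode_code[OF K(2) that])
  have da [simp]: "?da (?ca f) = f" if "f \<in> ?R" for f by (rule decode_code[OF R that])
  have AO: "a \<in> Obj A" if "a \<in> K" for a using that K(1) by blast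
  have RI: "f \<in> ?R" if "f \<in> Hom A a b" "a \<in> K" "b \<in> K" for f a b using that by (simp add: Hom_def)
  have RD: "f \<in> Hom A (Dom A f) (Cod A f)" if "f \<in> ?R" for f using that by (simp add: Hom_def)
  have ir: "Ide A a \<in> ?R" if "a \<in> K" for a by (rule RI[OF ide[OF AO[OF that]] that that])
  define B :: "('u, 'u) cat" where "B = \<lparr>Obj = ?co ` K, Arr = ?ca ` ?R, Dom = (\<lambda>m. ?co (Dom A (?da m))),
    Cod = (\<lambda>m. ?co (Cod A (?da m))), Ide = (\<lambda>a. ?ca (Ide A (?do a))), Comp = (\<lambda>g f. ?ca (Comp A (?da g) (?da f)))\<rparr>"
  have B [simp]: "Obj B = ?co ` K" "Arr B = ?ca ` ?R" "Dom B m = ?co (Dom A (?da m))"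
    "Cod B m = ?co (Cod A (?da m))" "Ide B a = ?ca (Ide A (?do a))" "Comp B g f = ?ca (Comp A (?da g) (?da f))" for m a g f
    by (simp_all add: B_def)
  have HomB: "?ca f \<in> Hom B (?co a) (?co b)" if "f \<in> Hom A a b" "a \<in> K" "b \<in> K" for f a b
    using RI[OF that] that(1) by (auto simp: Hom_def)
  have compR: "Comp A g f \<in> Hom A (Dom A f) (Cod A g)" "Comp A g f \<in> ?R"
    if "f \<in> ?R" "g \<in> ?R" "Cod A f = Dom A g" for f g
  proof -
    show "Comp A g f \<in> Hom A (Dom A f) (Cod A g)"
      using comp[of f "Dom A f" "Cod A f" g "Cod A g"] RD[OF that(1)] RD[OF that(2)] that(3) by simp
    then show "Comp A g f \<in> ?R" using that by (auto simp: Hom_def)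
  qed
  have co_inj: "?co a = ?co b \<longleftrightarrow> a = b" if "a \<in> K" "b \<in> K" for a b
    by (rule code_inject[OF K(2) that])
  have catB: "category B"
    unfolding category_def
  proof (intro conjI ballI impI; (elim conjE)?)
    fix f assume "f \<in> Arr B"
    then obtain f' where f: "f' \<in> ?R" "f = ?ca f'" by auto
    show "Dom B f \<in> Obj B" "Cod B f \<in> Obj B" using f by auto
    have d: "Dom A f' \<in> K" "Cod A f' \<in> K" using f by auto
    show "Comp B f (Ide B (Dom B f)) = f" "Comp B (Ide B (Cod B f)) f = f"
      using f(1) d idr[OF RD[OF f(1)]] idl[OF RD[OF f(1)]] by (simp_all only: f(2) B da[OF f(1)] do da[OF ir])
    fix g assume "g \<in> Arr B" "Cod B f = Dom B g"
    then obtain g' where g: "g' \<in> ?R" "g = ?ca g'" "Cod A f' = Dom A g'"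
      using f d by (auto simp del: mem_Collect_eq simp: co_inj) (auto simp: co_inj)
    show "Comp B g f \<in> Hom B (Dom B f) (Cod B g)"
      using HomB[OF compR(1)[OF f(1) g(1,3)]] f g by (simp only: f(2) g(2) B da[OF f(1)] da[OF g(1)]) auto
    fix h assume "h \<in> Arr B" "Cod B g = Dom B h"
    then obtain h' where h: "h' \<in> ?R" "h = ?ca h'" "Cod A g' = Dom A h'"
      using g by (auto simp del: mem_Collect_eq simp: co_inj) (auto simp: co_inj)
    have "Comp A h' (Comp A g' f') = Comp A (Comp A h' g') f'"
      using RD[OF f(1)] RD[OF g(1)] RD[OF h(1)] g(3) h(3) by (intro assoc) auto
    then show "Comp B h (Comp B g f) = Comp B (Comp B h g) f"
      by (simp only: f(2) g(2) h(2) B da[OF f(1)] da[OF g(1)] da[OF h(1)] da[OF compR(2)[OF f(1) g(1,3)]]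
          da[OF compR(2)[OF g(1) h(1,3)]])
  next
    fix a assume "a \<in> Obj B"
    then obtain a' where a: "a' \<in> K" "a = ?co a'" by auto
    show "Ide B a \<in> Hom B a a" using HomB[OF ide[OF AO[OF a(1)]] a(1) a(1)] a by simp
  qed
  define \<Phi> where "\<Phi> = \<lparr>omap = restrict ?do (Obj B), amap = restrict ?da (Arr B)\<rparr>"
  \<comment> \<open>Conjugation by the chosen isomorphisms extends \<open>std\<close> to
    arrows.\<close>
  define tr where "tr f = Comp A (\<gamma> (Cod A f)) (Comp A f (\<beta> (Dom A f)))" for f
  define \<Psi> where "\<Psi> = \<lparr>omap = (\<lambda>a\<in>Obj A. ?co (std a)), amap = (\<lambda>f\<in>Arr A. ?ca (tr f))\<rparr>"
  have tr: "tr f \<in> Hom A (std a) (std b)" if f: "f \<in> Hom A a b" for f a b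
    using comp[OF comp[OF \<beta> f] \<gamma>] f categoryD(8,9)[OF A f] by (simp add: tr_def Hom_def)
  have trR: "tr f \<in> ?R" if f: "f \<in> Hom A a b" for f a b
    using RI[OF tr[OF f]] std categoryD(8,9)[OF A f] by blast
  have tr_nat: "Comp A f (\<beta> a) = Comp A (\<beta> b) (tr f)" "Comp A (\<gamma> b) f = Comp A (tr f) (\<gamma> a)"
    if f: "f \<in> Hom A a b" for f a b
  proof -
    have o: "a \<in> Obj A" "b \<in> Obj A" and d: "Dom A f = a" "Cod A f = b" using f categoryD(8,9)[OF A f] by (auto simp: Hom_def)
    note f\<beta> = comp[OF \<beta>[OF o(1)] f]
    show "Comp A f (\<beta> a) = Comp A (\<beta> b) (tr f)"
      using assoc[OF f\<beta> \<gamma>[OF o(2)] \<beta>[OF o(2)]] \<beta>\<gamma>[OF o(2)] idl[OF f\<beta>] by (simp add: tr_def d)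
    show "Comp A (\<gamma> b) f = Comp A (tr f) (\<gamma> a)"
      using assoc[OF \<gamma>[OF o(1)] f\<beta> \<gamma>[OF o(2)]] assoc[OF \<gamma>[OF o(1)] \<beta>[OF o(1)] f] \<beta>\<gamma>[OF o(1)] idr[OF f]
      by (simp add: tr_def d)
  qed
  have tr_ide: "tr (Ide A a) = Ide A (std a)" if a: "a \<in> Obj A" for a
    using ide[OF a] idl[OF \<beta>[OF a]] \<gamma>\<beta>[OF a] by (simp add: tr_def Hom_def)
  have tr_comp: "tr (Comp A g f) = Comp A (tr g) (tr f)" if f: "f \<in> Hom A a b" and g: "g \<in> Hom A b c" for f g a b c
  proof -
    have o: "a \<in> Obj A" "b \<in> Obj A" "c \<in> Obj A" using categoryD(8,9)[OF A f] categoryD(9)[OF A g] by auto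
    have "tr (Comp A g f) = Comp A (\<gamma> c) (Comp A (Comp A g f) (\<beta> a))"
      using comp[OF f g] by (simp add: tr_def Hom_def)
    also have "\<dots> = Comp A (\<gamma> c) (Comp A g (Comp A (\<beta> b) (tr f)))"
      using assoc[OF \<beta>[OF o(1)] f g] tr_nat(1)[OF f] by simp
    also have "\<dots> = Comp A (Comp A (\<gamma> c) g) (Comp A (\<beta> b) (tr f))"
      using assoc[OF comp[OF tr[OF f] \<beta>[OF o(2)]] g \<gamma>[OF o(3)]] .
    also have "\<dots> = Comp A (tr g) (Comp A (\<gamma> b) (Comp A (\<beta> b) (tr f)))"
      using assoc[OF comp[OF tr[OF f] \<beta>[OF o(2)]] \<gamma>[OF o(2)] tr[OF g]] tr_nat(2)[OF g] by simp
    also have "Comp A (\<gamma> b) (Comp A (\<beta> b) (tr f)) = tr f"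
      using assoc[OF tr[OF f] \<beta>[OF o(2)] \<gamma>[OF o(2)]] \<gamma>\<beta>[OF o(2)] idl[OF tr[OF f]] by simp
    finally show ?thesis .
  qed
  have F\<Phi>: "is_functor B A \<Phi>"
  proof (rule is_functorI)
    show "omap \<Phi> \<in> extensional (Obj B)" "amap \<Phi> \<in> extensional (Arr B)" by (simp_all add: \<Phi>_def)
    show "omap \<Phi> a \<in> Obj A" if "a \<in> Obj B" for a using that AO by (auto simp: \<Phi>_def)
    show "amap \<Phi> (Ide B a) = Ide A (omap \<Phi> a)" if aB: "a \<in> Obj B" for a
    proof -
      obtain a' where a': "a' \<in> K" "a = ?co a'" using aB by auto
      then have "amap \<Phi> (Ide B a) = ?da (?ca (Ide A a'))" using ir[OF a'(1)] by (simp add: \<Phi>_def del: mem_Collect_eq da)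
      also have "\<dots> = Ide A a'" by (rule da[OF ir[OF a'(1)]])
      finally show ?thesis using a' by (simp add: \<Phi>_def)
    qed
    fix f assume "f \<in> Arr B"
    then obtain f' where f: "f' \<in> ?R" "f = ?ca f'" by auto
    have d: "Dom A f' \<in> K" "Cod A f' \<in> K" using f by auto
    show "amap \<Phi> f \<in> Hom A (omap \<Phi> (Dom B f)) (omap \<Phi> (Cod B f))"
      using RD[OF f(1)] d f(1) by (simp add: \<Phi>_def f(2) del: mem_Collect_eq)
    fix g assume "g \<in> Arr B" "Cod B f = Dom B g"
    then obtain g' where g: "g' \<in> ?R" "g = ?ca g'" "Cod A f' = Dom A g'"
      using f d by (auto simp del: mem_Collect_eq simp: co_inj) (auto simp: co_inj)
    show "amap \<Phi> (Comp B g f) = Comp A (amap \<Phi> g) (amap \<Phi> f)"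
      using f(1) g(1) compR(2)[OF f(1) g(1,3)] by (simp add: \<Phi>_def f(2) g(2) del: mem_Collect_eq)
  qed
  have F\<Psi>: "is_functor A B \<Psi>"
  proof (rule is_functorI)
    show "omap \<Psi> \<in> extensional (Obj A)" "amap \<Psi> \<in> extensional (Arr A)" by (simp_all add: \<Psi>_def)
    show "omap \<Psi> a \<in> Obj B" if "a \<in> Obj A" for a using that std by (simp add: \<Psi>_def)
    show "amap \<Psi> (Ide A a) = Ide B (omap \<Psi> a)" if "a \<in> Obj A" for a
      using that std HomD(1)[OF ide[OF that]] by (simp add: \<Psi>_def tr_ide)
    fix f assume "f \<in> Arr A"
    then have f: "f \<in> Hom A (Dom A f) (Cod A f)" by (simp add: Hom_def)
    show "amap \<Psi> f \<in> Hom B (omap \<Psi> (Dom A f)) (omap \<Psi> (Cod A f))"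
      using HomB[OF tr[OF f] std std] categoryD(8,9)[OF A f] \<open>f \<in> Arr A\<close> by (simp add: \<Psi>_def del: B)
    fix g assume "g \<in> Arr A" "Cod A f = Dom A g"
    then have g: "g \<in> Hom A (Cod A f) (Cod A g)" by (simp add: Hom_def)
    show "amap \<Psi> (Comp A g f) = Comp B (amap \<Psi> g) (amap \<Psi> f)"
      using \<open>f \<in> Arr A\<close> \<open>g \<in> Arr A\<close> HomD(1)[OF comp[OF f g]] trR[OF f] trR[OF g] tr_comp[OF f g]
      by (simp add: \<Psi>_def del: mem_Collect_eq)
  qed
  have "comp_functor B \<Psi> \<Phi> = id_functor B"
  proof (rule functor_eqI[OF is_functor_comp[OF catB F\<Phi> F\<Psi>] is_functor_id[OF catB]])
    show "omap (comp_functor B \<Psi> \<Phi>) a = omap (id_functor B) a" if "a \<in> Obj B" for a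
      using that stdO AO by (auto simp: comp_functor_sel id_functor_def \<Phi>_def \<Psi>_def)
    fix f assume fB: "f \<in> Arr B"
    then obtain f' where f: "f' \<in> ?R" "f = ?ca f'" by auto
    have d: "Dom A f' \<in> K" "Cod A f' \<in> K" "f' \<in> Arr A" using f by auto
    have "tr f' = f'"
      using stdO[OF d(1)] stdO[OF d(2)] idr[OF RD[OF f(1)]] idl[OF RD[OF f(1)]] by (simp add: tr_def)
    then show "amap (comp_functor B \<Psi> \<Phi>) f = amap (id_functor B) f"
      using fB d(3) da[OF f(1)] by (simp add: comp_functor_sel id_functor_def \<Phi>_def \<Psi>_def f(2) del: B)
  qed
  then have iB: "isomorphic (functor_category B B) (comp_functor B \<Psi> \<Phi>) (id_functor B)"
    using isomorphic_refl[OF category_functor_category[OF catB catB]] is_functor_id[OF catB] by simp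
  have W: "is_functor A A (comp_functor A \<Phi> \<Psi>)" by (rule is_functor_comp[OF A F\<Psi> F\<Phi>])
  have Wo: "omap (comp_functor A \<Phi> \<Psi>) a = std a" if "a \<in> Obj A" for a
    using that std by (simp add: comp_functor_sel \<Phi>_def \<Psi>_def)
  have Wa: "amap (comp_functor A \<Phi> \<Psi>) f = tr f" if "f \<in> Arr A" for f
  proof -
    have "tr f \<in> ?R" by (rule trR[of f "Dom A f" "Cod A f"]) (simp add: Hom_def that)
    then show ?thesis using that da by (simp add: comp_functor_sel \<Phi>_def \<Psi>_def del: mem_Collect_eq)
  qed
  have io: "omap (id_functor A) a = a" if "a \<in> Obj A" for a using that by (simp add: id_functor_def)
  have ia: "amap (id_functor A) f = f" if "f \<in> Arr A" for f using that by (simp add: id_functor_def)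
  have "isomorphic (functor_category A A) (comp_functor A \<Phi> \<Psi>) (id_functor A)"
    unfolding isomorphic_def
  proof (intro conjI bexI)
    let ?b = "Arrow (comp_functor A \<Phi> \<Psi>) (restrict \<beta> (Obj A)) (id_functor A)"
    let ?g = "Arrow (id_functor A) (restrict \<gamma> (Obj A)) (comp_functor A \<Phi> \<Psi>)"
    show "comp_functor A \<Phi> \<Psi> \<in> Obj (functor_category A A)" "id_functor A \<in> Obj (functor_category A A)"
      using W is_functor_id[OF A] by simp_all
    have nat: "Comp A f (\<beta> (Dom A f)) = Comp A (\<beta> (Cod A f)) (tr f)" "Comp A (\<gamma> (Cod A f)) f = Comp A (tr f) (\<gamma> (Dom A f))"
      if "f \<in> Arr A" for f using tr_nat[of f "Dom A f" "Cod A f"] that by (simp_all add: Hom_def)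
    show "?b \<in> Hom (functor_category A A) (comp_functor A \<Phi> \<Psi>) (id_functor A)"
      using \<beta> nat(1) W is_functor_id[OF A] categoryD(1,2)[OF A]
      by (auto simp only: Arrow_functor_category_Hom is_nat_trans_def restrict_PiE_iff Wo Wa io ia restrict_apply' intro!: ballI)
    show "?g \<in> Hom (functor_category A A) (id_functor A) (comp_functor A \<Phi> \<Psi>)"
      using \<gamma> nat(2) W is_functor_id[OF A] categoryD(1,2)[OF A]
      by (auto simp only: Arrow_functor_category_Hom is_nat_trans_def restrict_PiE_iff Wo Wa io ia restrict_apply' intro!: ballI)
    show "Comp (functor_category A A) ?g ?b = Ide (functor_category A A) (comp_functor A \<Phi> \<Psi>)"
      using \<gamma>\<beta> by (auto simp: Wo intro!: restrict_ext)
    show "Comp (functor_category A A) ?b ?g = Ide (functor_category A A) (id_functor A)"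
      using \<beta>\<gamma> by (auto simp: id_functor_def intro!: restrict_ext)
  qed
  with iB have "is_equivalence A B \<Psi> \<Phi>" by (simp add: is_equivalence_def F\<Phi> F\<Psi>)
  note e = equivalence_functor_category[OF A catB category_set_cat this]
  note cop = category_opposite[OF catB]
  have sh: "sheaf_category (opposite B) (trivial_topology (opposite B)) =
      (functor_category B set_cat :: (('u, 'u, 'u) sfun, ('u, 'u, 'u) strans) cat)"
    using sheaf_category_trivial[OF cop] by simp
  have "\<exists>F G. is_equivalence (functor_category A (set_cat :: ('u set, 'u fn) cat))
      (sheaf_category (opposite B) (trivial_topology (opposite B)) :: (('u, 'u, 'u) sfun, ('u, 'u, 'u) strans) cat) F G"
    unfolding sh by (intro exI) (rule e)
  moreover have "small TYPE('u) (Obj (opposite B))" "small TYPE('u) (Arr (opposite B))"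
    using small_image[OF K(2)] small_image[OF R] by simp_all
  ultimately show ?thesis
    unfolding grothendieck_topos_def
    using category_functor_category[OF A category_set_cat] cop grothendieck_topology_trivial[OF cop] by blast
qed

text \<open>One standard set of each positive finite size, cut out of an injective sequence in
  \<open>'u\<close>, gives a skeleton with countably many objects and arrows.\<close>

lemma grothendieck_topos_IC: "grothendieck_topos TYPE('u) IC"
proof -
  obtain \<nu> :: "nat \<Rightarrow> 'u" where \<nu>: "inj \<nu>"
    using infinite_universe by (auto simp: infinite_iff_countable_subset)
  define st where "st n = \<nu> ` {..<n}" for n
  have cst: "card (st n) = n" for n by (simp add: st_def card_image inj_on_subset[OF \<nu>])
  have fst: "fs (st (card A))" if "fs A" for A :: "'u set"
    using that by (auto simp: st_def card_gt_0_iff lessThan_empty_iff)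
  let ?A = "finset_inh :: ('u set, 'u fn) cat"
  let ?K = "{A. fs A \<and> A = st (card A)}"
  have cO: "countable ?K"
    by (rule countable_subset[of _ "range st"]) auto
  have "countable {f \<in> Arr ?A. Dom ?A f \<in> ?K \<and> Cod ?A f \<in> ?K}"
  proof (rule countable_subset)
    show "{f \<in> Arr ?A. Dom ?A f \<in> ?K \<and> Cod ?A f \<in> ?K} \<subseteq> (\<Union>A\<in>?K. \<Union>B\<in>?K. (\<lambda>f. Arrow A f B) ` (A \<rightarrow>\<^sub>E B))"
    proof
      fix m assume m: "m \<in> {f \<in> Arr ?A. Dom ?A f \<in> ?K \<and> Cod ?A f \<in> ?K}"
      obtain A f B where f: "m = Arrow A f B" by (cases m)
      have "A \<in> ?K" "B \<in> ?K" "f \<in> A \<rightarrow>\<^sub>E B" using m unfolding f by (simp_all add: Arr_finset)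
      then show "m \<in> (\<Union>A\<in>?K. \<Union>B\<in>?K. (\<lambda>f. Arrow A f B) ` (A \<rightarrow>\<^sub>E B))"
        unfolding f by (intro UN_I[of A] UN_I[of B] imageI)
    qed
    show "countable (\<Union>A\<in>?K. \<Union>B\<in>?K. (\<lambda>f. Arrow A f B) ` (A \<rightarrow>\<^sub>E B))"
      by (intro countable_UN cO countable_image countable_finite finite_PiE) auto
  qed
  then have R: "small TYPE('u) {f \<in> Arr ?A. Dom ?A f \<in> ?K \<and> Cod ?A f \<in> ?K}" by (rule small_countable)
  \<comment> \<open>Mutually inverse bijections with the standard set, required to be identities
    when \<open>A\<close> is itself standard; this is the normalisation that the skeleton lemma asks
    for.\<close>
  define P where "P A h k \<longleftrightarrow> h \<in> A \<rightarrow>\<^sub>E st (card A) \<and> k \<in> st (card A) \<rightarrow>\<^sub>E A \<and>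
     (\<forall>a\<in>A. k (h a) = a) \<and> (\<forall>b\<in>st (card A). h (k b) = b) \<and>
     (A = st (card A) \<longrightarrow> h = (\<lambda>a\<in>A. a) \<and> k = (\<lambda>a\<in>A. a))" for A h k
  have ex: "\<exists>h k. P A h k" if A: "fs A" for A
  proof (cases "A = st (card A)")
    case True
    then show ?thesis unfolding P_def by (intro exI[of _ "\<lambda>a\<in>A. a"]) auto
  next
    case False
    obtain h where h: "bij_betw h A (st (card A))"
      using finite_same_card_bij[of A "st (card A)"] A fst[OF A] cst by auto
    let ?k = "inv_into A h"
    have k: "bij_betw ?k (st (card A)) A" by (rule bij_betw_inv_into[OF h])
    show ?thesis
      using False bij_betw_apply[OF h] bij_betw_apply[OF k] bij_betw_inv_into_left[OF h] bij_betw_inv_into_right[OF h]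
      unfolding P_def by (intro exI[of _ "restrict h A"] exI[of _ "restrict ?k (st (card A))"]) auto
  qed
  define h where "h A = (SOME h. \<exists>k. P A h k)" for A
  define k where "k A = (SOME k. P A (h A) k)" for A
  have "P A (h A) (k A)" if "fs A" for A
    unfolding k_def using someI_ex[OF ex[OF that]] unfolding h_def[symmetric] by (rule someI_ex)
  then have hk: "h A \<in> A \<rightarrow>\<^sub>E st (card A)" "k A \<in> st (card A) \<rightarrow>\<^sub>E A"
    "a \<in> A \<Longrightarrow> k A (h A a) = a" "b \<in> st (card A) \<Longrightarrow> h A (k A b) = b"
    "A = st (card A) \<Longrightarrow> h A = (\<lambda>a\<in>A. a) \<and> k A = (\<lambda>a\<in>A. a)" if "fs A" for A a b
    using that unfolding P_def by blast+
  show ?thesis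
    unfolding IC_Sets
  proof (rule grothendieck_topos_functor_category[OF finset.cat _ _ R,
        of "\<lambda>A. st (card A)" "\<lambda>A. Arrow A (h A) (st (card A))" "\<lambda>A. Arrow (st (card A)) (k A) A"])
    show "?K \<subseteq> Obj ?A" by (auto simp: Obj_finset)
    show "small TYPE('u) ?K" by (rule small_countable[OF cO])
    fix A :: "'u set"
    { assume "A \<in> Obj ?A"
      then have A: "fs A" by (simp add: Obj_finset)
      show "st (card A) \<in> ?K" using fst[OF A] cst by simp
      show "Arrow A (h A) (st (card A)) \<in> Hom ?A A (st (card A))"
        "Arrow (st (card A)) (k A) A \<in> Hom ?A (st (card A)) A"
        using A fst[OF A] hk(1,2)[OF A] by (simp_all add: Hom_def Arr_finset)
      show "Comp ?A (Arrow (st (card A)) (k A) A) (Arrow A (h A) (st (card A))) = Ide ?A A"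
        "Comp ?A (Arrow A (h A) (st (card A))) (Arrow (st (card A)) (k A) A) = Ide ?A (st (card A))"
        using hk(3,4)[OF A] by (auto simp: compose_def intro!: restrict_ext) }
    show "st (card A) = A \<and> Arrow A (h A) (st (card A)) = Ide ?A A \<and> Arrow (st (card A)) (k A) A = Ide ?A A"
      if "A \<in> ?K" using that hk(5)[of A] by auto
  qed
qed

end

theorem theorem6p18:
  assumes "inaccessible TYPE('u)"
  shows "\<exists>\<L> :: nat language.
    countable (symbols \<L>) \<and> (\<forall>l\<in>symbols \<L>. arity \<L> l \<noteq> 0) \<and>
    (let \<E> = (encoding_topos \<L> :: ((nat, 'u) enc_obj, (nat, 'u) enc_arr) cat) in
       proper_class_many TYPE('u) {X. inhabited_topos_rigid TYPE('u) \<E> X} (isomorphic \<E>) \<and>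
       proper_class_many TYPE('u)
         (quotient_topoi TYPE('u) \<E> ::
            (('u inh_obj, 'u inh_arr) cat
              \<times> ((nat, 'u) enc_obj, (nat, 'u) enc_arr, 'u inh_obj, 'u inh_arr) geom) set)
         (equivalent_quotients \<E>))"
proof -
  interpret inaccessible_universe "TYPE('u)" by standard (rule assms)
  show ?thesis
    unfolding Let_def
  proof (intro exI[of _ empty_lang] conjI)
    show "countable (symbols empty_lang)" "\<forall>l\<in>symbols empty_lang. arity empty_lang l \<noteq> 0"
      by (simp_all add: empty_lang_def)
  qed (rule proper_class_rigid, rule proper_class_quotients[OF grothendieck_topos_IC])
qed

end
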